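(* Let $R$ be an fqf-ring. Then $\lambda\text{-}\dim(R)\leq 3$.
   Context: All rings are commutative with unity. For $R$-modules $M$ and $V$, $V$ is $M$-\underline{flat} (the underlining distinguishes this notion from ordinary flatness) if for any $R$-module $M'$, any epimorphism $p:M\rightarrow M'$, any homomorphism $u:V\rightarrow M'$, any finitely presented $R$-module $G$ and any homomorphism $v:G\rightarrow V$, there exists a homomorphism $q:G\rightarrow M$ such that $pq=uv$. $V$ is quasi-flat if $V$ is $V^n$-\underline{flat} for each integer $n>0$. $R$ is an fqf-ring if each finitely generated ideal of $R$ is quasi-flat. An $R$-module $E$ is of finite $n$-presentation if there is an exact sequence $F_n\rightarrow F_{n-1}\rightarrow\cdots\rightarrow F_1\rightarrow F_0\rightarrow E\rightarrow 0$ with all $F_i$ free $R$-modules of finite rank. Put $\lambda_R(E)=\sup\{n\mid \text{there is a finite } n\text{-presentation of } E\}$, and $\lambda_R(E)=-1$ if $E$ is not finitely generated. The $\lambda$-dimension $\lambda\text{-}\dim(R)$ is the least integer $n$ (or $\infty$ if none exists) such that, for every $R$-module $E$, $\lambda_R(E)\geq n$ implies $\lambda_R(E)=\infty$. *)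

theory Defs
  imports "HOL-Library.Extended_Real" "HOL-Algebra.Module" "HOL-Algebra.Ideal"
begin

text \<open>Modules are the records of HOL-Algebra; their fields \<open>mult\<close> and \<open>one\<close> play no role.\<close>

definition mod_hom :: "('a, 'r) ring_scheme \<Rightarrow> ('a, 'm) module \<Rightarrow> ('a, 'n) module \<Rightarrow> ('m \<Rightarrow> 'n) set"
  where "mod_hom R M N = {f \<in> carrier M \<rightarrow> carrier N.
     (\<forall>x\<in>carrier M. \<forall>y\<in>carrier M. f (x \<oplus>\<^bsub>M\<^esub> y) = f x \<oplus>\<^bsub>N\<^esub> f y) \<and>
     (\<forall>a\<in>carrier R. \<forall>x\<in>carrier M. f (a \<odot>\<^bsub>M\<^esub> x) = a \<odot>\<^bsub>N\<^esub> f x)}"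

definition mod_epi :: "('a, 'r) ring_scheme \<Rightarrow> ('a, 'm) module \<Rightarrow> ('a, 'n) module \<Rightarrow> ('m \<Rightarrow> 'n) set"
  where "mod_epi R M N = {f \<in> mod_hom R M N. f ` carrier M = carrier N}"

definition mod_iso :: "('a, 'r) ring_scheme \<Rightarrow> ('a, 'm) module \<Rightarrow> ('a, 'n) module \<Rightarrow> ('m \<Rightarrow> 'n) set"
  where "mod_iso R M N = {f \<in> mod_hom R M N. bij_betw f (carrier M) (carrier N)}"

definition mod_ker :: "('a, 'm) module \<Rightarrow> ('a, 'n) module \<Rightarrow> ('m \<Rightarrow> 'n) \<Rightarrow> 'm set"
  where "mod_ker M N f = {x \<in> carrier M. f x = \<zero>\<^bsub>N\<^esub>}"

definition ideal_module :: "('a, 'r) ring_scheme \<Rightarrow> 'a set \<Rightarrow> ('a, 'a) module"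
  where "ideal_module R I =
    \<lparr>carrier = I, mult = mult R, one = one R, zero = zero R, add = add R, smult = mult R\<rparr>"

definition mod_power :: "('a, 'm) module \<Rightarrow> nat \<Rightarrow> ('a, nat \<Rightarrow> 'm) module"
  where "mod_power M n =
    \<lparr>carrier = {..<n} \<rightarrow>\<^sub>E carrier M,
     mult = (\<lambda>f g. \<lambda>i\<in>{..<n}. f i \<otimes>\<^bsub>M\<^esub> g i),
     one = (\<lambda>i\<in>{..<n}. \<one>\<^bsub>M\<^esub>),
     zero = (\<lambda>i\<in>{..<n}. \<zero>\<^bsub>M\<^esub>),
     add = (\<lambda>f g. \<lambda>i\<in>{..<n}. f i \<oplus>\<^bsub>M\<^esub> g i),
     smult = (\<lambda>a f. \<lambda>i\<in>{..<n}. a \<odot>\<^bsub>M\<^esub> f i)\<rparr>"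

definition free_of_finite_rank :: "('a, 'r) ring_scheme \<Rightarrow> ('a, 'm) module \<Rightarrow> bool"
  where "free_of_finite_rank R F \<longleftrightarrow> module R F \<and>
    (\<exists>k f. f \<in> mod_iso R (mod_power (ideal_module R (carrier R)) k) F)"

definition finitely_generated_module :: "('a, 'r) ring_scheme \<Rightarrow> ('a, 'm) module \<Rightarrow> bool"
  where "finitely_generated_module R E \<longleftrightarrow> module R E \<and>
    (\<exists>S. finite S \<and> S \<subseteq> carrier E \<and> (\<forall>N. submodule N R E \<and> S \<subseteq> N \<longrightarrow> N = carrier E))"

text \<open>
  \<open>F n \<rightarrow> \<dots> \<rightarrow> F 1 \<rightarrow> F 0 \<rightarrow> E \<rightarrow> 0\<close> is exact, where \<open>e\<close> is \<open>F 0 \<rightarrow> E\<close> and \<open>d i\<close> is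
  \<open>F (i + 1) \<rightarrow> F i\<close>; no exactness is required at \<open>F n\<close>.
\<close>
definition finite_n_presentation ::
  "('a, 'r) ring_scheme \<Rightarrow> nat \<Rightarrow> (nat \<Rightarrow> ('a, 'f) module) \<Rightarrow> (nat \<Rightarrow> 'f \<Rightarrow> 'f) \<Rightarrow> ('f \<Rightarrow> 'e) \<Rightarrow> ('a, 'e) module \<Rightarrow> bool"
  where "finite_n_presentation R n F d e E \<longleftrightarrow>
    (\<forall>i\<le>n. free_of_finite_rank R (F i)) \<and>
    e \<in> mod_epi R (F 0) E \<and>
    (\<forall>i<n. d i \<in> mod_hom R (F (Suc i)) (F i)) \<and>
    (0 < n \<longrightarrow> d 0 ` carrier (F 1) = mod_ker (F 0) E e) \<and>
    (\<forall>i. Suc i < n \<longrightarrow>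
       d (Suc i) ` carrier (F (Suc (Suc i))) = mod_ker (F (Suc i)) (F i) (d i))"

text \<open>
  The free modules may be taken with elements of type \<open>nat \<Rightarrow> 'a\<close>, since this type contains
  all the \<open>R\<^sup>k\<close>; see \<open>finite_n_presentation_imp_finitely_n_presented\<close> below.
\<close>
definition finitely_n_presented :: "('a, 'r) ring_scheme \<Rightarrow> nat \<Rightarrow> ('a, 'e) module \<Rightarrow> bool"
  where "finitely_n_presented R n E \<longleftrightarrow> module R E \<and>
    (\<exists>(F :: nat \<Rightarrow> ('a, nat \<Rightarrow> 'a) module) d e. finite_n_presentation R n F d e E)"

abbreviation finitely_presented :: "('a, 'r) ring_scheme \<Rightarrow> ('a, 'e) module \<Rightarrow> bool"
  where "finitely_presented R E \<equiv> finitely_n_presented R 1 E"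

definition module_lambda :: "('a, 'r) ring_scheme \<Rightarrow> ('a, 'e) module \<Rightarrow> ereal"
  where "module_lambda R E =
    (if finitely_generated_module R E
     then Sup {ereal (real n) | n. finitely_n_presented R n E} else -1)"

text \<open>
  The argument \<open>TYPE('e)\<close> is the type of the elements of the modules \<open>E\<close>; it has to be
  a parameter because a definition cannot quantify over types. By \<open>lambda_dim_universe\<close> below
  the value is largest for \<open>'e = (nat \<Rightarrow> 'a) set\<close>.
  Over a nonzero ring, a module that is not finitely generated excludes negative \<open>n\<close>; over the
  zero ring every integer would do, and the value is \<open>0\<close> here.
\<close>
definition lambda_dim :: "'e itself \<Rightarrow> ('a, 'r) ring_scheme \<Rightarrow> enat"
  where "lambda_dim _ R = Inf {enat n | n. \<forall>E :: ('a, 'e) module.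
     module R E \<longrightarrow> module_lambda R E \<ge> ereal (real n) \<longrightarrow> module_lambda R E = \<infinity>}"

text \<open>
  \<open>V\<close> is \<open>M\<close>-flat in the relative (underlined) sense. The quotient \<open>M'\<close> of \<open>M\<close> and the finitely presented
  module \<open>G\<close> (a quotient of some \<open>R\<^sup>k\<close>) range over types that contain
  all of these up to isomorphism; \<open>rel_flatD\<close> below removes the restriction.
\<close>
definition rel_flat :: "('a, 'r) ring_scheme \<Rightarrow> ('a, 'm) module \<Rightarrow> ('a, 'v) module \<Rightarrow> bool"
  where "rel_flat R M V \<longleftrightarrow>
    (\<forall>(M' :: ('a, 'm set) module) p u (G :: ('a, (nat \<Rightarrow> 'a) set) module) v.
       module R M' \<longrightarrow> p \<in> mod_epi R M M' \<longrightarrow> u \<in> mod_hom R V M' \<longrightarrow>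
       finitely_presented R G \<longrightarrow> v \<in> mod_hom R G V \<longrightarrow>
       (\<exists>q \<in> mod_hom R G M. \<forall>x \<in> carrier G. p (q x) = u (v x)))"

definition quasi_flat :: "('a, 'r) ring_scheme \<Rightarrow> ('a, 'v) module \<Rightarrow> bool"
  where "quasi_flat R V \<longleftrightarrow> (\<forall>n>0. rel_flat R (mod_power V n) V)"

definition fqf_ring :: "('a, 'r) ring_scheme \<Rightarrow> bool"
  where "fqf_ring R \<longleftrightarrow> cring R \<and>
    (\<forall>S. finite S \<longrightarrow> S \<subseteq> carrier R \<longrightarrow> quasi_flat R (ideal_module R (Idl\<^bsub>R\<^esub> S)))"


section \<open>The constructions are modules\<close>

lemma module_ideal_module:
  assumes "cring R" "ideal I R"
  shows "module R (ideal_module R I)"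
proof -
  interpret cring R by fact
  interpret I: ideal I R by fact
  have sub: "x \<in> carrier R" if "x \<in> I" for x
    using that I.Icarr by blast
  have inv: "\<exists>y\<in>I. y \<oplus>\<^bsub>R\<^esub> x = \<zero>\<^bsub>R\<^esub>" if "x \<in> I" for x
    using that I.a_inv_closed sub l_neg by blast
  show ?thesis
    unfolding ideal_module_def
    by (intro moduleI abelian_groupI)
       (auto simp: assms sub a_assoc m_assoc l_distr r_distr I.I_l_closed intro: a_comm inv)
qed

lemma module_mod_power:
  fixes R :: "('a, 'r) ring_scheme" and M :: "('a, 'm) module"
  assumes "module R M"
  shows "module R (mod_power M n)"
proof -
  interpret module R M by fact
  have inv: "\<exists>y\<in>{..<n} \<rightarrow>\<^sub>E carrier M. (\<lambda>i\<in>{..<n}. y i \<oplus>\<^bsub>M\<^esub> x i) = (\<lambda>i\<in>{..<n}. \<zero>\<^bsub>M\<^esub>)"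
    if "x \<in> {..<n} \<rightarrow>\<^sub>E carrier M" for x
    by (rule bexI[of _ "\<lambda>i\<in>{..<n}. \<ominus>\<^bsub>M\<^esub> x i"]) (use that in \<open>auto simp: fun_eq_iff M.l_neg PiE_iff\<close>)
  have c: "x i \<in> carrier M" if "x \<in> {..<n} \<rightarrow>\<^sub>E carrier M" "i < n" for x i
    using that by auto
  have r: "restrict f {..<n} = restrict g {..<n}" if "\<And>i. i < n \<Longrightarrow> f i = g i" for f g :: "nat \<Rightarrow> 'm"
    using that by (auto simp: restrict_def)
  have e: "restrict f {..<n} = x" if "\<And>i. i < n \<Longrightarrow> f i = x i" "x \<in> {..<n} \<rightarrow>\<^sub>E carrier M" for f x
    using r[of f x] that PiE_restrict[of x "{..<n}"] by auto
  have P: "carrier (mod_power M n) = {..<n} \<rightarrow>\<^sub>E carrier M"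
    "\<zero>\<^bsub>mod_power M n\<^esub> = (\<lambda>i\<in>{..<n}. \<zero>\<^bsub>M\<^esub>)"
    "x \<oplus>\<^bsub>mod_power M n\<^esub> y = (\<lambda>i\<in>{..<n}. x i \<oplus>\<^bsub>M\<^esub> y i)"
    "a \<odot>\<^bsub>mod_power M n\<^esub> x = (\<lambda>i\<in>{..<n}. a \<odot>\<^bsub>M\<^esub> x i)" for x y a
    by (simp_all add: mod_power_def)
  have "abelian_group (mod_power M n)"
  proof (rule abelian_groupI, unfold P)
    fix x y z
    assume xyz: "x \<in> {..<n} \<rightarrow>\<^sub>E carrier M" "y \<in> {..<n} \<rightarrow>\<^sub>E carrier M" "z \<in> {..<n} \<rightarrow>\<^sub>E carrier M"
    show "(\<lambda>i\<in>{..<n}. (\<lambda>i\<in>{..<n}. x i \<oplus>\<^bsub>M\<^esub> y i) i \<oplus>\<^bsub>M\<^esub> z i) =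
      (\<lambda>i\<in>{..<n}. x i \<oplus>\<^bsub>M\<^esub> (\<lambda>i\<in>{..<n}. y i \<oplus>\<^bsub>M\<^esub> z i) i)"
      by (rule r) (simp add: c[OF xyz(1)] c[OF xyz(2)] c[OF xyz(3)] M.a_assoc)
  next
    fix x y
    assume xy: "x \<in> {..<n} \<rightarrow>\<^sub>E carrier M" "y \<in> {..<n} \<rightarrow>\<^sub>E carrier M"
    show "(\<lambda>i\<in>{..<n}. x i \<oplus>\<^bsub>M\<^esub> y i) \<in> {..<n} \<rightarrow>\<^sub>E carrier M"
      using c[OF xy(1)] c[OF xy(2)] by simp
    show "(\<lambda>i\<in>{..<n}. x i \<oplus>\<^bsub>M\<^esub> y i) = (\<lambda>i\<in>{..<n}. y i \<oplus>\<^bsub>M\<^esub> x i)"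
      by (rule r) (simp add: c[OF xy(1)] c[OF xy(2)] M.a_comm)
  next
    fix x
    assume x: "x \<in> {..<n} \<rightarrow>\<^sub>E carrier M"
    show "(\<lambda>i\<in>{..<n}. (\<lambda>i\<in>{..<n}. \<zero>\<^bsub>M\<^esub>) i \<oplus>\<^bsub>M\<^esub> x i) = x"
      by (rule e[OF _ x]) (simp add: c[OF x])
    show "\<exists>y\<in>{..<n} \<rightarrow>\<^sub>E carrier M. (\<lambda>i\<in>{..<n}. y i \<oplus>\<^bsub>M\<^esub> x i) = (\<lambda>i\<in>{..<n}. \<zero>\<^bsub>M\<^esub>)"
      by (rule inv[OF x])
  qed simp
  thus ?thesis
  proof (rule moduleI[OF R.cring_axioms], unfold P)
    fix a b x y
    assume a: "a \<in> carrier R" and x: "x \<in> {..<n} \<rightarrow>\<^sub>E carrier M"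
    show "(\<lambda>i\<in>{..<n}. a \<odot>\<^bsub>M\<^esub> x i) \<in> {..<n} \<rightarrow>\<^sub>E carrier M"
      using a c[OF x] by simp
    show "(\<lambda>i\<in>{..<n}. (a \<oplus>\<^bsub>R\<^esub> b) \<odot>\<^bsub>M\<^esub> x i) =
      (\<lambda>i\<in>{..<n}. (\<lambda>i\<in>{..<n}. a \<odot>\<^bsub>M\<^esub> x i) i \<oplus>\<^bsub>M\<^esub> (\<lambda>i\<in>{..<n}. b \<odot>\<^bsub>M\<^esub> x i) i)"
      if "b \<in> carrier R"
      by (rule r) (simp add: a that c[OF x] smult_l_distr)
    show "(\<lambda>i\<in>{..<n}. (a \<otimes>\<^bsub>R\<^esub> b) \<odot>\<^bsub>M\<^esub> x i) =
      (\<lambda>i\<in>{..<n}. a \<odot>\<^bsub>M\<^esub> (\<lambda>i\<in>{..<n}. b \<odot>\<^bsub>M\<^esub> x i) i)"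
      if "b \<in> carrier R"
      by (rule r) (simp add: a that c[OF x] smult_assoc1)
    show "(\<lambda>i\<in>{..<n}. a \<odot>\<^bsub>M\<^esub> (\<lambda>i\<in>{..<n}. x i \<oplus>\<^bsub>M\<^esub> y i) i) =
      (\<lambda>i\<in>{..<n}. (\<lambda>i\<in>{..<n}. a \<odot>\<^bsub>M\<^esub> x i) i \<oplus>\<^bsub>M\<^esub> (\<lambda>i\<in>{..<n}. a \<odot>\<^bsub>M\<^esub> y i) i)"
      if y: "y \<in> {..<n} \<rightarrow>\<^sub>E carrier M"
      by (rule r) (simp add: a c[OF x] c[OF y] smult_r_distr)
  next
    fix x
    assume x: "x \<in> {..<n} \<rightarrow>\<^sub>E carrier M"
    show "(\<lambda>i\<in>{..<n}. \<one>\<^bsub>R\<^esub> \<odot>\<^bsub>M\<^esub> x i) = x"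
      by (rule e[OF _ x]) (simp add: c[OF x])
  qed
qed


section \<open>Independence of the types of the elements\<close>

definition mod_transport :: "('m \<Rightarrow> 'n) \<Rightarrow> ('a, 'm) module \<Rightarrow> ('a, 'n) module"
  where "mod_transport g M =
    (let h = inv_into (carrier M) g in
    \<lparr>carrier = g ` carrier M,
     mult = (\<lambda>x y. g (h x \<otimes>\<^bsub>M\<^esub> h y)),
     one = g \<one>\<^bsub>M\<^esub>,
     zero = g \<zero>\<^bsub>M\<^esub>,
     add = (\<lambda>x y. g (h x \<oplus>\<^bsub>M\<^esub> h y)),
     smult = (\<lambda>a x. g (a \<odot>\<^bsub>M\<^esub> h x))\<rparr>)"

lemma
  assumes "module R M" "inj_on g (carrier M)"
  shows module_mod_transport: "module R (mod_transport g M)"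
    and mod_transport_iso: "g \<in> mod_iso R M (mod_transport g M)"
proof -
  interpret module R M by fact
  note [simp] = inv_into_f_f[OF assms(2)]
  have inv: "\<exists>y\<in>carrier M. g (y \<oplus>\<^bsub>M\<^esub> x) = g \<zero>\<^bsub>M\<^esub>" if "x \<in> carrier M" for x
    using that M.l_neg M.a_inv_closed by metis
  show "module R (mod_transport g M)"
    unfolding mod_transport_def Let_def
    by (intro moduleI abelian_groupI)
       (auto simp: R.cring_axioms M.a_assoc smult_l_distr smult_r_distr smult_assoc1
         intro: arg_cong[OF M.a_comm] inv)
  show "g \<in> mod_iso R M (mod_transport g M)"
    using assms(2)
    by (auto simp: mod_iso_def mod_hom_def mod_transport_def Let_def bij_betw_def)
qed

lemma mod_hom_comp:
  assumes "f \<in> mod_hom R M N" "g \<in> mod_hom R N P"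
  shows "g \<circ> f \<in> mod_hom R M P"
  using assms by (auto simp: mod_hom_def Pi_iff)

lemma mod_epi_comp:
  assumes "f \<in> mod_epi R M N" "g \<in> mod_epi R N P"
  shows "g \<circ> f \<in> mod_epi R M P"
  using assms mod_hom_comp[of f R M N g P] unfolding mod_epi_def
  by (simp add: image_comp[symmetric] del: o_apply)

lemma mod_iso_imp_epi: "f \<in> mod_iso R M N \<Longrightarrow> f \<in> mod_epi R M N"
  by (simp add: mod_iso_def mod_epi_def bij_betw_def)

lemma mod_hom_zero:
  assumes "module R M" "module R N" "f \<in> mod_hom R M N"
  shows "f \<zero>\<^bsub>M\<^esub> = \<zero>\<^bsub>N\<^esub>"
proof -
  interpret M: module R M by fact
  interpret N: module R N by fact
  have R0: "\<zero>\<^bsub>R\<^esub> \<in> carrier R" by simp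
  have "f (\<zero>\<^bsub>R\<^esub> \<odot>\<^bsub>M\<^esub> \<zero>\<^bsub>M\<^esub>) = \<zero>\<^bsub>R\<^esub> \<odot>\<^bsub>N\<^esub> f \<zero>\<^bsub>M\<^esub>"
    using assms(3) R0 M.M.zero_closed unfolding mod_hom_def by blast
  moreover have "f \<zero>\<^bsub>M\<^esub> \<in> carrier N"
    using assms(3) by (auto simp: mod_hom_def)
  ultimately show ?thesis by simp
qed

lemma mod_iso_comp:
  assumes "f \<in> mod_iso R M N" "g \<in> mod_iso R N P"
  shows "g \<circ> f \<in> mod_iso R M P"
  using assms mod_hom_comp[of f R M N g P] bij_betw_trans
  unfolding mod_iso_def by blast

lemma mod_iso_inv:
  assumes "module R M" "f \<in> mod_iso R M N"
  shows "inv_into (carrier M) f \<in> mod_iso R N M"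
proof -
  interpret module R M by fact
  have f: "f \<in> mod_hom R M N" "inj_on f (carrier M)" "carrier N = f ` carrier M"
    using assms(2) by (auto simp: mod_iso_def bij_betw_def)
  have add: "f x \<oplus>\<^bsub>N\<^esub> f y = f (x \<oplus>\<^bsub>M\<^esub> y)" if "x \<in> carrier M" "y \<in> carrier M" for x y
    using f that by (auto simp: mod_hom_def)
  have sm: "a \<odot>\<^bsub>N\<^esub> f x = f (a \<odot>\<^bsub>M\<^esub> x)" if "a \<in> carrier R" "x \<in> carrier M" for a x
    using f that by (auto simp: mod_hom_def)
  have "inv_into (carrier M) f \<in> mod_hom R N M"
    by (auto simp: mod_hom_def f inv_into_f_f[OF f(2)] add sm)
  thus ?thesis
    using assms(2) by (auto simp: mod_iso_def bij_betw_inv_into)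
qed

lemma finite_n_presentation_iso:
  assumes "module R E" "module R E'" "g \<in> mod_iso R E E'" "finite_n_presentation R n F d e E"
  shows "finite_n_presentation R n F d (g \<circ> e) E'"
proof -
  have g: "g \<in> mod_hom R E E'" "inj_on g (carrier E)" "g ` carrier E = carrier E'"
    using assms(3) by (auto simp: mod_iso_def bij_betw_def)
  have e: "e \<in> mod_hom R (F 0) E" "e ` carrier (F 0) = carrier E"
    using assms(4) by (auto simp: finite_n_presentation_def mod_epi_def)
  interpret E: module R E by fact
  have "g x = \<zero>\<^bsub>E'\<^esub> \<longleftrightarrow> x = \<zero>\<^bsub>E\<^esub>" if "x \<in> carrier E" for x
    using that g(2) mod_hom_zero[OF assms(1,2) g(1)] E.M.zero_closed
    by (metis inj_on_eq_iff)
  hence "mod_ker (F 0) E' (g \<circ> e) = mod_ker (F 0) E e"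
    using e(2) by (auto simp: mod_ker_def)
  moreover have "g \<circ> e \<in> mod_epi R (F 0) E'"
    by (rule mod_epi_comp[OF _ mod_iso_imp_epi[OF assms(3)]])
       (use assms(4) in \<open>simp add: finite_n_presentation_def\<close>)
  ultimately show ?thesis
    using assms(4) by (simp add: finite_n_presentation_def)
qed

lemma finitely_n_presented_iso:
  assumes "module R E'" "g \<in> mod_iso R E E'" "finitely_n_presented R n E"
  shows "finitely_n_presented R n E'"
  using assms finite_n_presentation_iso unfolding finitely_n_presented_def by blast

lemma free_of_finite_rank_iso:
  assumes "module R F'" "g \<in> mod_iso R F F'" "free_of_finite_rank R F"
  shows "free_of_finite_rank R F'"
  using assms mod_iso_comp unfolding free_of_finite_rank_def by blast

lemma finite_n_presentation_imp_finitely_n_presented: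
  fixes R :: "('a, 'r) ring_scheme" and F :: "nat \<Rightarrow> ('a, 'f) module" and E :: "('a, 'e) module"
  assumes "module R E" "finite_n_presentation R n F d e E"
  shows "finitely_n_presented R n E"
proof -
  let ?P = "\<lambda>k. mod_power (ideal_module R (carrier R)) k"
  have R: "cring R" using assms(1) by (simp add: module_def)
  interpret R: cring R by fact
  have modP: "module R (?P k)" for k
    by (intro module_mod_power module_ideal_module R R.oneideal)
  have F: "free_of_finite_rank R (F i)" if "i \<le> n" for i
    using assms(2) that by (auto simp: finite_n_presentation_def)
  have "\<exists>k f. f \<in> mod_iso R (?P k) (F i)" if "i \<le> n" for i
    using F[OF that] by (auto simp: free_of_finite_rank_def)
  then obtain k f where f: "\<And>i. i \<le> n \<Longrightarrow> f i \<in> mod_iso R (?P (k i)) (F i)"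
    by metis
  define h where "h i = inv_into (carrier (?P (k i))) (f i)" for i
  have h: "h i \<in> mod_iso R (F i) (?P (k i))" if "i \<le> n" for i
    unfolding h_def by (rule mod_iso_inv[OF modP f[OF that]])
  have fhom: "f i \<in> mod_hom R (?P (k i)) (F i)"
    and fim: "f i ` carrier (?P (k i)) = carrier (F i)" if "i \<le> n" for i
    using f[OF that] by (auto simp: mod_iso_def bij_betw_def)
  have hhom: "h i \<in> mod_hom R (F i) (?P (k i))"
    and him: "h i ` carrier (F i) = carrier (?P (k i))"
    and hinj: "inj_on (h i) (carrier (F i))" if "i \<le> n" for i
    using h[OF that] by (auto simp: mod_iso_def bij_betw_def)
  have fc: "f i x \<in> carrier (F i)" if "i \<le> n" "x \<in> carrier (?P (k i))" for i x
    using fim that by blast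
  have hf: "h i (f i x) = x" if "i \<le> n" "x \<in> carrier (?P (k i))" for i x
    using f[OF that(1)] that(2) by (auto simp: h_def mod_iso_def bij_betw_def)
  have fh: "f i (h i x) = x" if "i \<le> n" "x \<in> carrier (F i)" for i x
    using fim[OF that(1)] that(2) unfolding h_def by (simp add: f_inv_into_f)
  have modF: "module R (F i)" if "i \<le> n" for i
    using F[OF that] by (simp add: free_of_finite_rank_def)
  have hz: "h i x = \<zero>\<^bsub>?P (k i)\<^esub> \<longleftrightarrow> x = \<zero>\<^bsub>F i\<^esub>" if "i \<le> n" "x \<in> carrier (F i)" for i x
  proof -
    have "\<zero>\<^bsub>F i\<^esub> \<in> carrier (F i)"
      using modF[OF that(1)] by (meson abelian_group.axioms(1) abelian_monoid.zero_closed module_def)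
    thus ?thesis
      using hinj[OF that(1)] that(2) mod_hom_zero[OF modF[OF that(1)] modP hhom[OF that(1)]]
      by (metis inj_on_eq_iff)
  qed
  define F' where "F' i = ?P (k i)" for i
  define d' where "d' i = h i \<circ> d i \<circ> f (Suc i)" for i
  define e' where "e' = e \<circ> f 0"
  have kerim: "mod_ker (F' i) N (t \<circ> f i) = h i ` mod_ker (F i) N' t'"
    if "i \<le> n" "\<And>x. x \<in> carrier (F i) \<Longrightarrow> t x = \<zero>\<^bsub>N\<^esub> \<longleftrightarrow> t' x = \<zero>\<^bsub>N'\<^esub>"
    for i t t' and N :: "('a, 'n) module" and N' :: "('a, 'n') module"
    unfolding mod_ker_def F'_def
    using that(2) fc[OF that(1)] hf[OF that(1)] fh[OF that(1)] him[OF that(1)]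
    by (auto simp: image_iff) (metis)+
  have dc: "d i x \<in> carrier (F i)" if "i < n" "x \<in> carrier (F (Suc i))" for i x
    using assms(2) that by (auto simp: finite_n_presentation_def mod_hom_def)
  have d'im: "d' i ` carrier (F' (Suc i)) = h i ` d i ` carrier (F (Suc i))" if "i < n" for i
    using fim[of "Suc i"] that unfolding d'_def F'_def image_comp[symmetric] by simp
  have "finite_n_presentation R n F' d' e' E"
    unfolding finite_n_presentation_def
  proof (intro conjI allI impI)
    fix i assume "i \<le> n"
    show "free_of_finite_rank R (F' i)"
      unfolding F'_def by (rule free_of_finite_rank_iso[OF modP h[OF \<open>i \<le> n\<close>] F[OF \<open>i \<le> n\<close>]])
  next
    have "e \<in> mod_epi R (F 0) E"
      using assms(2) by (auto simp: finite_n_presentation_def)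
    thus "e' \<in> mod_epi R (F' 0) E"
      unfolding e'_def F'_def by (rule mod_epi_comp[OF mod_iso_imp_epi[OF f[OF le0]]])
  next
    fix i assume "i < n"
    hence "d i \<in> mod_hom R (F (Suc i)) (F i)"
      using assms(2) by (auto simp: finite_n_presentation_def)
    thus "d' i \<in> mod_hom R (F' (Suc i)) (F' i)"
      unfolding d'_def F'_def using fhom[of "Suc i"] hhom[of i] \<open>i < n\<close>
      by (intro mod_hom_comp) auto
  next
    assume "0 < n"
    hence "d 0 ` carrier (F (Suc 0)) = mod_ker (F 0) E e"
      using assms(2) by (auto simp: finite_n_presentation_def)
    thus "d' 0 ` carrier (F' 1) = mod_ker (F' 0) E e'"
      using d'im[OF \<open>0 < n\<close>] kerim[of 0 e E e E] unfolding e'_def by simp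
  next
    fix i assume "Suc i < n"
    hence "d (Suc i) ` carrier (F (Suc (Suc i))) = mod_ker (F (Suc i)) (F i) (d i)"
      using assms(2) by (auto simp: finite_n_presentation_def)
    moreover have "mod_ker (F' (Suc i)) (F' i) (d' i) = h (Suc i) ` mod_ker (F (Suc i)) (F i) (d i)"
      unfolding d'_def
      by (rule kerim) (use \<open>Suc i < n\<close> dc hz in \<open>auto simp: F'_def\<close>)
    ultimately show "d' (Suc i) ` carrier (F' (Suc (Suc i))) = mod_ker (F' (Suc i)) (F' i) (d' i)"
      using d'im[OF \<open>Suc i < n\<close>] by simp
  qed
  thus ?thesis
    using assms(1) unfolding finitely_n_presented_def F'_def by blast
qed

text \<open>The fibres of \<open>p\<close> serve as elements of a copy of its target.\<close>
lemma inj_on_fibre: "inj_on (\<lambda>y. {x \<in> A. p x = y}) (p ` A)"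
  by (rule inj_onI) blast

lemma rel_flatD:
  fixes R :: "('a, 'r) ring_scheme" and M :: "('a, 'm) module" and V :: "('a, 'v) module"
    and M' :: "('a, 'x) module" and G :: "('a, 'y) module"
  assumes flat: "rel_flat R M V"
    and M': "module R M'" "p \<in> mod_epi R M M'" "u \<in> mod_hom R V M'"
    and G: "finitely_presented R G" "v \<in> mod_hom R G V"
  shows "\<exists>q \<in> mod_hom R G M. \<forall>x \<in> carrier G. p (q x) = u (v x)"
proof -
  define g where "g = (\<lambda>y. {x \<in> carrier M. p x = y})"
  define M1 where "M1 = mod_transport g M'"
  have p: "p \<in> mod_hom R M M'" "p ` carrier M = carrier M'"
    using M'(2) by (auto simp: mod_epi_def)
  have ginj: "inj_on g (carrier M')"
    unfolding g_def using inj_on_fibre[of "carrier M" p] p(2) by simp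
  have M1: "module R M1" "g \<in> mod_iso R M' M1"
    unfolding M1_def using module_mod_transport mod_transport_iso M'(1) ginj by blast+
  hence g: "g \<in> mod_hom R M' M1" "g ` carrier M' = carrier M1"
    by (auto simp: mod_iso_def bij_betw_def)
  have p1: "g \<circ> p \<in> mod_epi R M M1"
    by (intro mod_epi_comp[OF M'(2)] mod_iso_imp_epi M1(2))
  have u1: "g \<circ> u \<in> mod_hom R V M1"
    by (rule mod_hom_comp[OF M'(3) g(1)])
  obtain F :: "nat \<Rightarrow> ('a, nat \<Rightarrow> 'a) module" and d e where
    "finite_n_presentation R 1 F d e G" and modG: "module R G"
    using G(1) by (auto simp: finitely_n_presented_def)
  hence e: "e ` carrier (F 0) = carrier G"
    by (auto simp: finite_n_presentation_def mod_epi_def)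
  define k where "k = (\<lambda>y. {x \<in> carrier (F 0). e x = y})"
  have kinj: "inj_on k (carrier G)"
    unfolding k_def using inj_on_fibre[of "carrier (F 0)" e] e by simp
  define G1 where "G1 = mod_transport k G"
  have G1: "module R G1" "k \<in> mod_iso R G G1"
    unfolding G1_def using module_mod_transport mod_transport_iso modG kinj by blast+
  let ?l = "inv_into (carrier G) k"
  have l: "?l \<in> mod_hom R G1 G"
    using mod_iso_inv[OF modG G1(2)] by (simp add: mod_iso_def)
  have k: "k \<in> mod_hom R G G1"
    using G1(2) by (simp add: mod_iso_def)
  have "finitely_presented R G1"
    by (rule finitely_n_presented_iso[OF G1 G(1)])
  moreover have "v \<circ> ?l \<in> mod_hom R G1 V"
    by (rule mod_hom_comp[OF l G(2)])
  ultimately obtain q where q: "q \<in> mod_hom R G1 M"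
    "\<And>x. x \<in> carrier G1 \<Longrightarrow> (g \<circ> p) (q x) = (g \<circ> u) ((v \<circ> ?l) x)"
    using flat[unfolded rel_flat_def, rule_format, OF M1(1) p1 u1] by blast
  have qk: "q \<circ> k \<in> mod_hom R G M"
    by (rule mod_hom_comp[OF k q(1)])
  have "p ((q \<circ> k) x) = u (v x)" if x: "x \<in> carrier G" for x
  proof -
    have "k x \<in> carrier G1" using k x by (auto simp: mod_hom_def)
    from q(2)[OF this] have "g (p (q (k x))) = g (u (v x))"
      using inv_into_f_f[OF kinj x] by simp
    moreover have "p (q (k x)) \<in> carrier M'"
      using qk x p(1) by (auto simp: mod_hom_def Pi_iff)
    moreover have "u (v x) \<in> carrier M'"
      using G(2) M'(3) x by (auto simp: mod_hom_def)
    ultimately show ?thesis using ginj by (simp add: inj_on_eq_iff)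
  qed
  thus ?thesis using qk by blast
qed

lemma finitely_generated_mod_iso:
  assumes "module R E" "module R E'" "g \<in> mod_iso R E E'" "finitely_generated_module R E"
  shows "finitely_generated_module R E'"
proof -
  interpret E: module R E by fact
  interpret E': module R E' by fact
  obtain S where S: "finite S" "S \<subseteq> carrier E"
    "\<And>N. submodule N R E \<Longrightarrow> S \<subseteq> N \<Longrightarrow> N = carrier E"
    using assms(4) by (auto simp: finitely_generated_module_def)
  have g: "g \<in> mod_hom R E E'" "g ` carrier E = carrier E'"
    using assms(3) by (auto simp: mod_iso_def bij_betw_def)
  have gneg: "g (\<ominus>\<^bsub>E\<^esub> x) = \<ominus>\<^bsub>E'\<^esub> g x" if "x \<in> carrier E" for x
  proof -
    have "g (\<ominus>\<^bsub>E\<^esub> x) \<oplus>\<^bsub>E'\<^esub> g x = g (\<ominus>\<^bsub>E\<^esub> x \<oplus>\<^bsub>E\<^esub> x)"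
      using g(1) that by (auto simp: mod_hom_def)
    also have "\<dots> = \<zero>\<^bsub>E'\<^esub>"
      using mod_hom_zero[OF assms(1,2) g(1)] that by (simp add: E.M.l_neg)
    finally show ?thesis
      using that g(2) E'.M.minus_equality E.M.a_inv_closed by (metis imageI)
  qed
  have "N = carrier E'" if N: "submodule N R E'" "g ` S \<subseteq> N" for N
  proof -
    note sub = E'.submoduleE[OF N(1)]
    have z: "\<zero>\<^bsub>E'\<^esub> \<in> N"
      using N(1) by (metis submodule.axioms(1) subgroup.one_closed monoid.simps(2))
    have "submodule {x \<in> carrier E. g x \<in> N} R E"
      using g(1) sub(3-5) z mod_hom_zero[OF assms(1,2) g(1)] gneg
      by (intro E.submoduleI) (auto simp: mod_hom_def)
    hence "{x \<in> carrier E. g x \<in> N} = carrier E"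
      by (rule S(3)) (use S(2) N(2) in auto)
    hence "g ` carrier E \<subseteq> N" by auto
    thus ?thesis using g(2) sub(1) by auto
  qed
  moreover have "g ` S \<subseteq> carrier E'" using S(2) g(2) by auto
  ultimately show ?thesis
    unfolding finitely_generated_module_def using assms(2) S(1)
    by (intro conjI exI[of _ "g ` S"]) auto
qed

lemma module_lambda_iso:
  assumes "module R E" "module R E'" "g \<in> mod_iso R E E'"
  shows "module_lambda R E = module_lambda R E'"
proof -
  note inv = mod_iso_inv[OF assms(1,3)]
  have "finitely_generated_module R E \<longleftrightarrow> finitely_generated_module R E'"
    using finitely_generated_mod_iso[OF assms] finitely_generated_mod_iso[OF assms(2,1) inv]
    by blast
  moreover have "finitely_n_presented R n E \<longleftrightarrow> finitely_n_presented R n E'" for n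
    using finitely_n_presented_iso[OF assms(2,3)] finitely_n_presented_iso[OF assms(1) inv] by blast
  ultimately show ?thesis by (simp add: module_lambda_def)
qed

lemma lambda_dim_universe:
  fixes R :: "('a, 'r) ring_scheme"
  shows "lambda_dim TYPE('e) R \<le> lambda_dim TYPE((nat \<Rightarrow> 'a) set) R"
  unfolding lambda_dim_def
proof (rule Inf_superset_mono, safe)
  fix n
  assume *: "\<forall>E :: ('a, (nat \<Rightarrow> 'a) set) module. module R E \<longrightarrow> ereal (real n) \<le> module_lambda R E \<longrightarrow>
    module_lambda R E = \<infinity>"
  have "module_lambda R E = \<infinity>"
    if E: "module R E" "ereal (real n) \<le> module_lambda R E" for E :: "('a, 'e) module"
  proof -
    have "\<exists>m. finitely_n_presented R m E"
    proof (rule ccontr)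
      assume "\<not> ?thesis"
      hence "module_lambda R E \<le> -1" by (auto simp: module_lambda_def bot_ereal_def)
      with E(2) have "ereal (real n) \<le> ereal (-1)" by (metis order_trans one_ereal_def uminus_ereal.simps(1))
      thus False by simp
    qed
    then obtain m and F :: "nat \<Rightarrow> ('a, nat \<Rightarrow> 'a) module" and d e where
      "finite_n_presentation R m F d e E"
      by (auto simp: finitely_n_presented_def)
    hence e: "e ` carrier (F 0) = carrier E"
      by (auto simp: finite_n_presentation_def mod_epi_def)
    define g where "g = (\<lambda>y. {x \<in> carrier (F 0). e x = y})"
    have "inj_on g (carrier E)"
      unfolding g_def using inj_on_fibre[of "carrier (F 0)" e] e by simp
    note tr = module_mod_transport[OF E(1) this] mod_transport_iso[OF E(1) this]
    show ?thesis
      using *[rule_format, OF tr(1)] E(2) unfolding module_lambda_iso[OF E(1) tr] by simp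
  qed
  thus "\<exists>na. enat n = enat na \<and> (\<forall>E :: ('a, 'e) module. module R E \<longrightarrow>
    ereal (real na) \<le> module_lambda R E \<longrightarrow> module_lambda R E = \<infinity>)"
    by blast
qed

end

theory Submission
  imports Defs "HOL-Algebra.Ring_Divisibility"
begin

text \<open>A module has to be shown to admit presentations of every length as soon as it has a presentation
  \<open>F\<^sub>3 \<rightarrow> F\<^sub>2 \<rightarrow> F\<^sub>1 \<rightarrow> F\<^sub>0\<close>. For this it is enough that the kernel of \<open>F\<^sub>3 \<rightarrow> F\<^sub>2\<close> is finitely generated, since the argument
  can be repeated with the next three maps. Finite generation is a local property: the multipliers that move the
  kernel into a finitely generated submodule form an ideal (\<open>finitely_generated_if_locally\<close>). So a prime ideal \<open>P\<close> is
  fixed and the kernel is studied near \<open>P\<close>, that is, up to a multiplier outside \<open>P\<close> that does not depend on the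
  elements. By Schanuel's lemma (\<open>pres_Suc_cover\<close>) one may change generators freely in this analysis.

  Quasi-flatness of the ideal generated by two elements \<open>x\<close>, \<open>y\<close> is used in one way only. If neither of them divides
  the other near \<open>P\<close>, then every relation \<open>r x + t y = 0\<close> is trivial, in the strong sense that \<open>r\<close> and \<open>t\<close>
  annihilate both \<open>x\<close> and \<open>y\<close> near \<open>P\<close> (\<open>fqf_split_at_prime\<close>). This leaves two kinds of primes.

  At the primes of the first kind any two elements are comparable. A matrix can be diagonalised there by pivots
  (\<open>pres_syz_pivot\<close>), which reduces the question to the annihilator of one element \<open>z\<close>. If this annihilator is
  generated by \<open>b\<close>, and that of \<open>b\<close> by \<open>c\<close>, then the annihilator of \<open>c\<close> is generated by \<open>b\<close>
  (\<open>double_annihilator_if_chain\<close>). The three steps of the presentation are needed here, as the finite generation of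
  the first two annihilators has to be known in a neighbourhood of \<open>P\<close>.

  At the other primes there is a pair of incomparable elements. Their annihilator \<open>N\<close> is a prime ideal of square zero
  near \<open>P\<close>, modulo which the ring is a valuation domain, and the elements outside \<open>N\<close> are regular and divide those of
  \<open>N\<close> (\<open>N_square_zero\<close>, \<open>not_N_cancel\<close>, \<open>not_N_ndvd_N\<close>). So a pivot outside \<open>N\<close> has
  annihilator zero near \<open>P\<close> once this annihilator is finitely generated. There remains a family with entries in \<open>N\<close>. It can be thinned out to one that is independent modulo
  \<open>N\<close>, and its syzygies are then the vectors with entries in \<open>N\<close>. If they are finitely generated, then \<open>N\<close> is the
  span of a finite independent family near \<open>P\<close>, and the syzygies of this family are again vectors with entries in
  \<open>N\<close>. So \<open>N\<close> has presentations of every length (\<open>pres_syz_entries_in_N\<close>).\<close>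

section \<open>Vectors over a commutative ring\<close>

context cring
begin

text \<open>Every free module of finite rank is realised inside one ambient type: \<open>vecs I\<close> is the free module
  with basis \<open>I\<close>, made of functions on the natural numbers that vanish outside \<open>I\<close>. So presentations, their
  kernels and the kernels of these are all sets of elements of the same type.\<close>
definition vecs :: "nat set \<Rightarrow> (nat \<Rightarrow> 'a) set"
  where "vecs I = {v. (\<forall>i. v i \<in> carrier R) \<and> (\<forall>i. i \<notin> I \<longrightarrow> v i = \<zero>)}"

definition vzero :: "nat \<Rightarrow> 'a"
  where "vzero = (\<lambda>_. \<zero>)"

definition vadd :: "(nat \<Rightarrow> 'a) \<Rightarrow> (nat \<Rightarrow> 'a) \<Rightarrow> nat \<Rightarrow> 'a"
  where "vadd u v = (\<lambda>i. u i \<oplus> v i)"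

definition smul :: "'a \<Rightarrow> (nat \<Rightarrow> 'a) \<Rightarrow> nat \<Rightarrow> 'a"
  where "smul a v = (\<lambda>i. a \<otimes> v i)"

definition unit_vec :: "nat \<Rightarrow> nat \<Rightarrow> 'a"
  where "unit_vec j = (\<lambda>i. if i = j then \<one> else \<zero>)"

definition submod :: "(nat \<Rightarrow> 'a) set \<Rightarrow> bool"
  where "submod L \<longleftrightarrow> L \<subseteq> vecs UNIV \<and> vzero \<in> L \<and> (\<forall>u\<in>L. \<forall>v\<in>L. vadd u v \<in> L) \<and>
    (\<forall>a\<in>carrier R. \<forall>v\<in>L. smul a v \<in> L)"

definition lin :: "(nat \<Rightarrow> 'a) set \<Rightarrow> ((nat \<Rightarrow> 'a) \<Rightarrow> nat \<Rightarrow> 'a) \<Rightarrow> bool"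
  where "lin L f \<longleftrightarrow> (\<forall>v\<in>L. f v \<in> vecs UNIV) \<and> (\<forall>u\<in>L. \<forall>v\<in>L. f (vadd u v) = vadd (f u) (f v)) \<and>
    (\<forall>a\<in>carrier R. \<forall>v\<in>L. f (smul a v) = smul a (f v))"

definition ker :: "nat set \<Rightarrow> ((nat \<Rightarrow> 'a) \<Rightarrow> nat \<Rightarrow> 'a) \<Rightarrow> (nat \<Rightarrow> 'a) set"
  where "ker I f = {v \<in> vecs I. f v = vzero}"

lemma vecs_carrier: "v \<in> vecs I \<Longrightarrow> v i \<in> carrier R"
  by (simp add: vecs_def)

lemma vecs_outside: "v \<in> vecs I \<Longrightarrow> i \<notin> I \<Longrightarrow> v i = \<zero>"
  by (simp add: vecs_def)

lemma vecs_UNIV_iff: "v \<in> vecs UNIV \<longleftrightarrow> (\<forall>i. v i \<in> carrier R)"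
  by (simp add: vecs_def)

lemma vecs_mono: "I \<subseteq> J \<Longrightarrow> v \<in> vecs I \<Longrightarrow> v \<in> vecs J"
  by (auto simp: vecs_def)

lemma vecs_UNIV: "v \<in> vecs I \<Longrightarrow> v \<in> vecs UNIV"
  by (auto simp: vecs_def)

lemma vecs_empty: "vecs {} = {vzero}"
  by (auto simp: vecs_def vzero_def)

lemma vadd_vecs [simp]: "u \<in> vecs I \<Longrightarrow> v \<in> vecs I \<Longrightarrow> vadd u v \<in> vecs I"
  by (auto simp: vecs_def vadd_def)

lemma smul_vecs [simp]: "a \<in> carrier R \<Longrightarrow> v \<in> vecs I \<Longrightarrow> smul a v \<in> vecs I"
  by (auto simp: vecs_def smul_def)

lemma vzero_vecs [simp]: "vzero \<in> vecs I"
  by (auto simp: vecs_def vzero_def)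

lemma unit_vec_vecs [simp]: "j \<in> I \<Longrightarrow> unit_vec j \<in> vecs I"
  by (auto simp: vecs_def unit_vec_def)

lemma vecs_UNIV_carrier: "v \<in> vecs UNIV \<Longrightarrow> v i \<in> carrier R"
  by (rule vecs_carrier)

declare vecs_carrier [simp] vecs_UNIV_carrier [simp]

lemma vadd_apply [simp]: "vadd u v i = u i \<oplus> v i"
  and smul_apply [simp]: "smul a v i = a \<otimes> v i"
  and vzero_apply [simp]: "vzero i = \<zero>"
  by (simp_all add: vadd_def smul_def vzero_def)

lemma unit_vec_apply: "unit_vec j i = (if i = j then \<one> else \<zero>)"
  by (simp add: unit_vec_def)

lemma vadd_assoc:
  "u \<in> vecs UNIV \<Longrightarrow> v \<in> vecs UNIV \<Longrightarrow> w \<in> vecs UNIV \<Longrightarrow> vadd (vadd u v) w = vadd u (vadd v w)"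
  by (auto simp: a_assoc)

lemma vadd_comm: "u \<in> vecs UNIV \<Longrightarrow> v \<in> vecs UNIV \<Longrightarrow> vadd u v = vadd v u"
  by (auto simp: a_comm)

lemma vadd_zero [simp]: "u \<in> vecs I \<Longrightarrow> vadd u vzero = u" "u \<in> vecs I \<Longrightarrow> vadd vzero u = u"
  by auto

lemma smul_vadd:
  "a \<in> carrier R \<Longrightarrow> u \<in> vecs UNIV \<Longrightarrow> v \<in> vecs UNIV \<Longrightarrow> smul a (vadd u v) = vadd (smul a u) (smul a v)"
  by (auto simp: r_distr)

lemma add_smul:
  "a \<in> carrier R \<Longrightarrow> b \<in> carrier R \<Longrightarrow> v \<in> vecs UNIV \<Longrightarrow> smul (a \<oplus> b) v = vadd (smul a v) (smul b v)"
  by (auto simp: l_distr)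

lemma smul_smul:
  "a \<in> carrier R \<Longrightarrow> b \<in> carrier R \<Longrightarrow> v \<in> vecs UNIV \<Longrightarrow> smul a (smul b v) = smul (a \<otimes> b) v"
  by (auto simp: m_assoc)

lemma smul_one [simp]: "v \<in> vecs I \<Longrightarrow> smul \<one> v = v"
  by auto

lemma smul_zero [simp]: "a \<in> carrier R \<Longrightarrow> smul a vzero = vzero" "v \<in> vecs I \<Longrightarrow> smul \<zero> v = vzero"
  by auto

lemma vadd_minus [simp]: "v \<in> vecs I \<Longrightarrow> vadd v (smul (\<ominus> \<one>) v) = vzero"
    "v \<in> vecs I \<Longrightarrow> vadd (smul (\<ominus> \<one>) v) v = vzero"
  by (auto simp: l_minus r_neg l_neg)

lemma submodD:
  assumes "submod L"
  shows submod_vecs: "\<And>v. v \<in> L \<Longrightarrow> v \<in> vecs UNIV" and submod_zero: "vzero \<in> L"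
    and submod_vadd: "\<And>u v. u \<in> L \<Longrightarrow> v \<in> L \<Longrightarrow> vadd u v \<in> L"
    and submod_smul: "\<And>a v. a \<in> carrier R \<Longrightarrow> v \<in> L \<Longrightarrow> smul a v \<in> L"
  using assms by (auto simp: submod_def)

lemma linD:
  assumes "lin L f"
  shows lin_vecs: "\<And>v. v \<in> L \<Longrightarrow> f v \<in> vecs UNIV"
    and lin_vadd: "\<And>u v. u \<in> L \<Longrightarrow> v \<in> L \<Longrightarrow> f (vadd u v) = vadd (f u) (f v)"
    and lin_smul: "\<And>a v. a \<in> carrier R \<Longrightarrow> v \<in> L \<Longrightarrow> f (smul a v) = smul a (f v)"
  using assms by (auto simp: lin_def)

lemma submod_vecs_set [simp]: "submod (vecs I)"
  by (auto simp: submod_def vecs_UNIV)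

lemma lin_zero: "submod L \<Longrightarrow> lin L f \<Longrightarrow> f vzero = vzero"
  using lin_smul[of L f \<zero> vzero] submod_zero[of L] lin_vecs[of L f vzero] by simp

lemma submod_image: "submod L \<Longrightarrow> lin L f \<Longrightarrow> submod (f ` L)"
  unfolding submod_def[of "f ` L"]
  apply (intro conjI)
  subgoal by (auto dest: lin_vecs)
  subgoal by (metis image_eqI lin_zero submod_zero)
  subgoal by (auto simp: lin_vadd[symmetric] submod_vadd)
  subgoal by (auto simp: lin_smul[symmetric] submod_smul)
  done

lemma submod_ker: "lin (vecs I) f \<Longrightarrow> submod (ker I f)"
  using lin_zero[OF submod_vecs_set, of I f]
  by (auto simp: submod_def ker_def vecs_UNIV lin_vadd lin_smul)

lemma lin_subset: "lin L f \<Longrightarrow> L' \<subseteq> L \<Longrightarrow> lin L' f"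
  by (auto simp: lin_def subset_iff)

lemma lin_comp: "lin L f \<Longrightarrow> lin L' g \<Longrightarrow> f ` L \<subseteq> L' \<Longrightarrow> lin L (\<lambda>v. g (f v))"
  by (simp add: lin_def image_subset_iff)

lemma lin_add: "lin L f \<Longrightarrow> lin L g \<Longrightarrow> lin L (\<lambda>v. vadd (f v) (g v))"
  unfolding lin_def by (auto intro!: ext simp: a_ac r_distr simp del: vecs_carrier)

lemma lin_scale: "submod L \<Longrightarrow> a \<in> carrier R \<Longrightarrow> lin L (\<lambda>v. smul a v)"
  by (auto simp: lin_def submod_vecs smul_vadd smul_smul m_comm)

lemma lin_id: "submod L \<Longrightarrow> lin L (\<lambda>v. v)"
  by (auto simp: lin_def submod_vecs)

lemma submod_sum:
  assumes "submod L" "submod L'"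
  shows "submod {vadd u v |u v. u \<in> L \<and> v \<in> L'}" (is "submod ?T")
  unfolding submod_def[of ?T]
proof (intro conjI ballI)
  show "?T \<subseteq> vecs UNIV" using assms by (auto simp: submod_vecs)
  show "vzero \<in> ?T" using assms by (intro CollectI exI[of _ vzero]) (auto simp: submod_zero)
next
  fix x y assume "x \<in> ?T" "y \<in> ?T"
  then obtain u v u' v' where "x = vadd u v" "y = vadd u' v'" "u \<in> L" "u' \<in> L" "v \<in> L'" "v' \<in> L'"
    by blast
  moreover from this have "vadd x y = vadd (vadd u u') (vadd v v')"
    using assms by (intro ext) (simp add: submod_vecs a_ac)
  ultimately show "vadd x y \<in> ?T" using assms submod_vadd by blast
next
  fix a x assume a: "a \<in> carrier R" and "x \<in> ?T"
  then obtain u v where "x = vadd u v" "u \<in> L" "v \<in> L'"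
    by blast
  moreover from this have "smul a x = vadd (smul a u) (smul a v)"
    using assms a by (simp add: smul_vadd submod_vecs)
  ultimately show "smul a x \<in> ?T" using assms a submod_smul by blast
qed

subsection \<open>External direct sums\<close>

text \<open>Even and odd coordinates provide two disjoint copies of the index set, so that two free modules can be
  added without renaming their bases.\<close>
definition evens :: "(nat \<Rightarrow> 'a) \<Rightarrow> nat \<Rightarrow> 'a"
  where "evens v = (\<lambda>i. v (2 * i))"

definition odds :: "(nat \<Rightarrow> 'a) \<Rightarrow> nat \<Rightarrow> 'a"
  where "odds v = (\<lambda>i. v (2 * i + 1))"

definition join :: "(nat \<Rightarrow> 'a) \<Rightarrow> (nat \<Rightarrow> 'a) \<Rightarrow> nat \<Rightarrow> 'a"
  where "join u v = (\<lambda>i. if even i then u (i div 2) else v (i div 2))"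

definition join_index :: "nat set \<Rightarrow> nat set \<Rightarrow> nat set"
  where "join_index I J = (\<lambda>i. 2 * i) ` I \<union> (\<lambda>i. 2 * i + 1) ` J"

definition direct_sum :: "(nat \<Rightarrow> 'a) set \<Rightarrow> (nat \<Rightarrow> 'a) set \<Rightarrow> (nat \<Rightarrow> 'a) set"
  where "direct_sum L L' = {join u v |u v. u \<in> L \<and> v \<in> L'}"

lemma evens_join [simp]: "evens (join u v) = u" and odds_join [simp]: "odds (join u v) = v"
  by (auto simp: evens_def odds_def join_def)

lemma join_evens_odds [simp]: "join (evens v) (odds v) = v"
  by (auto simp: evens_def odds_def join_def elim: oddE evenE)

lemma direct_sum_iff: "v \<in> direct_sum L L' \<longleftrightarrow> evens v \<in> L \<and> odds v \<in> L'"
  unfolding direct_sum_def by auto (metis join_evens_odds)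

lemma join_index_iff: "i \<in> join_index I J \<longleftrightarrow> (if even i then i div 2 \<in> I else i div 2 \<in> J)"
proof -
  have "i \<in> (\<lambda>i. 2 * i) ` I \<longleftrightarrow> even i \<and> i div 2 \<in> I"
    by (auto intro!: image_eqI[of _ _ "i div 2"])
  moreover have "i \<in> (\<lambda>i. 2 * i + 1) ` J \<longleftrightarrow> odd i \<and> i div 2 \<in> J"
    by (auto intro!: image_eqI[of _ _ "i div 2"])
  ultimately show ?thesis by (auto simp: join_index_def)
qed

lemma finite_join_index: "finite I \<Longrightarrow> finite J \<Longrightarrow> finite (join_index I J)"
  by (simp add: join_index_def)

lemma evens_odds_simps [simp]:
  "evens (vadd u v) = vadd (evens u) (evens v)" "odds (vadd u v) = vadd (odds u) (odds v)"
  "evens (smul a u) = smul a (evens u)" "odds (smul a u) = smul a (odds u)"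
  "evens vzero = vzero" "odds vzero = vzero"
  by (auto simp: evens_def odds_def vadd_def smul_def vzero_def)

lemma evens_vecs: "v \<in> vecs UNIV \<Longrightarrow> evens v \<in> vecs UNIV" and odds_vecs: "v \<in> vecs UNIV \<Longrightarrow> odds v \<in> vecs UNIV"
  unfolding vecs_UNIV_iff by (auto simp: evens_def odds_def)

lemma join_vecs: "u \<in> vecs UNIV \<Longrightarrow> v \<in> vecs UNIV \<Longrightarrow> join u v \<in> vecs UNIV"
  unfolding vecs_UNIV_iff by (auto simp: join_def)

lemma vadd_join: "vadd (join u v) (join u' v') = join (vadd u u') (vadd v v')"
  and smul_join: "smul a (join u v) = join (smul a u) (smul a v)"
  by (auto simp: join_def)

lemma join_eq_iff: "v = join a b \<longleftrightarrow> evens v = a \<and> odds v = b"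
  by auto

lemma join_eq_vzero: "join a b = vzero \<longleftrightarrow> a = vzero \<and> b = vzero"
  by (metis evens_join odds_join evens_odds_simps(5,6) join_evens_odds)

lemma vecs_join_index: "vecs (join_index I J) = direct_sum (vecs I) (vecs J)"
proof (intro Set.set_eqI iffI)
  fix v assume "v \<in> vecs (join_index I J)"
  thus "v \<in> direct_sum (vecs I) (vecs J)"
    unfolding direct_sum_iff vecs_def by (auto simp: evens_def odds_def join_index_iff)
next
  fix v assume "v \<in> direct_sum (vecs I) (vecs J)"
  hence 1: "evens v \<in> vecs I" "odds v \<in> vecs J" by (auto simp: direct_sum_iff)
  have "join (evens v) (odds v) \<in> vecs (join_index I J)"
    using 1 unfolding vecs_def by (auto simp: join_index_iff join_def)
  thus "v \<in> vecs (join_index I J)" by simp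
qed

lemma submod_direct_sum:
  assumes "submod L" "submod L'"
  shows "submod (direct_sum L L')"
  unfolding submod_def[of "direct_sum L L'"]
proof (intro conjI ballI subsetI)
  fix v assume "v \<in> direct_sum L L'"
  hence "join (evens v) (odds v) \<in> vecs UNIV"
    using assms by (intro join_vecs) (auto simp: direct_sum_iff submod_vecs)
  thus "v \<in> vecs UNIV" by simp
qed (use assms in \<open>auto simp: direct_sum_iff submod_zero submod_vadd submod_smul\<close>)

lemma lin_evens: "submod L \<Longrightarrow> lin L evens" and lin_odds: "submod L \<Longrightarrow> lin L odds"
  by (auto simp: lin_def evens_vecs odds_vecs submod_vecs)

lemma lin_join:
  "lin L f \<Longrightarrow> lin L g \<Longrightarrow> lin L (\<lambda>v. join (f v) (g v))"
  by (auto simp: lin_def join_vecs vadd_join smul_join)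

subsection \<open>Linear combinations\<close>

definition lincomb :: "nat set \<Rightarrow> (nat \<Rightarrow> nat \<Rightarrow> 'a) \<Rightarrow> (nat \<Rightarrow> 'a) \<Rightarrow> nat \<Rightarrow> 'a"
  where "lincomb I x r = (\<lambda>c. \<Oplus>i\<in>I. r i \<otimes> x i c)"

definition syz :: "nat set \<Rightarrow> (nat \<Rightarrow> nat \<Rightarrow> 'a) \<Rightarrow> (nat \<Rightarrow> 'a) set"
  where "syz I x = ker I (lincomb I x)"

lemma lincomb_empty [simp]: "lincomb {} x r = vzero"
  by (simp add: lincomb_def vzero_def)

lemma lincomb_insert:
  assumes "finite I" "i \<notin> I" "\<And>j. j \<in> insert i I \<Longrightarrow> x j \<in> vecs UNIV" "r \<in> vecs UNIV"
  shows "lincomb (insert i I) x r = vadd (smul (r i) (x i)) (lincomb I x r)"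
proof
  fix c
  have "(\<lambda>j. r j \<otimes> x j c) \<in> I \<rightarrow> carrier R" "r i \<otimes> x i c \<in> carrier R"
    using assms by auto
  thus "lincomb (insert i I) x r c = vadd (smul (r i) (x i)) (lincomb I x r) c"
    using assms(1,2) by (simp add: lincomb_def)
qed

lemma lincomb_remove:
  assumes "finite I" "i \<in> I" "\<And>j. j \<in> I \<Longrightarrow> x j \<in> vecs UNIV" "r \<in> vecs UNIV"
  shows "lincomb I x r = vadd (smul (r i) (x i)) (lincomb (I - {i}) x r)"
  using lincomb_insert[of "I - {i}" i x r] assms by (simp add: insert_absorb)

lemma lincomb_cong:
  assumes "\<And>i. i \<in> I \<Longrightarrow> r i = r' i" "\<And>i. i \<in> I \<Longrightarrow> x i = x' i" 
    "\<And>i. i \<in> I \<Longrightarrow> x i \<in> vecs UNIV" "r \<in> vecs UNIV"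
  shows "lincomb I x r = lincomb I x' r'"
  unfolding lincomb_def using assms(3,4) 
  by (intro ext finsum_cong') (auto simp: assms(1,2)[symmetric])

lemma lincomb_mem:
  assumes "submod L" "finite I" "\<And>i. i \<in> I \<Longrightarrow> x i \<in> L" "r \<in> vecs UNIV"
  shows "lincomb I x r \<in> L"
  using assms(2,3)
proof (induction I)
  case (insert i I)
  have "lincomb (insert i I) x r = vadd (smul (r i) (x i)) (lincomb I x r)"
    using insert assms by (intro lincomb_insert) (auto simp: submod_vecs)
  also have "\<dots> \<in> L" using insert assms by (intro submod_vadd submod_smul) auto
  finally show ?case .
qed (simp add: submod_zero assms)

lemma lincomb_vecs:
  assumes "finite I" "\<And>i. i \<in> I \<Longrightarrow> x i \<in> vecs C" "r \<in> vecs UNIV"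
  shows "lincomb I x r \<in> vecs C"
  using lincomb_mem[of "vecs C"] assms by auto

lemma lin_lincomb:
  assumes "finite I" "\<And>i. i \<in> I \<Longrightarrow> x i \<in> vecs UNIV"
  shows "lin (vecs UNIV) (lincomb I x)"
  unfolding lin_def
proof (intro conjI ballI)
  show "lincomb I x v \<in> vecs UNIV" if "v \<in> vecs UNIV" for v
    using lincomb_vecs assms that by blast
  fix u v assume uv: "u \<in> vecs UNIV" "v \<in> vecs UNIV"
  show "lincomb I x (vadd u v) = vadd (lincomb I x u) (lincomb I x v)"
    using assms
  proof (induction I)
    case (insert i I)
    have c: "lincomb I x u \<in> vecs UNIV" "lincomb I x v \<in> vecs UNIV"
      using insert uv by (auto intro!: lincomb_vecs)
    have xi: "x i \<in> vecs UNIV" using insert by auto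
    have 1: "lincomb (insert i I) x (vadd u v) = vadd (smul (vadd u v i) (x i)) (lincomb I x (vadd u v))"
      using insert uv by (intro lincomb_insert) auto
    have 2: "lincomb (insert i I) x u = vadd (smul (u i) (x i)) (lincomb I x u)"
      using insert uv by (intro lincomb_insert) auto
    have 3: "lincomb (insert i I) x v = vadd (smul (v i) (x i)) (lincomb I x v)"
      using insert uv by (intro lincomb_insert) auto
    have 4: "lincomb I x (vadd u v) = vadd (lincomb I x u) (lincomb I x v)"
      using insert by blast
    show ?case unfolding 1 2 3 4 using uv c xi by (intro ext) (simp add: l_distr a_ac)
  qed simp
next
  fix a v assume av: "a \<in> carrier R" "v \<in> vecs UNIV"
  show "lincomb I x (smul a v) = smul a (lincomb I x v)"
    using assms
  proof (induction I)
    case (insert i I)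
    have c: "lincomb I x v \<in> vecs UNIV"
      using insert av by (auto intro!: lincomb_vecs)
    have xi: "x i \<in> vecs UNIV" using insert by auto
    have 1: "lincomb (insert i I) x (smul a v) = vadd (smul (smul a v i) (x i)) (lincomb I x (smul a v))"
      using insert av by (intro lincomb_insert) auto
    have 2: "lincomb (insert i I) x v = vadd (smul (v i) (x i)) (lincomb I x v)"
      using insert av by (intro lincomb_insert) auto
    have 3: "lincomb I x (smul a v) = smul a (lincomb I x v)"
      using insert by blast
    show ?case unfolding 1 2 3 using av c xi by (intro ext) (simp add: r_distr m_ac)
  qed (simp add: av)
qed

lemma lin_lincomb_vecs:
  assumes "finite I" "\<And>i. i \<in> I \<Longrightarrow> x i \<in> vecs UNIV"
  shows "lin (vecs J) (lincomb I x)"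
  by (rule lin_subset[OF lin_lincomb[OF assms]]) (auto intro: vecs_UNIV)

lemma lin_of_lincomb:
  assumes "submod L" "lin L f" "finite I" "\<And>i. i \<in> I \<Longrightarrow> x i \<in> L" "r \<in> vecs UNIV"
  shows "f (lincomb I x r) = lincomb I (\<lambda>i. f (x i)) r"
  using assms(3,4)
proof (induction I)
  case (insert i I)
  have c: "lincomb I x r \<in> L" using insert assms by (intro lincomb_mem) auto
  have e: "lincomb (insert i I) x r = vadd (smul (r i) (x i)) (lincomb I x r)"
    using insert assms by (intro lincomb_insert) (auto simp: submod_vecs)
  have e': "lincomb (insert i I) (\<lambda>i. f (x i)) r = vadd (smul (r i) (f (x i))) (lincomb I (\<lambda>i. f (x i)) r)"
    using insert assms by (intro lincomb_insert) (auto simp: lin_vecs)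
  have i: "x i \<in> L" "r i \<in> carrier R" and IH: "f (lincomb I x r) = lincomb I (\<lambda>i. f (x i)) r"
    using insert assms by auto
  show ?case unfolding e e' IH[symmetric] lin_vadd[OF assms(2) submod_smul[OF assms(1) i(2,1)] c]
    lin_smul[OF assms(2) i(2,1)] ..
qed (simp add: lin_zero[OF assms(1,2)])

lemma lincomb_unit_vecs:
  assumes "finite I" "r \<in> vecs I"
  shows "lincomb I unit_vec r = r"
proof
  fix c
  have rc: "r i \<in> carrier R" for i using assms(2) by simp
  have "lincomb I unit_vec r c = (\<Oplus>i\<in>I. if c = i then r i else \<zero>)"
    unfolding lincomb_def using rc by (intro finsum_cong') (auto simp: unit_vec_def)
  also have "\<dots> = r c"
  proof (cases "c \<in> I")
    case True
    thus ?thesis using rc assms(1) by (simp add: add.finprod_singleton)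
  next
    case False
    have "(\<Oplus>i\<in>I. if c = i then r i else \<zero>) = (\<Oplus>i\<in>I. \<zero>)"
      using False by (intro finsum_cong') auto
    thus ?thesis using False vecs_outside[OF assms(2)] by simp
  qed
  finally show "lincomb I unit_vec r c = r c" .
qed

lemma lin_eq_lincomb:
  assumes "finite I" "lin (vecs I) f" "r \<in> vecs I"
  shows "f r = lincomb I (\<lambda>i. f (unit_vec i)) r"
proof -
  have "f (lincomb I unit_vec r) = lincomb I (\<lambda>i. f (unit_vec i)) r"
    using assms(1,2) vecs_UNIV[OF assms(3)] by (intro lin_of_lincomb[OF submod_vecs_set]) auto
  thus ?thesis unfolding lincomb_unit_vecs[OF assms(1,3)] .
qed

lemma lincomb_unit_vec:
  assumes "finite I" "i \<in> I" "\<And>j. j \<in> I \<Longrightarrow> x j \<in> vecs UNIV"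
  shows "lincomb I x (unit_vec i) = x i"
proof -
  have u: "unit_vec i \<in> vecs UNIV" by simp
  have "lincomb (I - {i}) x (unit_vec i) = lincomb (I - {i}) x vzero"
    using assms by (intro lincomb_cong) (auto simp: unit_vec_apply)
  also have "\<dots> = vzero"
    using assms by (intro lin_zero[OF _ lin_lincomb_vecs, of UNIV]) auto
  finally have z: "lincomb (I - {i}) x (unit_vec i) = vzero" .
  have "lincomb I x (unit_vec i) = vadd (smul (unit_vec i i) (x i)) (lincomb (I - {i}) x (unit_vec i))"
    using assms by (intro lincomb_remove) auto
  also have "\<dots> = x i"
    unfolding z using assms(3)[OF assms(2)] by (simp add: unit_vec_apply)
  finally show ?thesis .
qed

end

section \<open>Presentations in the vicinity of a prime\<close>

locale at_prime = primeideal P R for P and R (structure)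
begin

text \<open>The statements below are about localisations, but no localised ring is formed. An equality or inclusion
  that holds after localisation at the prime is expressed by a multiplier from the complement \<open>S\<close> of \<open>P\<close>. In
  \<open>near\<close> the multiplier is the same for all elements: this is an inclusion over a basic open
  neighbourhood of the prime, and it is stronger than an inclusion of the localised modules unless the left
  hand side is finitely generated.\<close>
definition S :: "'a set"
  where "S = carrier R - P"

definition near :: "(nat \<Rightarrow> 'a) set \<Rightarrow> (nat \<Rightarrow> 'a) set \<Rightarrow> bool"
  where "near L L' \<longleftrightarrow> (\<exists>s\<in>S. \<forall>v\<in>L. smul s v \<in> L')"

definition cover :: "nat set \<Rightarrow> ((nat \<Rightarrow> 'a) \<Rightarrow> nat \<Rightarrow> 'a) \<Rightarrow> (nat \<Rightarrow> 'a) set \<Rightarrow> bool"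
  where "cover I f L \<longleftrightarrow> finite I \<and> lin (vecs I) f \<and> f ` vecs I \<subseteq> L \<and> near L (f ` vecs I)"

text \<open>\<open>pres k L\<close>: near the prime, \<open>L\<close> has an exact sequence of \<open>k\<close> free modules of finite rank ending in \<open>L\<close>.
  So \<open>pres 1\<close> is finite generation and \<open>pres 2\<close> finite presentation.\<close>
primrec pres :: "nat \<Rightarrow> (nat \<Rightarrow> 'a) set \<Rightarrow> bool"
  where "pres 0 L = True"
  | "pres (Suc k) L = (\<exists>I f. cover I f L \<and> pres k (ker I f))"

text \<open>A map that becomes an isomorphism on some basic open neighbourhood of the prime.\<close>
definition near_iso :: "(nat \<Rightarrow> 'a) set \<Rightarrow> (nat \<Rightarrow> 'a) set \<Rightarrow> ((nat \<Rightarrow> 'a) \<Rightarrow> nat \<Rightarrow> 'a) \<Rightarrow> bool"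
  where "near_iso L L' f \<longleftrightarrow> lin L f \<and> f ` L \<subseteq> L' \<and>
    (\<exists>s\<in>S. \<forall>v\<in>L. f v = vzero \<longrightarrow> smul s v = vzero) \<and> near L' (f ` L)"

lemma S_carrier [simp]: "s \<in> S \<Longrightarrow> s \<in> carrier R"
  by (simp add: S_def)

lemma one_S [simp]: "\<one> \<in> S"
  using I_notcarr one_imp_carrier by (auto simp: S_def)

lemma mult_S [simp]: "s \<in> S \<Longrightarrow> t \<in> S \<Longrightarrow> s \<otimes> t \<in> S"
  using I_prime by (auto simp: S_def)

lemma S_or_P: "a \<in> carrier R \<Longrightarrow> a \<in> S \<or> a \<in> P"
  by (auto simp: S_def)

lemma mult_S_right: "a \<in> carrier R \<Longrightarrow> b \<in> carrier R \<Longrightarrow> a \<otimes> b \<in> S \<Longrightarrow> b \<in> S"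
  using I_l_closed by (auto simp: S_def)

lemma S_minus_P: "s \<in> S \<Longrightarrow> p \<in> P \<Longrightarrow> s \<ominus> p \<in> S"
proof -
  assume s: "s \<in> S" and p: "p \<in> P"
  have c: "s \<in> carrier R" "p \<in> carrier R" using s p Icarr by auto
  have "s \<in> P" if "s \<ominus> p \<in> P"
  proof -
    have "(s \<ominus> p) \<oplus> p \<in> P" using that p Icarr a_subgroup by (simp add: additive_subgroup.a_closed additive_subgroup_axioms)
    moreover have "(s \<ominus> p) \<oplus> p = s" using c by algebra
    ultimately show ?thesis by simp
  qed
  thus ?thesis using s c by (auto simp: S_def)
qed

lemma S_plus_P: "s \<in> S \<Longrightarrow> p \<in> P \<Longrightarrow> s \<oplus> p \<in> S"
  using S_minus_P[of s "\<ominus> p"] Icarr[of p] by (simp add: minus_eq)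

text \<open>The product of the finitely many denominators serves for all conditions.\<close>
lemma common_denominator:
  assumes "finite A" "\<And>a. a \<in> A \<Longrightarrow> \<exists>s\<in>S. Q a s"
    and "\<And>a s t. a \<in> A \<Longrightarrow> s \<in> S \<Longrightarrow> t \<in> S \<Longrightarrow> Q a s \<Longrightarrow> Q a (t \<otimes> s)"
  shows "\<exists>s\<in>S. \<forall>a\<in>A. Q a s"
  using assms
proof (induction A)
  case empty
  show ?case using one_S by blast
next
  case (insert a A)
  obtain s where s: "s \<in> S" "\<forall>a\<in>A. Q a s" using insert by blast
  obtain t where t: "t \<in> S" "Q a t" using insert by blast
  have "Q a (s \<otimes> t)" using insert.prems(2)[of a t s] s t by simp
  moreover have "Q b (s \<otimes> t)" if "b \<in> A" for b
    using insert.prems(2)[of b s t] s t that by (simp add: m_comm[of s t])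
  ultimately show ?case using s(1) t(1) by (intro bexI[of _ "s \<otimes> t"]) auto
qed

lemma near_refl: "submod L \<Longrightarrow> L \<subseteq> L' \<Longrightarrow> near L L'"
  unfolding near_def by (intro bexI[of _ \<one>]) (auto simp: submod_smul)

lemma near_trans: "near L L' \<Longrightarrow> near L' L'' \<Longrightarrow> submod L \<Longrightarrow> near L L''"
proof -
  assume "near L L'" "near L' L''" and L: "submod L"
  then obtain s t where s: "s \<in> S" "\<And>v. v \<in> L \<Longrightarrow> smul s v \<in> L'"
    and t: "t \<in> S" "\<And>v. v \<in> L' \<Longrightarrow> smul t v \<in> L''"
    by (auto simp: near_def)
  have "smul (t \<otimes> s) v \<in> L''" if "v \<in> L" for v
  proof -
    have "smul (t \<otimes> s) v = smul t (smul s v)"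
      using s(1) t(1) submod_vecs[OF L that] by (simp add: smul_smul)
    thus ?thesis using s(2)[OF that] t(2) by simp
  qed
  thus ?thesis unfolding near_def using s(1) t(1) by (intro bexI[of _ "t \<otimes> s"]) auto
qed

lemma coverD:
  assumes "cover I f L"
  shows "\<exists>s. finite I \<and> lin (vecs I) f \<and> (\<forall>r\<in>vecs I. f r \<in> L) \<and>
    s \<in> S \<and> (\<forall>v\<in>L. \<exists>r\<in>vecs I. smul s v = f r)"
  using assms by (auto simp: cover_def near_def image_iff)

lemma near_isoD:
  assumes "near_iso L L' f"
  shows "\<exists>s t. lin L f \<and> (\<forall>v\<in>L. f v \<in> L') \<and>
    s \<in> S \<and> (\<forall>v\<in>L. f v = vzero \<longrightarrow> smul s v = vzero) \<and>
    t \<in> S \<and> (\<forall>w\<in>L'. \<exists>v\<in>L. smul t w = f v)"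
  using assms by (auto simp: near_iso_def near_def image_iff)

lemma near_image:
  assumes "finite I" "lin (vecs I) f" "submod M"
    and "\<And>i. i \<in> I \<Longrightarrow> \<exists>s\<in>S. smul s (f (unit_vec i)) \<in> M"
  shows "near (f ` vecs I) M"
proof -
  have fv: "f (unit_vec i) \<in> vecs UNIV" if "i \<in> I" for i
    using lin_vecs[OF assms(2), of "unit_vec i"] that by simp
  have "\<exists>s\<in>S. \<forall>i\<in>I. smul s (f (unit_vec i)) \<in> M"
  proof (rule common_denominator[OF assms(1,4)])
    fix i s t assume *: "i \<in> I" "s \<in> S" "t \<in> S" "smul s (f (unit_vec i)) \<in> M"
    have "smul t (smul s (f (unit_vec i))) \<in> M"
      by (rule submod_smul[OF assms(3) S_carrier[OF *(3)] *(4)])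
    thus "smul (t \<otimes> s) (f (unit_vec i)) \<in> M"
      using * fv by (simp add: smul_smul)
  qed
  then obtain s where s: "s \<in> S" "\<And>i. i \<in> I \<Longrightarrow> smul s (f (unit_vec i)) \<in> M" by blast
  have "smul s (f r) \<in> M" if r: "r \<in> vecs I" for r
  proof -
    have "smul s (f r) = smul s (lincomb I (\<lambda>i. f (unit_vec i)) r)"
      by (simp only: lin_eq_lincomb[OF assms(1,2) r])
    also have "\<dots> = lincomb I (\<lambda>i. smul s (f (unit_vec i))) r"
      by (rule lin_of_lincomb[OF submod_vecs_set lin_scale[OF submod_vecs_set]])
         (use s(1) fv r assms(1) vecs_UNIV in auto)
    also have "\<dots> \<in> M"
      by (rule lincomb_mem[OF assms(3,1) s(2)]) (use r vecs_UNIV in auto)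
    finally show ?thesis .
  qed
  thus ?thesis unfolding near_def using s(1) by auto
qed

lemma cover_by_generators:
  assumes "cover I f L" "submod L" "finite J" "lin (vecs J) g" "g ` vecs J \<subseteq> L"
    and "\<And>i. i \<in> I \<Longrightarrow> \<exists>s\<in>S. smul s (f (unit_vec i)) \<in> g ` vecs J"
  shows "cover J g L"
proof -
  have f: "finite I" "lin (vecs I) f" "near L (f ` vecs I)"
    using assms(1) by (auto simp: cover_def)
  have "near (f ` vecs I) (g ` vecs J)"
    by (rule near_image[OF f(1,2) submod_image[OF submod_vecs_set assms(4)] assms(6)])
  thus ?thesis
    using near_trans[OF f(3) _ assms(2)] assms(3,4,5) by (simp add: cover_def)
qed

subsection \<open>Invariance under isomorphisms near the prime\<close>

lemma near_isoI:
  assumes "lin L f" "\<And>v. v \<in> L \<Longrightarrow> f v \<in> L'"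
    and "s \<in> S" "\<And>v. v \<in> L \<Longrightarrow> f v = vzero \<Longrightarrow> smul s v = vzero"
    and "t \<in> S" "\<And>w. w \<in> L' \<Longrightarrow> \<exists>v\<in>L. smul t w = f v"
  shows "near_iso L L' f"
  unfolding near_iso_def near_def using assms by blast

text \<open>If \<open>s\<close> annihilates the kernel of \<open>f\<close> and \<open>t\<close> moves \<open>L'\<close> into the image, then \<open>s\<close> times a preimage of
  \<open>t w\<close> does not depend on the choice of the preimage.\<close>
lemma near_iso_inverse:
  assumes "submod L" "submod L'" "near_iso L L' f"
  shows "\<exists>g. near_iso L' L g"
proof -
  obtain s t where f: "lin L f" "\<And>v. v \<in> L \<Longrightarrow> f v \<in> L'"
    and s: "s \<in> S" "\<And>v. v \<in> L \<Longrightarrow> f v = vzero \<Longrightarrow> smul s v = vzero"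
    and t: "t \<in> S" "\<And>w. w \<in> L' \<Longrightarrow> \<exists>v\<in>L. smul t w = f v"
    using near_isoD[OF assms(3)] by blast
  have c: "s \<in> carrier R" "t \<in> carrier R" "t \<otimes> s \<in> S" using s t by auto
  have uniq: "smul s v = smul s v'" if v: "v \<in> L" "v' \<in> L" "f v = f v'" for v v'
  proof -
    have vv: "v \<in> vecs UNIV" "v' \<in> vecs UNIV" using submod_vecs[OF assms(1)] v by auto
    have m: "smul (\<ominus> \<one>) v' \<in> L" using v submod_smul[OF assms(1)] by simp
    have w: "vadd v (smul (\<ominus> \<one>) v') \<in> L" using v m submod_vadd[OF assms(1)] by simp
    have "f (vadd v (smul (\<ominus> \<one>) v')) = vadd (f v) (smul (\<ominus> \<one>) (f v'))"
      using lin_vadd[OF f(1) v(1) m] lin_smul[OF f(1) _ v(2), of "\<ominus> \<one>"] by simp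
    also have "\<dots> = vzero" unfolding v(3) using lin_vecs[OF f(1) v(2)] by (rule vadd_minus)
    finally have z: "smul s (vadd v (smul (\<ominus> \<one>) v')) = vzero" by (rule s(2)[OF w])
    show ?thesis
    proof
      fix i
      have "s \<otimes> (v i \<oplus> \<ominus> \<one> \<otimes> v' i) = \<zero>"
        using fun_cong[OF z, of i] by simp
      thus "smul s v i = smul s v' i"
        using c vv by (simp add: l_minus r_distr r_minus add.inv_solve_right' )
    qed
  qed
  define h where "h w = (SOME v. v \<in> L \<and> smul t w = f v)" for w
  have h: "h w \<in> L" "f (h w) = smul t w" if "w \<in> L'" for w
    using someI_ex[of "\<lambda>v. v \<in> L \<and> smul t w = f v"] t(2)[OF that] unfolding h_def Bex_def by simp_all
  define g where "g w = smul s (h w)" for w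
  have gI: "g w = smul s v" if "w \<in> L'" "v \<in> L" "f v = smul t w" for w v
    unfolding g_def by (rule uniq) (use h that in auto)
  have wv: "w \<in> vecs UNIV" if "w \<in> L'" for w using submod_vecs[OF assms(2) that] .
  have hv: "h w \<in> vecs UNIV" if "w \<in> L'" for w using submod_vecs[OF assms(1) h(1)[OF that]] .
  have "lin L' g"
    unfolding lin_def
  proof (intro conjI ballI)
    show "g w \<in> vecs UNIV" if "w \<in> L'" for w using hv[OF that] c by (simp add: g_def)
  next
    fix u w assume uw: "u \<in> L'" "w \<in> L'"
    have "g (vadd u w) = smul s (vadd (h u) (h w))"
    proof (rule gI)
      show "vadd u w \<in> L'" "vadd (h u) (h w) \<in> L"
        using uw h by (auto intro: submod_vadd[OF assms(1)] submod_vadd[OF assms(2)])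
      show "f (vadd (h u) (h w)) = smul t (vadd u w)"
        using uw h c wv by (simp add: lin_vadd[OF f(1)] smul_vadd)
    qed
    thus "g (vadd u w) = vadd (g u) (g w)" using uw hv c by (simp add: g_def smul_vadd)
  next
    fix a w assume aw: "a \<in> carrier R" "w \<in> L'"
    have "g (smul a w) = smul s (smul a (h w))"
    proof (rule gI)
      show "smul a w \<in> L'" "smul a (h w) \<in> L"
        using aw h by (auto intro: submod_smul[OF assms(1)] submod_smul[OF assms(2)])
      show "f (smul a (h w)) = smul t (smul a w)"
        using aw h c wv by (simp add: lin_smul[OF f(1)] smul_smul m_comm)
    qed
    thus "g (smul a w) = smul a (g w)" using aw hv c by (simp add: g_def smul_smul m_comm)
  qed
  moreover have "g w \<in> L" if "w \<in> L'" for w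
    using h(1)[OF that] c submod_smul[OF assms(1)] by (simp add: g_def)
  moreover have "smul (t \<otimes> s) w = vzero" if w: "w \<in> L'" "g w = vzero" for w
  proof -
    have "smul (t \<otimes> s) w = smul s (f (h w))"
      using h[OF w(1)] c wv[OF w(1)] by (simp add: smul_smul m_comm)
    also have "\<dots> = f (g w)" unfolding g_def using h[OF w(1)] c by (simp add: lin_smul[OF f(1)])
    also have "\<dots> = vzero" unfolding w(2) by (rule lin_zero[OF assms(1) f(1)])
    finally show ?thesis .
  qed
  moreover have "\<exists>w\<in>L'. smul (t \<otimes> s) v = g w" if v: "v \<in> L" for v
  proof (rule bexI[of _ "f v"])
    have vv: "v \<in> vecs UNIV" using submod_vecs[OF assms(1) v] .
    have "g (f v) = smul s (smul t v)"
      by (rule gI) (use v f submod_smul[OF assms(1)] c in \<open>auto simp: lin_smul\<close>)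
    thus "smul (t \<otimes> s) v = g (f v)" using c vv by (simp add: smul_smul m_comm)
    show "f v \<in> L'" by (rule f(2)[OF v])
  qed
  ultimately have "near_iso L' L g"
    using near_isoI[of L' g L "t \<otimes> s" "t \<otimes> s"] c by blast
  thus ?thesis by (rule exI[where x = g])
qed

lemma submod_ker_cover: "cover I f L \<Longrightarrow> submod (ker I f)"
  by (auto simp: cover_def intro: submod_ker)

text \<open>Composing a cover with \<open>f\<close> enlarges its kernel only by elements that a fixed denominator moves back.\<close>
lemma pres_near_iso_imp:
  assumes "submod L" "submod L'" "near_iso L L' f" "pres k L"
  shows "pres k L'"
  using assms
proof (induction k arbitrary: L L' f)
  case (Suc k)
  obtain I g where g: "cover I g L" "pres k (ker I g)" using Suc.prems(4) by auto
  obtain s t where f: "lin L f" "\<And>v. v \<in> L \<Longrightarrow> f v \<in> L'"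
    and s: "s \<in> S" "\<And>v. v \<in> L \<Longrightarrow> f v = vzero \<Longrightarrow> smul s v = vzero"
    and t: "t \<in> S" "\<And>w. w \<in> L' \<Longrightarrow> \<exists>v\<in>L. smul t w = f v"
    using near_isoD[OF Suc.prems(3)] by blast
  obtain q where I: "finite I" "lin (vecs I) g" "\<And>r. r \<in> vecs I \<Longrightarrow> g r \<in> L"
    and q: "q \<in> S" "\<And>v. v \<in> L \<Longrightarrow> \<exists>r\<in>vecs I. smul q v = g r"
    using coverD[OF g(1)] by blast
  let ?h = "\<lambda>r. f (g r)"
  have h: "lin (vecs I) ?h" by (rule lin_comp[OF I(2) f(1)]) (use I in auto)
  have "smul (q \<otimes> t) w \<in> ?h ` vecs I" if w: "w \<in> L'" for w
  proof -
    obtain v where v: "v \<in> L" "smul t w = f v" using t(2)[OF w] by blast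
    obtain r where r: "r \<in> vecs I" "smul q v = g r" using q(2)[OF v(1)] by blast
    have "smul (q \<otimes> t) w = smul q (smul t w)"
      using q(1) t(1) submod_vecs[OF Suc.prems(2) w] by (simp add: smul_smul)
    also have "\<dots> = f (smul q v)" unfolding v(2) using q(1) v(1) by (simp add: lin_smul[OF f(1)])
    finally show ?thesis unfolding r(2) using r(1) by blast
  qed
  hence "near L' (?h ` vecs I)" unfolding near_def using q(1) t(1) by (intro bexI[of _ "q \<otimes> t"]) auto
  hence c: "cover I ?h L'" unfolding cover_def using I f h by auto
  have "near_iso (ker I g) (ker I ?h) (\<lambda>v. v)"
  proof (rule near_isoI[OF _ _ one_S _ s(1)])
    show "lin (ker I g) (\<lambda>v. v)" by (rule lin_id[OF submod_ker[OF I(2)]])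
    show "v \<in> ker I ?h" if "v \<in> ker I g" for v
      using that lin_zero[OF Suc.prems(1) f(1)] by (simp add: ker_def)
    show "smul \<one> v = vzero" if "v \<in> ker I g" "v = vzero" for v
      using that by simp
    show "\<exists>v\<in>ker I g. smul s w = v" if w: "w \<in> ker I ?h" for w
    proof -
      have w': "w \<in> vecs I" "f (g w) = vzero" using w by (auto simp: ker_def)
      have "g (smul s w) = smul s (g w)" using s(1) w' by (simp add: lin_smul[OF I(2)])
      also have "\<dots> = vzero" by (rule s(2)[OF I(3)[OF w'(1)] w'(2)])
      finally show ?thesis using s(1) w' by (auto simp: ker_def)
    qed
  qed
  hence "pres k (ker I ?h)"
    by (rule Suc.IH[OF submod_ker[OF I(2)] submod_ker[OF h] _ g(2)])
  thus ?case using c by auto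
qed simp

lemma pres_near_iso:
  assumes "submod L" "submod L'" "near_iso L L' f"
  shows "pres k L \<longleftrightarrow> pres k L'"
  using pres_near_iso_imp near_iso_inverse assms by meson

lemma pres_near_eq:
  assumes "submod L" "submod L'" "near L L'" "near L' L"
  shows "pres k L \<longleftrightarrow> pres k L'"
proof -
  obtain s t where s: "s \<in> S" "\<And>v. v \<in> L \<Longrightarrow> smul s v \<in> L'"
    and t: "t \<in> S" "\<And>v. v \<in> L' \<Longrightarrow> smul t v \<in> L"
    using assms(3,4) by (auto simp: near_def)
  have "near_iso L L' (smul s)"
  proof (rule near_isoI[OF lin_scale[OF assms(1)] s(2) s(1)])
    show "s \<otimes> t \<in> S" using s t by simp
    show "\<exists>v\<in>L. smul (s \<otimes> t) w = smul s v" if "w \<in> L'" for w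
      using that t s submod_vecs[OF assms(2) that] by (intro bexI[of _ "smul t w"]) (auto simp: smul_smul)
  qed (use s in auto)
  thus ?thesis by (rule pres_near_iso[OF assms(1,2)])
qed

subsection \<open>Direct sums and independence of the cover\<close>

lemma ker_id: "ker I (\<lambda>v. v) = {vzero}"
  by (auto simp: ker_def)

lemma submod_vzero: "submod {vzero}"
  using submod_vecs_set[of "{}"] by (simp add: vecs_empty)

lemma pres_vzero: "pres k {vzero}"
proof (induction k)
  case (Suc k)
  have "cover {} (\<lambda>v. v) {vzero}"
    using lin_id[OF submod_vecs_set[of "{}"]] near_refl[OF submod_vzero, of "{vzero}"]
    by (simp add: cover_def vecs_empty)
  moreover have "pres k (ker {} (\<lambda>v. v))" unfolding ker_id by (rule Suc)
  ultimately show ?case unfolding pres.simps by blast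
qed simp

lemma cover_vecs: "finite I \<Longrightarrow> cover I (\<lambda>v. v) (vecs I)"
  by (simp add: cover_def near_refl lin_id)

lemma pres_vecs: "finite I \<Longrightarrow> pres k (vecs I)"
proof (cases k)
  case (Suc n)
  assume "finite I"
  hence "cover I (\<lambda>v. v) (vecs I)" by (rule cover_vecs)
  moreover have "pres n (ker I (\<lambda>v. v))" unfolding ker_id by (rule pres_vzero)
  ultimately show ?thesis unfolding Suc pres.simps by blast
qed simp

definition cover_sum where
  "cover_sum f g r = vadd (f (evens r)) (g (odds r))"

text \<open>Projectivity of free modules: lift the images of the basis, after clearing a common denominator \<open>s\<close>.\<close>
lemma lift_through_cover:
  assumes "cover I f L" "finite J" "lin (vecs J) g" "g ` vecs J \<subseteq> L"
  shows "\<exists>s\<in>S. \<exists>h. lin (vecs J) h \<and> h ` vecs J \<subseteq> vecs I \<and> (\<forall>r\<in>vecs J. f (h r) = smul s (g r))"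
proof -
  obtain s where I: "finite I" "lin (vecs I) f" 
    and s: "s \<in> S" "\<And>v. v \<in> L \<Longrightarrow> \<exists>r\<in>vecs I. smul s v = f r"
    using coverD[OF assms(1)] by blast
  have gu: "g (unit_vec j) \<in> L" if "j \<in> J" for j
    using assms(4) that by auto
  obtain b where b: "\<And>j. j \<in> J \<Longrightarrow> b j \<in> vecs I" "\<And>j. j \<in> J \<Longrightarrow> f (b j) = smul s (g (unit_vec j))"
    using s(2)[OF gu] by metis
  have lh: "lin (vecs J) (lincomb J b)"
    by (rule lin_lincomb_vecs) (use assms(2) b vecs_UNIV in auto)
  have im: "lincomb J b r \<in> vecs I" if "r \<in> vecs J" for r
    by (rule lincomb_vecs[OF assms(2) b(1) vecs_UNIV[OF that]])
  have "f (lincomb J b r) = smul s (g r)" if r: "r \<in> vecs J" for r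
  proof -
    have "f (lincomb J b r) = lincomb J (\<lambda>j. f (b j)) r"
      by (rule lin_of_lincomb[OF submod_vecs_set I(2) assms(2) b(1) vecs_UNIV[OF r]])
    also have "\<dots> = lincomb J (\<lambda>j. smul s (g (unit_vec j))) r"
      using b(2) lin_vecs[OF I(2) b(1)] vecs_UNIV[OF r] by (intro lincomb_cong) auto
    also have "\<dots> = smul s (lincomb J (\<lambda>j. g (unit_vec j)) r)"
      using s(1) lin_vecs[OF assms(3)] vecs_UNIV[OF r] assms(2)
      by (intro lin_of_lincomb[OF submod_vecs_set[of UNIV] lin_scale[OF submod_vecs_set], symmetric]) auto
    also have "\<dots> = smul s (g r)" by (simp only: lin_eq_lincomb[OF assms(2,3) r])
    finally show ?thesis .
  qed
  thus ?thesis using s(1) lh im by (intro bexI[of _ s] exI[of _ "lincomb J b"]) auto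
qed

lemma lin_evens_vecs: "lin (vecs (join_index I J)) evens" "r \<in> vecs (join_index I J) \<Longrightarrow> evens r \<in> vecs I"
  and lin_odds_vecs: "lin (vecs (join_index I J)) odds" "r \<in> vecs (join_index I J) \<Longrightarrow> odds r \<in> vecs J"
  by (simp_all add: lin_evens lin_odds vecs_join_index direct_sum_iff submod_direct_sum)

lemma join_vecs_index: "a \<in> vecs I \<Longrightarrow> b \<in> vecs J \<Longrightarrow> join a b \<in> vecs (join_index I J)"
  by (simp add: vecs_join_index direct_sum_iff)

lemma cover_sum:
  assumes "cover I f L" "submod L" "finite J" "lin (vecs J) g" "g ` vecs J \<subseteq> L"
  shows "cover (join_index I J) (cover_sum f g) L"
proof -
  have I: "finite I" "lin (vecs I) f" "f ` vecs I \<subseteq> L" "near L (f ` vecs I)"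
    using assms(1) by (auto simp: cover_def)
  have "lin (vecs (join_index I J)) (\<lambda>r. f (evens r))"
    by (rule lin_comp[OF lin_evens_vecs(1) I(2)]) (auto simp: lin_evens_vecs)
  moreover have "lin (vecs (join_index I J)) (\<lambda>r. g (odds r))"
    by (rule lin_comp[OF lin_odds_vecs(1) assms(4)]) (auto simp: lin_odds_vecs)
  ultimately have l: "lin (vecs (join_index I J)) (cover_sum f g)"
    unfolding cover_sum_def by (rule lin_add)
  have im: "cover_sum f g ` vecs (join_index I J) \<subseteq> L"
    using I(3) assms(5) lin_evens_vecs(2) lin_odds_vecs(2)
    unfolding cover_sum_def by (force intro!: submod_vadd[OF assms(2)])
  have "f r = cover_sum f g (join r vzero)" if "r \<in> vecs I" for r
    unfolding cover_sum_def evens_join odds_join lin_zero[OF submod_vecs_set assms(4)]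
    using vadd_zero(1)[OF lin_vecs[OF I(2) that]] by simp
  hence "f ` vecs I \<subseteq> cover_sum f g ` vecs (join_index I J)"
    by (auto intro!: image_eqI join_vecs_index)
  hence "near L (cover_sum f g ` vecs (join_index I J))" using I(4) unfolding near_def by (meson subsetD)
  thus ?thesis using l im I assms(3) by (simp add: cover_def finite_join_index)
qed

text \<open>Since a free module lifts through a cover, the kernel of a cover that is enlarged by further
  generators changes by a free direct summand only.\<close>
lemma near_iso_ker_cover_sum:
  assumes "cover I f L" "submod L" "finite J" "lin (vecs J) g" "g ` vecs J \<subseteq> L"
  shows "\<exists>h. near_iso (direct_sum (ker I f) (vecs J)) (ker (join_index I J) (cover_sum f g)) h"
proof -
  have I: "finite I" "lin (vecs I) f" using assms(1) by (auto simp: cover_def)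
  obtain s b where s: "s \<in> S" and b: "lin (vecs J) b" "\<And>r. r \<in> vecs J \<Longrightarrow> b r \<in> vecs I"
    "\<And>r. r \<in> vecs J \<Longrightarrow> f (b r) = smul s (g r)"
    using lift_through_cover[OF assms(1,3,4,5)] by (auto simp: image_subset_iff)
  have sc: "s \<in> carrier R" using s by simp
  let ?D = "direct_sum (ker I f) (vecs J)" and ?K = "ker (join_index I J) (cover_sum f g)"
  \<comment> \<open>As \<open>f (b r) = s g r\<close>, the pairs \<open>(- b r, s r)\<close> are a complement to the kernel of \<open>f\<close>.\<close>
  let ?h = "\<lambda>v. join (vadd (evens v) (smul (\<ominus> \<one>) (b (odds v)))) (smul s (odds v))"
  have D: "submod ?D" by (intro submod_direct_sum submod_ker I submod_vecs_set)
  have Dv: "evens v \<in> vecs I" "f (evens v) = vzero" "odds v \<in> vecs J" if "v \<in> ?D" for v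
    using that by (auto simp: direct_sum_iff ker_def)
  have Kv: "evens v \<in> vecs I" "odds v \<in> vecs J" "vadd (f (evens v)) (g (odds v)) = vzero" if "v \<in> ?K" for v
    using that by (auto simp: ker_def cover_sum_def lin_evens_vecs lin_odds_vecs)
  have od: "lin ?D odds" "lin ?D evens" by (rule lin_odds[OF D], rule lin_evens[OF D])
  have lb: "lin ?D (\<lambda>v. b (odds v))"
    by (rule lin_comp[OF od(1) b(1)]) (auto simp: direct_sum_iff)
  have "lin ?D (\<lambda>v. smul (\<ominus> \<one>) (b (odds v)))"
    by (rule lin_comp[OF lb lin_scale[OF submod_vecs_set[of UNIV]]]) (use lin_vecs[OF lb] in auto)
  hence l1: "lin ?D (\<lambda>v. vadd (evens v) (smul (\<ominus> \<one>) (b (odds v))))"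
    by (rule lin_add[OF od(2)])
  have l2: "lin ?D (\<lambda>v. smul s (odds v))"
    by (rule lin_comp[OF od(1) lin_scale[OF submod_vecs_set[of UNIV]]]) (use lin_vecs[OF od(1)] sc in auto)
  have lh: "lin ?D ?h" by (rule lin_join[OF l1 l2])
  have m1: "\<ominus> \<one> \<in> carrier R" by simp
  have "near_iso ?D ?K ?h"
  proof (rule near_isoI[OF lh _ mult_S[OF s s] _ s])
    fix v assume v: "v \<in> ?D"
    note v' = Dv[OF v]
    note bv = b(2)[OF v'(3)]
    have gv: "g (odds v) \<in> vecs UNIV" using lin_vecs[OF assms(4) v'(3)] .
    have "f (vadd (evens v) (smul (\<ominus> \<one>) (b (odds v)))) = smul (\<ominus> \<one>) (smul s (g (odds v)))"
      unfolding lin_vadd[OF I(2) v'(1) smul_vecs[OF m1 bv]] lin_smul[OF I(2) m1 bv] b(3)[OF v'(3)] v'(2)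
      by (rule vadd_zero(2)[OF smul_vecs[OF m1 smul_vecs[OF sc gv]]])
    moreover have "g (smul s (odds v)) = smul s (g (odds v))" using lin_smul[OF assms(4) sc v'(3)] .
    ultimately have "cover_sum f g (?h v) = vzero"
      unfolding cover_sum_def evens_join odds_join
      using vadd_minus(2)[OF smul_vecs[OF sc gv]] by simp
    moreover have "?h v \<in> vecs (join_index I J)" using v' bv sc by (intro join_vecs_index) auto
    ultimately show "?h v \<in> ?K" by (simp add: ker_def)
  next
    fix v assume v: "v \<in> ?D" and z: "?h v = vzero"
    note v' = Dv[OF v]
    note bv = b(2)[OF v'(3)]
    have 1: "vadd (evens v) (smul (\<ominus> \<one>) (b (odds v))) = vzero" and 2: "smul s (odds v) = vzero"
      using z unfolding join_eq_vzero by blast+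
    have 3: "smul s (b (odds v)) = vzero"
      using lin_smul[OF b(1) sc v'(3)] lin_zero[OF submod_vecs_set b(1)] 2 by simp
    have "smul s (evens v) = vzero"
    proof
      fix i
      have e: "evens v i \<oplus> \<ominus> \<one> \<otimes> b (odds v) i = \<zero>" "s \<otimes> b (odds v) i = \<zero>"
        using fun_cong[OF 1, of i] fun_cong[OF 3, of i] by simp_all
      have c: "evens v i \<in> carrier R" "b (odds v) i \<in> carrier R" using v' bv by simp_all
      have "s \<otimes> evens v i = s \<otimes> (evens v i \<oplus> \<ominus> \<one> \<otimes> b (odds v) i) \<oplus> s \<otimes> b (odds v) i"
        using c sc by algebra
      thus "smul s (evens v) i = vzero i" unfolding e using sc by simp
    qed
    hence "join (smul s (smul s (evens v))) (smul s (smul s (odds v))) = vzero"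
      unfolding 2 join_eq_vzero using sc by simp
    moreover have "smul (s \<otimes> s) v = join (smul s (smul s (evens v))) (smul s (smul s (odds v)))"
      unfolding join_eq_iff evens_odds_simps
      using sc vecs_UNIV[OF v'(1)] vecs_UNIV[OF v'(3)] by (simp add: smul_smul)
    ultimately show "smul (s \<otimes> s) v = vzero" by simp
  next
    fix w assume w: "w \<in> ?K"
    note w' = Kv[OF w]
    note bw = b(2)[OF w'(2)]
    have fw: "f (evens w) \<in> vecs UNIV" and gw: "g (odds w) \<in> vecs UNIV"
      using lin_vecs[OF I(2) w'(1)] lin_vecs[OF assms(4) w'(2)] .
    let ?v = "join (vadd (smul s (evens w)) (b (odds w))) (odds w)"
    have "f (vadd (smul s (evens w)) (b (odds w))) = vadd (smul s (f (evens w))) (smul s (g (odds w)))"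
      using lin_vadd[OF I(2) smul_vecs[OF sc w'(1)] bw] lin_smul[OF I(2) sc w'(1)] b(3)[OF w'(2)] by simp
    also have "\<dots> = smul s (vadd (f (evens w)) (g (odds w)))" using smul_vadd[OF sc fw gw] by simp
    also have "\<dots> = vzero" unfolding w'(3) using sc by simp
    finally have "?v \<in> ?D" using w' bw sc by (simp add: direct_sum_iff ker_def)
    moreover have "smul s w = ?h ?v"
      unfolding join_eq_iff evens_join odds_join evens_odds_simps
    proof (intro conjI refl ext)
      fix i
      have c: "evens w i \<in> carrier R" "b (odds w) i \<in> carrier R" using w' bw by simp_all
      have "s \<otimes> evens w i = s \<otimes> evens w i \<oplus> b (odds w) i \<oplus> \<ominus> \<one> \<otimes> b (odds w) i"
        using c sc by algebra
      thus "smul s (evens w) i = vadd (vadd (smul s (evens w)) (b (odds w))) (smul (\<ominus> \<one>) (b (odds w))) i"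
        by simp
    qed
    ultimately show "\<exists>v\<in>?D. smul s w = ?h v" by blast
  qed
  thus ?thesis by blast
qed

lemma ker_sum_swap:
  assumes "lin (vecs I) f" "lin (vecs J) g"
  shows "near_iso (ker (join_index I J) (cover_sum f g)) (ker (join_index J I) (cover_sum g f))
    (\<lambda>v. join (odds v) (evens v))"
proof -
  have eq: "ker (join_index I J) (cover_sum f g) =
      {v \<in> direct_sum (vecs I) (vecs J). vadd (f (evens v)) (g (odds v)) = vzero}" for I J f g
    by (simp add: ker_def vecs_join_index cover_sum_def)
  have com: "vadd (f (evens v)) (g (odds v)) = vadd (g (odds v)) (f (evens v))"
    if "evens v \<in> vecs I" "odds v \<in> vecs J" for v
    by (rule vadd_comm) (use that assms in \<open>auto intro: lin_vecs\<close>)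
  have sub: "submod (direct_sum (vecs I) (vecs J))" "submod (direct_sum (vecs J) (vecs I))"
    by (intro submod_direct_sum submod_vecs_set)+
  show ?thesis
    unfolding eq
  proof (rule near_isoI[OF _ _ one_S _ one_S])
    show "lin {v \<in> direct_sum (vecs I) (vecs J). vadd (f (evens v)) (g (odds v)) = vzero}
       (\<lambda>v. join (odds v) (evens v))"
      by (rule lin_subset[OF lin_join[OF lin_odds[OF sub(1)] lin_evens[OF sub(1)]]]) auto
    show "join (odds v) (evens v) \<in> {v \<in> direct_sum (vecs J) (vecs I). vadd (g (evens v)) (f (odds v)) = vzero}"
      if "v \<in> {v \<in> direct_sum (vecs I) (vecs J). vadd (f (evens v)) (g (odds v)) = vzero}" for v
      using that com[of v] by (auto simp: direct_sum_iff)
    show "smul \<one> v = vzero" if "v \<in> {v \<in> direct_sum (vecs I) (vecs J). vadd (f (evens v)) (g (odds v)) = vzero}"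
      "join (odds v) (evens v) = vzero" for v
    proof -
      have "join (evens v) (odds v) = vzero" using that(2) unfolding join_eq_vzero by simp
      thus ?thesis using that(1) submod_vecs[OF sub(1)] by simp
    qed
    show "\<exists>v\<in>{v \<in> direct_sum (vecs I) (vecs J). vadd (f (evens v)) (g (odds v)) = vzero}. smul \<one> w = join (odds v) (evens v)"
      if w: "w \<in> {v \<in> direct_sum (vecs J) (vecs I). vadd (g (evens v)) (f (odds v)) = vzero}" for w
    proof (rule bexI[of _ "join (odds w) (evens w)"])
      show "smul \<one> w = join (odds (join (odds w) (evens w))) (evens (join (odds w) (evens w)))"
        unfolding evens_join odds_join join_evens_odds
        by (rule smul_one) (use w submod_vecs[OF sub(2)] in blast)
      show "join (odds w) (evens w) \<in> {v \<in> direct_sum (vecs I) (vecs J). vadd (f (evens v)) (g (odds v)) = vzero}"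
        using w com[of "join (odds w) (evens w)"] by (auto simp: direct_sum_iff)
    qed
  qed
qed

text \<open>Two covers of the same module are compared through their common enlargement. This needs that
  free summands do not matter, which is known one level below at this stage of the induction.\<close>
lemma pres_ker_cover_aux:
  assumes direct_sum: "\<And>L L'. submod L \<Longrightarrow> submod L' \<Longrightarrow> pres k (direct_sum L L') \<longleftrightarrow> pres k L \<and> pres k L'"
    and L: "submod L" and "cover I f L" "cover J g L"
  shows "pres k (ker I f) \<longleftrightarrow> pres k (ker J g)"
proof -
  have half: "pres k (ker (join_index I J) (cover_sum f g)) \<longleftrightarrow> pres k (ker I f)"
    if fg: "cover I f L" "cover J g L" for I J f g
  proof -
    have c: "finite J" "lin (vecs J) g" "g ` vecs J \<subseteq> L" using fg(2) by (auto simp: cover_def)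
    obtain h where h: "near_iso (direct_sum (ker I f) (vecs J)) (ker (join_index I J) (cover_sum f g)) h"
      using near_iso_ker_cover_sum[OF fg(1) L c] by blast
    have s: "submod (ker I f)" "submod (vecs J)" using submod_ker_cover[OF fg(1)] by auto
    have "pres k (ker (join_index I J) (cover_sum f g)) \<longleftrightarrow> pres k (direct_sum (ker I f) (vecs J))"
      using pres_near_iso[OF submod_direct_sum[OF s] submod_ker_cover[OF cover_sum[OF fg(1) L c]] h] by simp
    thus ?thesis using direct_sum[OF s] pres_vecs[OF c(1)] by simp
  qed
  have c: "finite I" "lin (vecs I) f" "f ` vecs I \<subseteq> L" "finite J" "lin (vecs J) g" "g ` vecs J \<subseteq> L"
    using assms(3,4) by (auto simp: cover_def)
  have "pres k (ker (join_index I J) (cover_sum f g)) \<longleftrightarrow> pres k (ker (join_index J I) (cover_sum g f))"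
    using submod_ker_cover cover_sum assms c by (intro pres_near_iso[OF _ _ ker_sum_swap]) blast+
  thus ?thesis using half[OF assms(3,4)] half[OF assms(4,3)] by blast
qed

lemma cover_direct_sum:
  assumes "cover I f L" "cover J g L'" "submod L" "submod L'"
  defines "h \<equiv> \<lambda>r. join (f (evens r)) (g (odds r))"
  shows "cover (join_index I J) h (direct_sum L L')"
    and "ker (join_index I J) h = direct_sum (ker I f) (ker J g)"
proof -
  obtain s where I: "finite I" "lin (vecs I) f" "\<And>r. r \<in> vecs I \<Longrightarrow> f r \<in> L"
    and s: "s \<in> S" "\<And>v. v \<in> L \<Longrightarrow> \<exists>r\<in>vecs I. smul s v = f r"
    using coverD[OF assms(1)] by blast
  obtain t where J: "finite J" "lin (vecs J) g" "\<And>r. r \<in> vecs J \<Longrightarrow> g r \<in> L'"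
    and t: "t \<in> S" "\<And>v. v \<in> L' \<Longrightarrow> \<exists>r\<in>vecs J. smul t v = g r"
    using coverD[OF assms(2)] by blast
  have c: "s \<in> carrier R" "t \<in> carrier R" using s t by auto
  have "lin (vecs (join_index I J)) (\<lambda>r. f (evens r))"
    by (rule lin_comp[OF lin_evens_vecs(1) I(2)]) (auto simp: lin_evens_vecs)
  moreover have "lin (vecs (join_index I J)) (\<lambda>r. g (odds r))"
    by (rule lin_comp[OF lin_odds_vecs(1) J(2)]) (auto simp: lin_odds_vecs)
  ultimately have l: "lin (vecs (join_index I J)) h"
    unfolding h_def by (rule lin_join)
  have im: "h ` vecs (join_index I J) \<subseteq> direct_sum L L'"
    using I(3) J(3) by (auto simp: h_def direct_sum_iff lin_evens_vecs lin_odds_vecs)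
  have "smul (s \<otimes> t) v \<in> h ` vecs (join_index I J)" if v: "v \<in> direct_sum L L'" for v
  proof -
    have v': "evens v \<in> L" "odds v \<in> L'" using v by (auto simp: direct_sum_iff)
    obtain a b where a: "a \<in> vecs I" "smul s (evens v) = f a" and b: "b \<in> vecs J" "smul t (odds v) = g b"
      using s(2)[OF v'(1)] t(2)[OF v'(2)] by blast
    have vv: "evens v \<in> vecs UNIV" "odds v \<in> vecs UNIV"
      using v' submod_vecs[OF assms(3)] submod_vecs[OF assms(4)] by auto
    have "smul (s \<otimes> t) (evens v) = smul t (smul s (evens v))"
      using c vv by (simp add: smul_smul m_comm)
    hence 1: "smul (s \<otimes> t) (evens v) = f (smul t a)" unfolding a(2) lin_smul[OF I(2) c(2) a(1)] .
    have "smul (s \<otimes> t) (odds v) = smul s (smul t (odds v))"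
      using c vv by (simp add: smul_smul)
    hence 2: "smul (s \<otimes> t) (odds v) = g (smul s b)" unfolding b(2) lin_smul[OF J(2) c(1) b(1)] .
    have "smul (s \<otimes> t) v = h (join (smul t a) (smul s b))"
      unfolding h_def join_eq_iff evens_odds_simps 1 2 by simp
    moreover have "join (smul t a) (smul s b) \<in> vecs (join_index I J)"
      using a b c by (intro join_vecs_index) auto
    ultimately show ?thesis by blast
  qed
  hence "near (direct_sum L L') (h ` vecs (join_index I J))"
    unfolding near_def using s t by (intro bexI[of _ "s \<otimes> t"]) auto
  thus "cover (join_index I J) h (direct_sum L L')"
    using l im I J by (simp add: cover_def finite_join_index)
  show "ker (join_index I J) h = direct_sum (ker I f) (ker J g)"
    by (rule Set.set_eqI) (auto simp: ker_def h_def vecs_join_index direct_sum_iff join_eq_vzero)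
qed

lemma cover_image:
  assumes "cover I f L" "lin L g" "g ` L = L'"
  shows "cover I (\<lambda>r. g (f r)) L'"
proof -
  obtain s where I: "finite I" "lin (vecs I) f" "f ` vecs I \<subseteq> L"
    and s: "s \<in> S" "\<And>v. v \<in> L \<Longrightarrow> smul s v \<in> f ` vecs I"
    using assms(1) by (auto simp: cover_def near_def)
  have "smul s w \<in> (\<lambda>r. g (f r)) ` vecs I" if w: "w \<in> L'" for w
  proof -
    obtain v where v: "v \<in> L" "w = g v" using w assms(3) by blast
    have "smul s w = g (smul s v)" unfolding v(2) using lin_smul[OF assms(2) _ v(1)] s(1) by simp
    thus ?thesis using s(2)[OF v(1)] by auto
  qed
  thus ?thesis
    using I lin_comp[OF I(2) assms(2) I(3)] s(1) assms(3) by (auto simp: cover_def near_def)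
qed

text \<open>For the converse direction, project a cover of the sum to covers of the summands. Their direct sum is a
  second cover of the same module, and its kernel decomposes.\<close>
lemma pres_direct_sum:
  "submod L \<Longrightarrow> submod L' \<Longrightarrow> pres k (direct_sum L L') \<longleftrightarrow> pres k L \<and> pres k L'"
proof (induction k arbitrary: L L')
  case (Suc k)
  note D = submod_direct_sum[OF Suc.prems]
  show ?case
  proof
    assume "pres (Suc k) (direct_sum L L')"
    then obtain I f where f: "cover I f (direct_sum L L')" "pres k (ker I f)" by auto
    have "v = evens (join v vzero)" "join v vzero \<in> direct_sum L L'" if "v \<in> L" for v
      using that submod_zero[OF Suc.prems(2)] by (simp_all add: direct_sum_iff)
    hence e: "evens ` direct_sum L L' = L" by (fastforce simp only: direct_sum_iff)
    have "v = odds (join vzero v)" "join vzero v \<in> direct_sum L L'" if "v \<in> L'" for v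
      using that submod_zero[OF Suc.prems(1)] by (simp_all add: direct_sum_iff)
    hence o: "odds ` direct_sum L L' = L'" by (fastforce simp only: direct_sum_iff)
    have c1: "cover I (\<lambda>r. evens (f r)) L" by (rule cover_image[OF f(1) lin_evens[OF D] e])
    have c2: "cover I (\<lambda>r. odds (f r)) L'" by (rule cover_image[OF f(1) lin_odds[OF D] o])
    note c = cover_direct_sum[OF c1 c2 Suc.prems]
    have "pres k (direct_sum (ker I (\<lambda>r. evens (f r))) (ker I (\<lambda>r. odds (f r))))"
      using pres_ker_cover_aux[OF Suc.IH D f(1) c(1)] f(2) unfolding c(2) by simp
    hence "pres k (ker I (\<lambda>r. evens (f r)))" "pres k (ker I (\<lambda>r. odds (f r)))"
      using Suc.IH[OF submod_ker_cover[OF c1] submod_ker_cover[OF c2]] by blast+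
    thus "pres (Suc k) L \<and> pres (Suc k) L'" using c1 c2 unfolding pres.simps by blast
  next
    assume "pres (Suc k) L \<and> pres (Suc k) L'"
    then obtain I f J g where f: "cover I f L" "pres k (ker I f)" and g: "cover J g L'" "pres k (ker J g)"
      by auto
    note c = cover_direct_sum[OF f(1) g(1) Suc.prems]
    have "pres k (direct_sum (ker I f) (ker J g))"
      using Suc.IH[OF submod_ker_cover[OF f(1)] submod_ker_cover[OF g(1)]] f(2) g(2) by blast
    thus "pres (Suc k) (direct_sum L L')" using c(1) unfolding pres.simps c(2)[symmetric] by blast
  qed
qed simp

text \<open>Schanuel's lemma in the form used from now on: any cover decides the length of presentations.\<close>
lemma pres_Suc_cover:
  assumes "submod L" "cover I f L"
  shows "pres (Suc k) L \<longleftrightarrow> pres k (ker I f)"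
  using pres_ker_cover_aux[OF pres_direct_sum assms(1) _ assms(2)] assms(2) unfolding pres.simps by blast

end

section \<open>Divisibility near a prime and elimination\<close>
context cring
begin

text \<open>Ideals are modelled on the first coordinate axis; \<open>principal b\<close> is multiplication by \<open>b\<close>.\<close>
definition principal :: "'a \<Rightarrow> (nat \<Rightarrow> 'a) \<Rightarrow> nat \<Rightarrow> 'a"
  where "principal b r = smul (r 0 \<otimes> b) (unit_vec 0)"

definition ann :: "'a \<Rightarrow> (nat \<Rightarrow> 'a) set"
  where "ann z = {r \<in> vecs {0}. r 0 \<otimes> z = \<zero>}"

lemma lin_coord:
  assumes "submod L" "a \<in> carrier R" "w \<in> vecs UNIV"
  shows "lin L (\<lambda>v. smul (a \<otimes> v c) w)"
  unfolding lin_def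
proof (intro conjI ballI)
  fix u v assume uv: "u \<in> L" "v \<in> L"
  have uv': "u \<in> vecs UNIV" "v \<in> vecs UNIV" using uv submod_vecs[OF assms(1)] by auto
  show "smul (a \<otimes> vadd u v c) w = vadd (smul (a \<otimes> u c) w) (smul (a \<otimes> v c) w)"
    using uv' assms by (intro ext) (simp add: l_distr r_distr)
next
  fix b v assume bv: "b \<in> carrier R" "v \<in> L"
  have bv': "v \<in> vecs UNIV" using bv submod_vecs[OF assms(1)] by auto
  show "smul (a \<otimes> smul b v c) w = smul b (smul (a \<otimes> v c) w)"
    using bv' bv assms by (intro ext) (simp add: m_ac)
qed (use assms submod_vecs in auto)

lemma vec1_eq: "v \<in> vecs {i} \<Longrightarrow> v = smul (v i) (unit_vec i)"
  by (rule ext) (auto simp: unit_vec_apply vecs_outside)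

lemma lin_principal: "b \<in> carrier R \<Longrightarrow> lin (vecs {0}) (principal b)"
  unfolding principal_def using lin_coord[OF submod_vecs_set[of "{0}"], of b "unit_vec 0" 0]
  unfolding lin_def by (auto simp: m_comm l_distr)

lemma principal_vecs: "b \<in> carrier R \<Longrightarrow> r \<in> vecs UNIV \<Longrightarrow> principal b r \<in> vecs {0}"
  by (simp add: principal_def)

lemma principal_apply: "b \<in> carrier R \<Longrightarrow> r \<in> vecs UNIV \<Longrightarrow> principal b r 0 = r 0 \<otimes> b"
  by (simp add: principal_def unit_vec_apply)

lemma vec1_eqI: "u \<in> vecs {i} \<Longrightarrow> v \<in> vecs {i} \<Longrightarrow> u i = v i \<Longrightarrow> u = v"
  by (metis vec1_eq)

lemma ker_principal: "b \<in> carrier R \<Longrightarrow> ker {0} (principal b) = ann b"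
proof -
  assume b: "b \<in> carrier R"
  have "principal b r = vzero \<longleftrightarrow> r 0 \<otimes> b = \<zero>" if r: "r \<in> vecs {0}" for r
    using principal_apply[OF b vecs_UNIV[OF r]] vec1_eqI[of "principal b r" 0 vzero]
      principal_vecs[OF b vecs_UNIV[OF r]] by auto
  thus ?thesis by (auto simp: ker_def ann_def)
qed

lemma submod_ann: "z \<in> carrier R \<Longrightarrow> submod (ann z)"
  using submod_ker[OF lin_principal] ker_principal by simp

lemma submod_syz:
  assumes "finite I" "\<And>i. i \<in> I \<Longrightarrow> x i \<in> vecs UNIV"
  shows "submod (syz I x)"
  unfolding syz_def by (rule submod_ker[OF lin_lincomb_vecs[OF assms]])

lemma lincomb_generator:
  assumes "finite I" "i \<in> I" "\<And>j. j \<in> I \<Longrightarrow> x j \<in> vecs UNIV"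
  shows "x i \<in> lincomb I x ` vecs I"
  using lincomb_unit_vec[of I i x] assms by (intro image_eqI[of _ _ "unit_vec i"]) auto

end

context at_prime
begin

definition nzero :: "'a \<Rightarrow> bool"
  where "nzero a \<longleftrightarrow> (\<exists>s\<in>S. s \<otimes> a = \<zero>)"

definition ndvd :: "'a \<Rightarrow> 'a \<Rightarrow> bool"
  where "ndvd z w \<longleftrightarrow> (\<exists>s\<in>S. \<exists>a\<in>carrier R. s \<otimes> w = a \<otimes> z)"

lemma nzero_mult: "a \<in> carrier R \<Longrightarrow> b \<in> carrier R \<Longrightarrow> nzero a \<Longrightarrow> nzero (b \<otimes> a)"
proof -
  assume *: "a \<in> carrier R" "b \<in> carrier R" "nzero a"
  then obtain s where s: "s \<in> S" "s \<otimes> a = \<zero>" by (auto simp: nzero_def)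
  have "s \<otimes> (b \<otimes> a) = b \<otimes> (s \<otimes> a)" using * s(1) by (simp add: m_lcomm)
  also have "\<dots> = \<zero>" unfolding s(2) using * by simp
  finally show ?thesis using s(1) by (auto simp: nzero_def)
qed

lemma nzero_cancel: "a \<in> carrier R \<Longrightarrow> s \<in> S \<Longrightarrow> nzero (s \<otimes> a) \<Longrightarrow> nzero a"
proof -
  assume *: "a \<in> carrier R" "s \<in> S" "nzero (s \<otimes> a)"
  then obtain t where t: "t \<in> S" "t \<otimes> (s \<otimes> a) = \<zero>" by (auto simp: nzero_def)
  thus ?thesis unfolding nzero_def using * by (intro bexI[of _ "t \<otimes> s"]) (auto simp: m_assoc)
qed

lemma nzero_zero: "nzero \<zero>"
  unfolding nzero_def by (rule bexI[OF _ one_S]) simp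

lemma ndvd_refl: "a \<in> carrier R \<Longrightarrow> ndvd a a"
  unfolding ndvd_def by (rule bexI[OF _ one_S], rule bexI[OF _ one_closed]) simp

lemma ndvd_trans:
  assumes "a \<in> carrier R" "b \<in> carrier R" "c \<in> carrier R" "ndvd a b" "ndvd b c"
  shows "ndvd a c"
proof -
  obtain s r t q where s: "s \<in> S" "r \<in> carrier R" "s \<otimes> b = r \<otimes> a" and t: "t \<in> S" "q \<in> carrier R" "t \<otimes> c = q \<otimes> b"
    using assms(4,5) by (auto simp: ndvd_def)
  have "(s \<otimes> t) \<otimes> c = q \<otimes> (s \<otimes> b)" using s(1) t assms(2,3)
    by (simp add: m_assoc m_lcomm)
  also have "\<dots> = (q \<otimes> r) \<otimes> a" unfolding s(3) using s t assms by (simp add: m_assoc)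
  finally show ?thesis unfolding ndvd_def using s t by (intro bexI[of _ "s \<otimes> t"] bexI[of _ "q \<otimes> r"]) auto
qed

lemma common_annihilator:
  assumes "finite A" "\<And>a. a \<in> A \<Longrightarrow> w a \<in> carrier R" "\<And>a. a \<in> A \<Longrightarrow> nzero (w a)"
  shows "\<exists>s\<in>S. \<forall>a\<in>A. s \<otimes> w a = \<zero>"
proof (rule common_denominator[OF assms(1)])
  show "\<exists>s\<in>S. s \<otimes> w a = \<zero>" if "a \<in> A" for a
    using assms(3)[OF that] by (simp add: nzero_def)
  show "t \<otimes> s \<otimes> w a = \<zero>" if "a \<in> A" "s \<in> S" "t \<in> S" "s \<otimes> w a = \<zero>" for a s t
    using that assms(2)[OF that(1)] by (simp add: m_assoc)
qed

lemma common_multiple_denominator: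
  assumes "finite A" "z \<in> carrier R" "\<And>a. a \<in> A \<Longrightarrow> w a \<in> carrier R" "\<And>a. a \<in> A \<Longrightarrow> ndvd z (w a)"
  shows "\<exists>s\<in>S. \<forall>a\<in>A. \<exists>b\<in>carrier R. s \<otimes> w a = b \<otimes> z"
proof (rule common_denominator[OF assms(1)])
  show "\<exists>s\<in>S. \<exists>b\<in>carrier R. s \<otimes> w a = b \<otimes> z" if "a \<in> A" for a
    using assms(4)[OF that] by (simp add: ndvd_def)
  show "\<exists>b\<in>carrier R. t \<otimes> s \<otimes> w a = b \<otimes> z"
    if a: "a \<in> A" and st: "s \<in> S" "t \<in> S" and e: "\<exists>b\<in>carrier R. s \<otimes> w a = b \<otimes> z" for a s t
  proof -
    obtain b where b: "b \<in> carrier R" "s \<otimes> w a = b \<otimes> z" using e by blast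
    have "t \<otimes> s \<otimes> w a = t \<otimes> (s \<otimes> w a)" using st assms(3)[OF a] by (simp add: m_assoc)
    also have "\<dots> = (t \<otimes> b) \<otimes> z" unfolding b(2) using b(1) st assms(2) by (simp add: m_assoc)
    finally show ?thesis using b(1) st by (intro bexI[of _ "t \<otimes> b"]) simp_all
  qed
qed

lemma ex_ndvd_least:
  assumes "finite B" "B \<noteq> {}" "B \<subseteq> carrier R" "\<And>a b. a \<in> B \<Longrightarrow> b \<in> B \<Longrightarrow> ndvd a b \<or> ndvd b a"
  shows "\<exists>b\<in>B. \<forall>a\<in>B. ndvd b a"
  using assms
proof (induction B rule: finite_ne_induct)
  case (singleton x)
  thus ?case using ndvd_refl by auto
next
  case (insert x B)
  then obtain b where b: "b \<in> B" "\<forall>a\<in>B. ndvd b a" by auto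
  consider "ndvd x b" | "ndvd b x" using insert.prems b by auto
  thus ?case
  proof cases
    case 1
    have "ndvd x a" if "a \<in> insert x B" for a
      using that b 1 ndvd_refl ndvd_trans[of x b a] insert.prems(1) by auto
    thus ?thesis by blast
  next
    case 2
    thus ?thesis using b by auto
  qed
qed

text \<open>Both families cover the sum of their spans, so that any cover of this sum compares their syzygies.\<close>
lemma pres_syz_span:
  assumes "finite I" "finite J"
    and x: "\<And>i. i \<in> I \<Longrightarrow> x i \<in> vecs UNIV" and y: "\<And>j. j \<in> J \<Longrightarrow> y j \<in> vecs UNIV"
    and xy: "\<And>i. i \<in> I \<Longrightarrow> \<exists>s\<in>S. smul s (x i) \<in> lincomb J y ` vecs J"
    and yx: "\<And>j. j \<in> J \<Longrightarrow> \<exists>s\<in>S. smul s (y j) \<in> lincomb I x ` vecs I"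
  shows "pres k (syz I x) \<longleftrightarrow> pres k (syz J y)"
proof -
  let ?X = "lincomb I x ` vecs I" and ?Y = "lincomb J y ` vecs J"
  let ?L = "{vadd u v |u v. u \<in> ?X \<and> v \<in> ?Y}"
  have lx: "lin (vecs I) (lincomb I x)" and ly: "lin (vecs J) (lincomb J y)"
    using assms by (auto intro: lin_lincomb_vecs)
  have sx: "submod ?X" and sy: "submod ?Y" by (rule submod_image[OF submod_vecs_set lx], rule submod_image[OF submod_vecs_set ly])
  have L: "submod ?L" by (rule submod_sum[OF sx sy])
  have "near ?X ?Y"
    by (rule near_image[OF assms(1) lx sy]) (use xy lincomb_unit_vec[OF assms(1) _ x] in auto)
  then obtain s where s: "s \<in> S" "\<And>v. v \<in> ?X \<Longrightarrow> smul s v \<in> ?Y" unfolding near_def by blast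
  have "near ?Y ?X"
    by (rule near_image[OF assms(2) ly sx]) (use yx lincomb_unit_vec[OF assms(2) _ y] in auto)
  then obtain t where t: "t \<in> S" "\<And>v. v \<in> ?Y \<Longrightarrow> smul t v \<in> ?X" unfolding near_def by blast
  have "smul t w \<in> ?X" if w: "w \<in> ?L" for w
  proof -
    obtain u v where uv: "w = vadd u v" "u \<in> ?X" "v \<in> ?Y" using w by blast
    have "smul t w = vadd (smul t u) (smul t v)"
      unfolding uv(1) using t(1) submod_vecs[OF sx uv(2)] submod_vecs[OF sy uv(3)] by (simp add: smul_vadd)
    thus ?thesis using submod_vadd[OF sx submod_smul[OF sx _ uv(2)] t(2)[OF uv(3)], of t] t(1) by simp
  qed
  hence nx: "near ?L ?X" unfolding near_def using t(1) by blast
  have "smul s w \<in> ?Y" if w: "w \<in> ?L" for w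
  proof -
    obtain u v where uv: "w = vadd u v" "u \<in> ?X" "v \<in> ?Y" using w by blast
    have "smul s w = vadd (smul s u) (smul s v)"
      unfolding uv(1) using s(1) submod_vecs[OF sx uv(2)] submod_vecs[OF sy uv(3)] by (simp add: smul_vadd)
    thus ?thesis using submod_vadd[OF sy s(2)[OF uv(2)] submod_smul[OF sy _ uv(3)], of s] s(1) by simp
  qed
  hence ny: "near ?L ?Y" unfolding near_def using s(1) by blast
  have "?X \<subseteq> ?L"
  proof
    fix u assume u: "u \<in> ?X"
    have "u = vadd u vzero" using submod_vecs[OF sx u] by simp
    thus "u \<in> ?L" using u submod_zero[OF sy] by blast
  qed
  hence cx: "cover I (lincomb I x) ?L" unfolding cover_def using assms(1) lx nx by blast
  have "?Y \<subseteq> ?L"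
  proof
    fix u assume u: "u \<in> ?Y"
    have "u = vadd vzero u" using submod_vecs[OF sy u] by simp
    thus "u \<in> ?L" using u submod_zero[OF sx] by blast
  qed
  hence cy: "cover J (lincomb J y) ?L" unfolding cover_def using assms(2) ly ny by blast
  show ?thesis
    using pres_Suc_cover[OF L cx, of k] pres_Suc_cover[OF L cy, of k] unfolding syz_def by blast
qed

subsection \<open>Elimination with a pivot\<close>

text \<open>Column operations with the pivot \<open>z\<close> clear its row \<open>j\<^sub>0\<close>. In a relation between the new members the
  coefficient \<open>r\<close> of the pivot member then satisfies \<open>r z = 0\<close>. Since \<open>z\<close> divides all entries, the pivot
  member drops out of the relation, and the syzygies split.\<close>
lemma pres_syz_pivot:
  assumes I: "finite I" "i\<^sub>0 \<in> I" and x: "\<And>i. i \<in> I \<Longrightarrow> x i \<in> vecs C" and C: "finite C" 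
    and z: "z = x i\<^sub>0 j\<^sub>0" and dvd: "\<And>i c. i \<in> I \<Longrightarrow> c \<in> C \<Longrightarrow> ndvd z (x i c)"
  shows "\<exists>x'. (\<forall>i\<in>I. x' i \<in> vecs C) \<and>
    (\<forall>k. pres k (syz I x) \<longleftrightarrow> pres k (ann z) \<and> pres k (syz (I - {i\<^sub>0}) x'))"
proof -
  have zc: "z \<in> carrier R" using x[OF I(2)] unfolding z by simp
  have xc: "x i c \<in> carrier R" if "i \<in> I" for i c using x[OF that] by simp
  have "\<exists>s\<in>S. \<forall>p\<in>I \<times> C. \<exists>a\<in>carrier R. s \<otimes> x (fst p) (snd p) = a \<otimes> z"
    by (rule common_multiple_denominator) (use I C zc xc dvd in auto)
  then obtain s where s: "s \<in> S" and sx: "\<forall>p\<in>I \<times> C. \<exists>a\<in>carrier R. s \<otimes> x (fst p) (snd p) = a \<otimes> z" by blast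
  have "\<exists>a\<in>carrier R. s \<otimes> x i c = a \<otimes> z" if "i \<in> I" "c \<in> C" for i c
    using bspec[OF sx, of "(i, c)"] that by simp
  moreover have "\<exists>a\<in>carrier R. s \<otimes> x i c = a \<otimes> z" if "i \<in> I" "c \<notin> C" for i c
    using vecs_outside[OF x[OF that(1)] that(2)] s zc by (intro bexI[of _ \<zero>]) auto
  ultimately have "\<exists>a\<in>carrier R. s \<otimes> x i c = a \<otimes> z" if "i \<in> I" for i c
    using that by blast
  then obtain a where a: "\<And>i c. i \<in> I \<Longrightarrow> a i c \<in> carrier R" "\<And>i c. i \<in> I \<Longrightarrow> s \<otimes> x i c = a i c \<otimes> z"
    by metis
  have sc: "s \<in> carrier R" using s by simp
  define x' where "x' i = (if i = i\<^sub>0 then x i else vadd (smul s (x i)) (smul (\<ominus> a i j\<^sub>0) (x i\<^sub>0)))" for i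
  have x'0: "x' i\<^sub>0 = x i\<^sub>0" by (simp add: x'_def)
  have x'i: "x' i = vadd (smul s (x i)) (smul (\<ominus> a i j\<^sub>0) (x i\<^sub>0))" if "i \<noteq> i\<^sub>0" for i
    using that by (simp add: x'_def)
  have x'C: "x' i \<in> vecs C" if "i \<in> I" for i
    unfolding x'_def using x[OF that] x[OF I(2)] a(1)[OF that] sc by simp
  have x'U: "x' i \<in> vecs UNIV" and xU: "x i \<in> vecs UNIV" if "i \<in> I" for i
    using vecs_UNIV x'C[OF that] x[OF that] by auto
  have x'j: "x' i j\<^sub>0 = \<zero>" if "i \<in> I - {i\<^sub>0}" for i
  proof -
    have i: "i \<in> I" "i \<noteq> i\<^sub>0" using that by auto
    have "x' i j\<^sub>0 = s \<otimes> x i j\<^sub>0 \<oplus> \<ominus> a i j\<^sub>0 \<otimes> z" unfolding x'i[OF i(2)] z by simp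
    also have "\<dots> = \<zero>" unfolding a(2)[OF i(1)] using a(1)[OF i(1)] zc by (simp add: l_minus r_neg)
    finally show ?thesis .
  qed
  let ?I = "I - {i\<^sub>0}"
  have fI: "finite ?I" using I by simp
  have lx: "lin (vecs I) (lincomb I x)" and lx': "lin (vecs I) (lincomb I x')"
    using I xU x'U by (auto intro: lin_lincomb_vecs)
  have sx: "submod (lincomb I x ` vecs I)" and sx': "submod (lincomb I x' ` vecs I)"
    by (rule submod_image[OF submod_vecs_set lx], rule submod_image[OF submod_vecs_set lx'])
  have mx: "x i \<in> lincomb I x ` vecs I" and mx': "x' i \<in> lincomb I x' ` vecs I" if "i \<in> I" for i
    by (intro lincomb_generator I that xU x'U; assumption)+
  have span: "pres k (syz I x) \<longleftrightarrow> pres k (syz I x')" for k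
  proof (rule pres_syz_span[OF I(1) I(1) xU x'U])
    fix i assume i: "i \<in> I"
    show "\<exists>s\<in>S. smul s (x' i) \<in> lincomb I x ` vecs I"
    proof (rule bexI[OF _ one_S])
      have "x' i \<in> lincomb I x ` vecs I"
        unfolding x'_def using mx[OF i] mx[OF I(2)] a(1)[OF i] sc
        by (auto intro!: submod_vadd[OF sx] submod_smul[OF sx])
      thus "smul \<one> (x' i) \<in> lincomb I x ` vecs I" using x'U[OF i] by simp
    qed
    show "\<exists>s\<in>S. smul s (x i) \<in> lincomb I x' ` vecs I"
    proof (cases "i = i\<^sub>0")
      case True
      thus ?thesis using mx'[OF I(2)] xU[OF I(2)] unfolding x'0 by (intro bexI[OF _ one_S]) simp
    next
      case False
      have "smul s (x i) = vadd (x' i) (smul (a i j\<^sub>0) (x' i\<^sub>0))"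
      proof
        fix c
        have c: "x i c \<in> carrier R" "x i\<^sub>0 c \<in> carrier R" "a i j\<^sub>0 \<in> carrier R" using xc I(2) i a(1) by auto
        show "smul s (x i) c = vadd (x' i) (smul (a i j\<^sub>0) (x' i\<^sub>0)) c"
          unfolding x'i[OF False] x'0 using c sc by (simp, algebra)
      qed
      hence "smul s (x i) \<in> lincomb I x' ` vecs I"
        using submod_vadd[OF sx' mx'[OF i] submod_smul[OF sx' a(1)[OF i] mx'[OF I(2)]]] by simp
      thus ?thesis using s by blast
    qed
  qed
  \<comment> \<open>After the elimination the pivot row splits off: its coordinate \<open>j\<^sub>0\<close> detects it.\<close>
  have lI: "lin (vecs J) (lincomb ?I x')" for J using fI x'U by (intro lin_lincomb_vecs) auto
  have remove_pivot: "lincomb I x' r = vadd (smul (r i\<^sub>0) (x i\<^sub>0)) (lincomb ?I x' r)" if "r \<in> vecs UNIV" for r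
    using lincomb_remove[OF I, of x' r] x'U that unfolding x'0 by blast
  let ?A = "ann z" and ?K = "syz ?I x'"
  have sA: "submod ?A" and sK: "submod ?K" and sx'z: "submod (syz I x')"
    using submod_ann[OF zc] submod_syz[OF fI] submod_syz[OF I(1)] x'U by auto
  let ?h = "\<lambda>v. vadd (smul (s \<otimes> evens v 0) (unit_vec i\<^sub>0)) (odds v)"
  have sD: "submod (direct_sum ?A ?K)" by (rule submod_direct_sum[OF sA sK])
  have lh: "lin (direct_sum ?A ?K) ?h"
  proof (rule lin_add[OF _ lin_odds[OF sD]])
    show "lin (direct_sum ?A ?K) (\<lambda>v. smul (s \<otimes> evens v 0) (unit_vec i\<^sub>0))"
      by (rule lin_comp[OF lin_evens[OF sD] lin_coord[OF submod_vecs_set[of UNIV] sc]])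
         (auto intro: evens_vecs submod_vecs[OF sD])
  qed
  have s_kills: "smul (s \<otimes> r) (x i\<^sub>0) = vzero" if r: "r \<in> carrier R" "r \<otimes> z = \<zero>" for r
  proof
    fix c
    have "s \<otimes> r \<otimes> x i\<^sub>0 c = r \<otimes> (s \<otimes> x i\<^sub>0 c)" using r sc xc[OF I(2)] by (simp add: m_ac)
    also have "\<dots> = a i\<^sub>0 c \<otimes> (r \<otimes> z)" unfolding a(2)[OF I(2)] using r(1) zc a(1)[OF I(2)] by (simp add: m_ac)
    also have "\<dots> = \<zero>" unfolding r(2) using a(1)[OF I(2)] by simp
    finally show "smul (s \<otimes> r) (x i\<^sub>0) c = vzero c" by simp
  qed
  have Kv: "v \<in> vecs ?I" "lincomb ?I x' v = vzero" if "v \<in> ?K" for v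
    using that by (auto simp: syz_def ker_def)
  have "near_iso (direct_sum ?A ?K) (syz I x') ?h"
  proof (rule near_isoI[OF lh _ s _ s])
    fix v assume v: "v \<in> direct_sum ?A ?K"
    let ?r = "evens v 0" and ?b = "odds v"
    have e: "evens v \<in> vecs {0}" "?r \<otimes> z = \<zero>" and o: "?b \<in> ?K" using v by (auto simp: direct_sum_iff ann_def)
    have r: "?r \<in> carrier R" using e by simp
    note b = Kv[OF o]
    have bI: "?b \<in> vecs I" using b(1) by (rule vecs_mono[rotated]) auto
    have hv: "?h v \<in> vecs I" using bI r sc I(2) by simp
    have bi: "?b i\<^sub>0 = \<zero>" using vecs_outside[OF b(1)] by simp
    have hi: "?h v i\<^sub>0 = s \<otimes> ?r" using bi r sc by (simp add: unit_vec_apply)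
    have "lincomb ?I x' (?h v) = lincomb ?I x' ?b"
      using b(1) r sc x'U hv vecs_UNIV
      by (intro lincomb_cong) (auto simp: unit_vec_apply)
    hence "lincomb I x' (?h v) = vadd (smul (s \<otimes> ?r) (x i\<^sub>0)) vzero"
      unfolding remove_pivot[OF vecs_UNIV[OF hv]] hi b(2) by simp
    thus "?h v \<in> syz I x'" using s_kills[OF r e(2)] hv vadd_zero(1)[of vzero UNIV] by (simp add: syz_def ker_def)
    assume h0: "?h v = vzero"
    have sr: "s \<otimes> ?r = \<zero>" using hi h0 by simp
    have "?b c = \<zero>" for c
      using fun_cong[OF h0, of c] bi b(1) sr by (cases "c = i\<^sub>0") (auto simp: unit_vec_apply)
    hence b0: "?b = vzero" by (simp add: fun_eq_iff)
    have "smul s (evens v) = vzero"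
      by (rule vec1_eqI[of _ 0]) (use e sc sr in auto)
    moreover have "smul s (odds v) = vzero" unfolding b0 using sc by simp
    ultimately have "join (smul s (evens v)) (smul s (odds v)) = vzero" unfolding join_eq_vzero by blast
    thus "smul s v = vzero" by (simp add: smul_join[symmetric])
  next
    fix w assume "w \<in> syz I x'"
    hence w: "w \<in> vecs I" "lincomb I x' w = vzero" by (auto simp: syz_def ker_def)
    have wU: "w \<in> vecs UNIV" by (rule vecs_UNIV[OF w(1)])
    define w' where "w' = (\<lambda>i. if i = i\<^sub>0 then \<zero> else w i)"
    have w'I: "w' \<in> vecs ?I" using w(1) unfolding vecs_def w'_def by auto
    have w'U: "w' \<in> vecs UNIV" by (rule vecs_UNIV[OF w'I])
    have split: "lincomb I x' w = vadd (smul (w i\<^sub>0) (x i\<^sub>0)) (lincomb ?I x' w')"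
    proof -
      have "lincomb ?I x' w = lincomb ?I x' w'"
        using x'U wU by (intro lincomb_cong) (auto simp: w'_def)
      thus ?thesis unfolding remove_pivot[OF wU] by simp
    qed
    have lU: "lincomb ?I x' w' \<in> vecs UNIV" using lin_vecs[OF lI w'U] .
    have "lincomb ?I x' w' j\<^sub>0 = (\<Oplus>i\<in>?I. \<zero>)"
      unfolding lincomb_def using x'j w'U by (intro finsum_cong') auto
    hence "w i\<^sub>0 \<otimes> z = lincomb I x' w j\<^sub>0" unfolding split z using w(1) xc[OF I(2)] by simp
    hence wz: "w i\<^sub>0 \<otimes> z = \<zero>" unfolding w(2) by simp
    have wc: "w i\<^sub>0 \<in> carrier R" using w(1) by simp
    have "vzero = smul s (lincomb I x' w)" unfolding w(2) using sc by simp
    also have "\<dots> = vadd (smul (s \<otimes> w i\<^sub>0) (x i\<^sub>0)) (smul s (lincomb ?I x' w'))"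
      unfolding split using sc wc xU[OF I(2)] lU by (simp add: smul_vadd smul_smul)
    also have "\<dots> = lincomb ?I x' (smul s w')"
      unfolding s_kills[OF wc wz] lin_smul[OF lI sc w'U] by (rule vadd_zero(2)[OF smul_vecs[OF sc lU]])
    finally have k: "smul s w' \<in> ?K" using w'I sc by (simp add: syz_def ker_def)
    let ?v = "join (smul (w i\<^sub>0) (unit_vec 0)) (smul s w')"
    have "smul (w i\<^sub>0) (unit_vec 0) \<in> ?A" using wc wz by (simp add: ann_def unit_vec_apply)
    hence v: "?v \<in> direct_sum ?A ?K" using k by (simp add: direct_sum_iff)
    have "smul s w = ?h ?v"
      unfolding evens_join odds_join
    proof
      fix c
      show "smul s w c = vadd (smul (s \<otimes> smul (w i\<^sub>0) (unit_vec 0) 0) (unit_vec i\<^sub>0)) (smul s w') c"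
        using wc sc w(1) by (simp add: unit_vec_apply w'_def)
    qed
    thus "\<exists>v\<in>direct_sum ?A ?K. smul s w = ?h v" using v by blast
  qed
  hence "pres k (syz I x') \<longleftrightarrow> pres k ?A \<and> pres k ?K" for k
    using pres_near_iso[OF sD sx'z] pres_direct_sum[OF sA sK] by blast
  thus ?thesis using span x'C by blast
qed

end

section \<open>Primes at which the ring is a chain ring\<close>
context at_prime
begin

lemma principal_image:
  assumes "b \<in> carrier R"
  shows "v \<in> principal b ` vecs {0} \<longleftrightarrow> v \<in> vecs {0} \<and> (\<exists>a\<in>carrier R. v 0 = a \<otimes> b)"
proof
  assume "v \<in> principal b ` vecs {0}"
  then obtain r where r: "r \<in> vecs {0}" "v = principal b r" by blast
  show "v \<in> vecs {0} \<and> (\<exists>a\<in>carrier R. v 0 = a \<otimes> b)"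
    unfolding r(2) using principal_vecs[OF assms vecs_UNIV[OF r(1)]] principal_apply[OF assms vecs_UNIV[OF r(1)]]
      vecs_carrier[OF r(1)] by blast
next
  assume *: "v \<in> vecs {0} \<and> (\<exists>a\<in>carrier R. v 0 = a \<otimes> b)"
  then obtain a where a: "a \<in> carrier R" "v 0 = a \<otimes> b" by blast
  let ?r = "smul a (unit_vec 0)"
  have r: "?r \<in> vecs {0}" "?r \<in> vecs UNIV" using a by simp_all
  have "principal b ?r 0 = v 0"
    unfolding principal_apply[OF assms r(2)] a(2) using a(1) by (simp add: unit_vec_apply)
  hence "principal b ?r = v"
    by (rule vec1_eqI[OF principal_vecs[OF assms r(2)] conjunct1[OF *]])
  thus "v \<in> principal b ` vecs {0}" using r(1) by blast
qed

lemma cover_ann_principal: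
  assumes "z \<in> carrier R" "b \<in> carrier R"
  shows "cover {0} (principal b) (ann z) \<longleftrightarrow> b \<otimes> z = \<zero> \<and>
    (\<exists>s\<in>S. \<forall>r\<in>carrier R. r \<otimes> z = \<zero> \<longrightarrow> (\<exists>a\<in>carrier R. s \<otimes> r = a \<otimes> b))"
proof
  assume c: "cover {0} (principal b) (ann z)"
  have "unit_vec 0 \<in> vecs {0}" by simp
  hence "principal b (unit_vec 0) \<in> ann z" using c unfolding cover_def by blast
  hence "b \<otimes> z = \<zero>" using principal_apply[OF assms(2), of "unit_vec 0"] assms by (simp add: ann_def unit_vec_apply)
  moreover obtain s where s: "s \<in> S" "\<And>v. v \<in> ann z \<Longrightarrow> smul s v \<in> principal b ` vecs {0}"
    using c by (auto simp: cover_def near_def)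
  have "\<exists>a\<in>carrier R. s \<otimes> r = a \<otimes> b" if r: "r \<in> carrier R" "r \<otimes> z = \<zero>" for r
  proof -
    have "smul r (unit_vec 0) \<in> ann z" using r by (simp add: ann_def unit_vec_apply)
    from s(2)[OF this] have "\<exists>a\<in>carrier R. smul s (smul r (unit_vec 0)) 0 = a \<otimes> b"
      unfolding principal_image[OF assms(2)] by blast
    thus ?thesis using r s(1) by (simp add: unit_vec_apply)
  qed
  ultimately show "b \<otimes> z = \<zero> \<and> (\<exists>s\<in>S. \<forall>r\<in>carrier R. r \<otimes> z = \<zero> \<longrightarrow> (\<exists>a\<in>carrier R. s \<otimes> r = a \<otimes> b))"
    using s(1) by blast
next
  assume *: "b \<otimes> z = \<zero> \<and> (\<exists>s\<in>S. \<forall>r\<in>carrier R. r \<otimes> z = \<zero> \<longrightarrow> (\<exists>a\<in>carrier R. s \<otimes> r = a \<otimes> b))"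
  then obtain s where s: "s \<in> S" "\<And>r. r \<in> carrier R \<Longrightarrow> r \<otimes> z = \<zero> \<Longrightarrow> \<exists>a\<in>carrier R. s \<otimes> r = a \<otimes> b"
    by blast
  have "v \<in> ann z" if v: "v \<in> principal b ` vecs {0}" for v
  proof -
    obtain a where a: "v \<in> vecs {0}" "a \<in> carrier R" "v 0 = a \<otimes> b"
      using v unfolding principal_image[OF assms(2)] by blast
    have "v 0 \<otimes> z = a \<otimes> (b \<otimes> z)" unfolding a(3) using a(2) assms by (simp add: m_assoc)
    also have "\<dots> = \<zero>" using * a(2) by simp
    finally show ?thesis using a(1) by (simp add: ann_def)
  qed
  moreover have "smul s v \<in> principal b ` vecs {0}" if v: "v \<in> ann z" for v
  proof -
    have v': "v \<in> vecs {0}" "v 0 \<otimes> z = \<zero>" using v by (simp_all add: ann_def)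
    have "v 0 \<in> carrier R" using v'(1) by simp
    then obtain a where "a \<in> carrier R" "s \<otimes> v 0 = a \<otimes> b" using s(2) v'(2) by blast
    thus ?thesis unfolding principal_image[OF assms(2)] using v'(1) s(1) by auto
  qed
  ultimately show "cover {0} (principal b) (ann z)"
    unfolding cover_def near_def using lin_principal[OF assms(2)] s(1) by blast
qed

text \<open>Among finitely many generators one divides all others near \<open>P\<close>.\<close>
lemma ann_principal_if_chain:
  assumes chain: "\<And>x y. x \<in> carrier R \<Longrightarrow> y \<in> carrier R \<Longrightarrow> ndvd x y \<or> ndvd y x"
    and z: "z \<in> carrier R" and "pres 1 (ann z)"
  shows "\<exists>b\<in>carrier R. cover {0} (principal b) (ann z)"
proof -
  obtain J f where f: "cover J f (ann z)" using assms(3) unfolding One_nat_def pres.simps by blast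
  obtain s where J: "finite J" "lin (vecs J) f" "\<And>r. r \<in> vecs J \<Longrightarrow> f r \<in> ann z"
    using coverD[OF f] by blast
  let ?B = "insert \<zero> ((\<lambda>j. f (unit_vec j) 0) ` J)"
  have fj: "f (unit_vec j) \<in> vecs {0}" "f (unit_vec j) 0 \<otimes> z = \<zero>" if "j \<in> J" for j
    using J(3)[OF unit_vec_vecs[OF that]] by (auto simp: ann_def)
  have B: "?B \<subseteq> carrier R" using vecs_carrier[OF fj(1)] by auto
  have "\<exists>b\<in>?B. \<forall>a\<in>?B. ndvd b a"
  proof (rule ex_ndvd_least)
    show "ndvd a b \<or> ndvd b a" if "a \<in> ?B" "b \<in> ?B" for a b
      by (rule chain[OF subsetD[OF B that(1)] subsetD[OF B that(2)]])
  qed (use J(1) B in auto)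
  then obtain b where b: "b \<in> ?B" "\<And>a. a \<in> ?B \<Longrightarrow> ndvd b a" by blast
  have bc: "b \<in> carrier R" using b(1) B by blast
  have bz: "b \<otimes> z = \<zero>"
  proof (cases "b = \<zero>")
    case False
    then obtain j where "j \<in> J" "b = f (unit_vec j) 0" using b(1) by blast
    thus ?thesis using fj(2) by simp
  qed (simp add: z)
  have "cover {0} (principal b) (ann z)"
  proof (rule cover_by_generators[OF f submod_ann[OF z] _ lin_principal[OF bc]])
    show "principal b ` vecs {0} \<subseteq> ann z"
    proof
      fix v assume "v \<in> principal b ` vecs {0}"
      then obtain a where a: "v \<in> vecs {0}" "a \<in> carrier R" "v 0 = a \<otimes> b"
        unfolding principal_image[OF bc] by blast
      have "v 0 \<otimes> z = a \<otimes> (b \<otimes> z)" unfolding a(3) using a(2) bc z by (simp add: m_assoc)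
      thus "v \<in> ann z" using a bz by (simp add: ann_def)
    qed
    fix j assume j: "j \<in> J"
    hence "ndvd b (f (unit_vec j) 0)" using b(2) by blast
    then obtain s a where s: "s \<in> S" "a \<in> carrier R" "s \<otimes> f (unit_vec j) 0 = a \<otimes> b" unfolding ndvd_def by blast
    hence "smul s (f (unit_vec j)) \<in> principal b ` vecs {0}"
      unfolding principal_image[OF bc] using fj(1)[OF j] by auto
    thus "\<exists>s\<in>S. smul s (f (unit_vec j)) \<in> principal b ` vecs {0}" using s(1) by blast
  qed simp
  thus ?thesis using bc by blast
qed

text \<open>Near \<open>P\<close> let \<open>b\<close> generate the annihilator of \<open>z\<close> and \<open>c\<close> that of \<open>b\<close>. Then \<open>c\<close> divides \<open>z\<close>, and
  \<open>z = d c\<close> forces the annihilator of \<open>c\<close> to be generated by \<open>b\<close> again: if \<open>d\<close> is not a unit, comparing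
  \<open>d\<close> with \<open>b\<close> shows that \<open>b\<close> is zero or a unit.\<close>
lemma double_annihilator_if_chain:
  assumes chain: "\<And>x y. x \<in> carrier R \<Longrightarrow> y \<in> carrier R \<Longrightarrow> ndvd x y \<or> ndvd y x"
    and c: "z \<in> carrier R" "b \<in> carrier R" "c \<in> carrier R"
    and zb: "cover {0} (principal b) (ann z)" and bc: "cover {0} (principal c) (ann b)"
  shows "cover {0} (principal b) (ann c)"
proof -
  obtain s1 where bz: "b \<otimes> z = \<zero>" and s1: "s1 \<in> S"
    "\<And>r. r \<in> carrier R \<Longrightarrow> r \<otimes> z = \<zero> \<Longrightarrow> \<exists>a\<in>carrier R. s1 \<otimes> r = a \<otimes> b"
    using zb unfolding cover_ann_principal[OF c(1,2)] by blast
  obtain s2 where cb: "c \<otimes> b = \<zero>" and s2: "s2 \<in> S"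
    "\<And>r. r \<in> carrier R \<Longrightarrow> r \<otimes> b = \<zero> \<Longrightarrow> \<exists>a\<in>carrier R. s2 \<otimes> r = a \<otimes> c"
    using bc unfolding cover_ann_principal[OF c(2,3)] by blast
  have sc: "s1 \<in> carrier R" "s2 \<in> carrier R" using s1 s2 by auto
  have bc0: "b \<otimes> c = \<zero>" and zb0: "z \<otimes> b = \<zero>" using cb bz c by (simp_all add: m_comm)
  obtain d where d: "d \<in> carrier R" "s2 \<otimes> z = d \<otimes> c" using s2(2)[OF c(1) zb0] by blast
  have unit: ?thesis if t: "t \<in> S" "\<And>r. r \<in> carrier R \<Longrightarrow> r \<otimes> c = \<zero> \<Longrightarrow> \<exists>a\<in>carrier R. t \<otimes> r = a \<otimes> b" for t
    unfolding cover_ann_principal[OF c(3,2)] using bc0 t by blast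
  consider "d \<in> S" | "d \<in> P" "ndvd b d" | "d \<in> P" "ndvd d b"
    using S_or_P[OF d(1)] chain[OF d(1) c(2)] by blast
  thus ?thesis
  proof cases
    case 1
    show ?thesis
    proof (rule unit[of "s1 \<otimes> s2"])
      fix r assume r: "r \<in> carrier R" "r \<otimes> c = \<zero>"
      have "(s2 \<otimes> r) \<otimes> z = r \<otimes> (s2 \<otimes> z)" using r(1) sc c by (simp add: m_ac)
      also have "\<dots> = d \<otimes> (r \<otimes> c)" unfolding d(2) using r(1) c d by (simp add: m_ac)
      also have "\<dots> = \<zero>" unfolding r(2) using d by simp
      finally show "\<exists>a\<in>carrier R. s1 \<otimes> s2 \<otimes> r = a \<otimes> b" using s1(2)[of "s2 \<otimes> r"] r sc by (simp add: m_assoc)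
    qed (use s1 s2 in simp)
  next
    case 2
    then obtain s y where y: "s \<in> S" "y \<in> carrier R" "s \<otimes> d = y \<otimes> b" unfolding ndvd_def by blast
    have "(s \<otimes> s2) \<otimes> z = (s \<otimes> d) \<otimes> c" using y(1) d(1) sc c d(2) by (simp add: m_assoc)
    also have "\<dots> = y \<otimes> (b \<otimes> c)" unfolding y(3) using y c by (simp add: m_assoc)
    also have "\<dots> = \<zero>" unfolding bc0 using y by simp
    finally obtain u where u: "u \<in> carrier R" "s1 \<otimes> (s \<otimes> s2) = u \<otimes> b"
      using s1(2)[of "s \<otimes> s2"] y(1) s2(1) by auto
    have "u \<otimes> b \<in> S" using s1 s2 y(1) unfolding u(2)[symmetric] by simp
    hence bS: "b \<in> S" by (rule mult_S_right[OF u(1) c(2)])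
    show ?thesis
      by (rule unit[OF bS]) (use c in \<open>auto simp: m_comm\<close>)
  next
    case 3
    then obtain s y where y: "s \<in> S" "y \<in> carrier R" "s \<otimes> b = y \<otimes> d" unfolding ndvd_def by blast
    have "(s2 \<otimes> y) \<otimes> z = y \<otimes> (s2 \<otimes> z)" using y(2) sc c by (simp add: m_ac)
    also have "\<dots> = (y \<otimes> d) \<otimes> c" unfolding d(2) using y(2) d(1) c by (simp add: m_assoc)
    also have "\<dots> = s \<otimes> (b \<otimes> c)" unfolding y(3)[symmetric] using y(1) c by (simp add: m_assoc)
    also have "\<dots> = \<zero>" unfolding bc0 using y(1) by simp
    finally obtain u where u: "u \<in> carrier R" "s1 \<otimes> (s2 \<otimes> y) = u \<otimes> b" using s1(2)[of "s2 \<otimes> y"] sc y by auto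
    have e: "(s \<otimes> (s1 \<otimes> s2)) \<otimes> b = (u \<otimes> d) \<otimes> b"
    proof -
      have "(s \<otimes> (s1 \<otimes> s2)) \<otimes> b = (s1 \<otimes> s2) \<otimes> (s \<otimes> b)" using y(1) sc c by (simp add: m_ac)
      also have "\<dots> = (s1 \<otimes> (s2 \<otimes> y)) \<otimes> d" unfolding y(3) using y(2) sc d(1) by (simp add: m_ac)
      also have "\<dots> = (u \<otimes> d) \<otimes> b" unfolding u(2) using u(1) d(1) c by (simp add: m_ac)
      finally show ?thesis .
    qed
    let ?f = "s \<otimes> (s1 \<otimes> s2) \<ominus> u \<otimes> d"
    have f: "?f \<in> S" using y(1) s1(1) s2(1) 3(1) u(1) I_l_closed by (intro S_minus_P) auto
    have fb: "?f \<otimes> b = \<zero>"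
    proof -
      have "?f \<otimes> b = (s \<otimes> (s1 \<otimes> s2)) \<otimes> b \<ominus> (u \<otimes> d) \<otimes> b"
        using y(1) sc u(1) d(1) c by (simp add: l_distr l_minus minus_eq)
      thus ?thesis unfolding e using u(1) d(1) c by (simp add: r_neg minus_eq)
    qed
    obtain v where v: "v \<in> carrier R" "s2 \<otimes> ?f = v \<otimes> c" using s2(2)[OF _ fb] f by auto
    have "v \<otimes> c \<in> S" unfolding v(2)[symmetric] using f s2(1) by simp
    hence cS: "c \<in> S" by (rule mult_S_right[OF v(1) c(3)])
    show ?thesis
    proof (rule unit[OF cS])
      fix r assume "r \<in> carrier R" "r \<otimes> c = \<zero>"
      thus "\<exists>a\<in>carrier R. c \<otimes> r = a \<otimes> b" using c by (intro bexI[of _ \<zero>]) (auto simp: m_comm)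
    qed
  qed
qed

text \<open>Passing to annihilators twice takes \<open>z\<close> to \<open>b\<close> and \<open>b\<close> to \<open>c\<close>, and the next annihilator is generated by \<open>b\<close>
  again. The third step is where finite generation in a neighbourhood, and not just at the prime, is gained.\<close>
lemma pres_ann_if_chain:
  assumes chain: "\<And>x y. x \<in> carrier R \<Longrightarrow> y \<in> carrier R \<Longrightarrow> ndvd x y \<or> ndvd y x"
    and z: "z \<in> carrier R" and p: "pres 2 (ann z)"
  shows "pres 3 (ann z)"
proof -
  have p': "pres (Suc 1) (ann z)" using p by (simp add: numeral_2_eq_2)
  hence "pres 1 (ann z)" by auto
  then obtain b where b: "b \<in> carrier R" "cover {0} (principal b) (ann z)"
    using ann_principal_if_chain[OF chain z] by blast
  have e1: "pres (Suc k) (ann z) \<longleftrightarrow> pres k (ann b)" for k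
    using pres_Suc_cover[OF submod_ann[OF z] b(2)] ker_principal[OF b(1)] by simp
  hence "pres 1 (ann b)" using p' by blast
  then obtain c where c: "c \<in> carrier R" "cover {0} (principal c) (ann b)"
    using ann_principal_if_chain[OF chain b(1)] by blast
  have e2: "pres (Suc k) (ann b) \<longleftrightarrow> pres k (ann c)" for k
    using pres_Suc_cover[OF submod_ann[OF b(1)] c(2)] ker_principal[OF c(1)] by simp
  have "cover {0} (principal b) (ann c)"
    by (rule double_annihilator_if_chain[OF chain z b(1) c(1) b(2) c(2)])
  hence "pres (Suc 0) (ann c)" by auto
  hence "pres (Suc (Suc (Suc 0))) (ann z)" unfolding e1 e2 .
  thus ?thesis unfolding numeral_3_eq_3 .
qed

text \<open>Eliminating pivots reduces the passage from two to three steps to single elements and to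
  families without a pivot.\<close>
lemma pres_syz_by_pivots:
  assumes C: "finite C"
    and single: "\<And>z. z \<in> Z \<Longrightarrow> z \<in> carrier R \<Longrightarrow> pres 2 (ann z) \<Longrightarrow> pres 3 (ann z)"
    and base: "\<And>I x. finite I \<Longrightarrow> (\<And>i. i \<in> I \<Longrightarrow> x i \<in> vecs C) \<Longrightarrow>
      (\<And>i j. i \<in> I \<Longrightarrow> j \<in> C \<Longrightarrow> x i j \<in> Z \<Longrightarrow> \<exists>i'\<in>I. \<exists>c\<in>C. \<not> ndvd (x i j) (x i' c)) \<Longrightarrow>
      pres 2 (syz I x) \<Longrightarrow> pres 3 (syz I x)"
    and I: "finite I" "\<And>i. i \<in> I \<Longrightarrow> x i \<in> vecs C" and p: "pres 2 (syz I x)"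
  shows "pres 3 (syz I x)"
  using I p
proof (induction "card I" arbitrary: I x)
  case 0
  hence "I = {}" by simp
  thus ?case using 0 base[of I x] by simp
next
  case (Suc n)
  show ?case
  proof (cases "\<exists>i\<in>I. \<exists>j\<in>C. x i j \<in> Z \<and> (\<forall>i'\<in>I. \<forall>c\<in>C. ndvd (x i j) (x i' c))")
    case False
    thus ?thesis using base[OF Suc.prems(1,2) _ Suc.prems(3)] by blast
  next
    case True
    then obtain i j where ij: "i \<in> I" "j \<in> C" "x i j \<in> Z" "\<And>i' c. i' \<in> I \<Longrightarrow> c \<in> C \<Longrightarrow> ndvd (x i j) (x i' c)"
      by blast
    obtain x' where x': "\<forall>i\<in>I. x' i \<in> vecs C"
      "\<And>k. pres k (syz I x) \<longleftrightarrow> pres k (ann (x i j)) \<and> pres k (syz (I - {i}) x')"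
      using pres_syz_pivot[of I i x C "x i j" j] Suc.prems(1,2) ij(1,4) C by blast
    have p: "pres 2 (ann (x i j))" "pres 2 (syz (I - {i}) x')" using x'(2)[of 2] Suc.prems(3) by blast+
    have "x i j \<in> carrier R" using Suc.prems(2)[OF ij(1)] by simp
    hence "pres 3 (ann (x i j))" using single[OF ij(3) _ p(1)] by blast
    moreover have "n = card (I - {i})" using Suc.hyps(2) ij(1) Suc.prems(1) by simp
    hence "pres 3 (syz (I - {i}) x')"
      by (rule Suc.hyps(1)) (use Suc.prems(1) x'(1) p(2) in auto)
    ultimately show ?thesis using x'(2)[of 3] by blast
  qed
qed

lemma syz_no_entries:
  assumes "finite I" "\<And>i. i \<in> I \<Longrightarrow> x i = vzero"
  shows "syz I x = vecs I"
proof -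
  have "lincomb I x r = vzero" if "r \<in> vecs I" for r
    using lincomb_vecs[OF assms(1), of x "{}" r] assms(2) vecs_UNIV[OF that] by (simp add: vecs_empty)
  thus ?thesis by (auto simp: syz_def ker_def)
qed

lemma pres_syz_if_chain:
  assumes chain: "\<And>x y. x \<in> carrier R \<Longrightarrow> y \<in> carrier R \<Longrightarrow> ndvd x y \<or> ndvd y x"
    and C: "finite C" and I: "finite I" "\<And>i. i \<in> I \<Longrightarrow> x i \<in> vecs C" and p: "pres 2 (syz I x)"
  shows "pres 3 (syz I x)"
proof (rule pres_syz_by_pivots[OF C _ _ I p, where Z = UNIV])
  show "pres 3 (ann z)" if "z \<in> carrier R" "pres 2 (ann z)" for z
    using pres_ann_if_chain[OF chain that] by blast
next
  fix I :: "nat set" and x :: "nat \<Rightarrow> nat \<Rightarrow> 'a"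
  assume I: "finite I" and x: "\<And>i. i \<in> I \<Longrightarrow> x i \<in> vecs C"
    and *: "\<And>i j. i \<in> I \<Longrightarrow> j \<in> C \<Longrightarrow> x i j \<in> UNIV \<Longrightarrow> \<exists>i'\<in>I. \<exists>c\<in>C. \<not> ndvd (x i j) (x i' c)"
  let ?B = "(\<lambda>(i, j). x i j) ` (I \<times> C)"
  have B: "?B \<subseteq> carrier R"
  proof
    fix b assume "b \<in> ?B"
    then obtain i j where "i \<in> I" "b = x i j" by auto
    thus "b \<in> carrier R" using x[of i] by simp
  qed
  have "?B = {}"
  proof (rule ccontr)
    assume "?B \<noteq> {}"
    have "\<exists>b\<in>?B. \<forall>a\<in>?B. ndvd b a"
    proof (rule ex_ndvd_least[OF _ \<open>?B \<noteq> {}\<close> B])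
      show "ndvd a b \<or> ndvd b a" if "a \<in> ?B" "b \<in> ?B" for a b
        by (rule chain[OF subsetD[OF B that(1)] subsetD[OF B that(2)]])
    qed (use I C in simp)
    then obtain i j where ij: "i \<in> I" "j \<in> C" "\<forall>a\<in>?B. ndvd (x i j) a" by auto
    then obtain i' c where "i' \<in> I" "c \<in> C" "\<not> ndvd (x i j) (x i' c)" using *[of i j] by blast
    moreover from this have "x i' c \<in> ?B" by (auto intro!: image_eqI[of _ _ "(i', c)"])
    ultimately show False using ij(3) by blast
  qed
  hence "I = {} \<or> C = {}" by auto
  hence "x i = vzero" if "i \<in> I" for i using x[OF that] that vecs_empty by auto
  hence "syz I x = vecs I" by (rule syz_no_entries[OF I])
  thus "pres 3 (syz I x)" using pres_vecs[OF I] by simp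
qed

end

section \<open>Primes with trivial relations between incomparable elements\<close>
text \<open>The form in which quasi-flatness of two-generated ideals enters: near \<open>P\<close>, two elements neither of
  which divides the other satisfy only trivial linear relations.\<close>
locale split_at_prime = at_prime +
  assumes split: "\<And>x y r t. x \<in> carrier R \<Longrightarrow> y \<in> carrier R \<Longrightarrow> \<not> ndvd x y \<Longrightarrow> \<not> ndvd y x \<Longrightarrow>
    r \<in> carrier R \<Longrightarrow> t \<in> carrier R \<Longrightarrow> r \<otimes> x \<oplus> t \<otimes> y = \<zero> \<Longrightarrow>
    nzero (r \<otimes> x) \<and> nzero (t \<otimes> y) \<and> nzero (t \<otimes> x) \<and> nzero (r \<otimes> y)"
begin

definition incomp :: "'a \<Rightarrow> 'a \<Rightarrow> bool"
  where "incomp x y \<longleftrightarrow> x \<in> carrier R \<and> y \<in> carrier R \<and> \<not> ndvd x y \<and> \<not> ndvd y x"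

lemma incomp_sym: "incomp x y \<Longrightarrow> incomp y x"
  by (auto simp: incomp_def)

lemma incomp_carrier: "incomp x y \<Longrightarrow> x \<in> carrier R" "incomp x y \<Longrightarrow> y \<in> carrier R"
  by (auto simp: incomp_def)

lemma incomp_eqD:
  assumes "incomp x y" "r \<in> carrier R" "t \<in> carrier R" "r \<otimes> x = t \<otimes> y"
  shows "nzero (r \<otimes> x)"
proof -
  have c: "x \<in> carrier R" "y \<in> carrier R" using incomp_carrier assms(1) by auto
  have "r \<otimes> x \<oplus> \<ominus> t \<otimes> y = \<zero>" unfolding assms(4) using c assms(3) by (simp add: l_minus r_neg)
  thus ?thesis using split[of x y r "\<ominus> t"] assms(1-3) c by (auto simp: incomp_def)
qed

lemma incomp_ann:
  assumes "incomp x y" "a \<in> carrier R" "nzero (a \<otimes> x)"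
  shows "nzero (a \<otimes> y)"
proof -
  have c: "x \<in> carrier R" "y \<in> carrier R" using incomp_carrier assms(1) by auto
  obtain s where s: "s \<in> S" "s \<otimes> (a \<otimes> x) = \<zero>" using assms(3) by (auto simp: nzero_def)
  have "(s \<otimes> a) \<otimes> x \<oplus> \<zero> \<otimes> y = \<zero>" using s assms(2) c by (simp add: m_assoc)
  hence "nzero ((s \<otimes> a) \<otimes> y)"
    using split[of x y "s \<otimes> a" \<zero>] assms(1,2) c s(1) by (auto simp: incomp_def)
  thus ?thesis using nzero_cancel[of "a \<otimes> y" s] assms(2) c s(1) by (simp add: m_assoc)
qed

text \<open>Apply the triviality of relations to the Koszul relation \<open>y x - x y = 0\<close>.\<close>
lemma incomp_prod:
  assumes "incomp x y"
  shows "nzero (x \<otimes> y)" "nzero (x \<otimes> x)"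
proof -
  have c: "x \<in> carrier R" "y \<in> carrier R" using incomp_carrier assms by auto
  show xy: "nzero (x \<otimes> y)"
    using incomp_eqD[OF assms, of y x] c by (simp add: m_comm)
  show "nzero (x \<otimes> x)" by (rule incomp_ann[OF incomp_sym[OF assms] c(1) xy])
qed

lemma incomp_not_nzero:
  assumes "incomp x y" shows "\<not> nzero x"
proof
  assume "nzero x"
  then obtain s where s: "s \<in> S" "s \<otimes> x = \<zero>" by (auto simp: nzero_def)
  have "ndvd y x" unfolding ndvd_def using s incomp_carrier[OF assms] by (intro bexI[of _ s] bexI[of _ \<zero>]) auto
  thus False using assms by (simp add: incomp_def)
qed

text \<open>A factor that does not annihilate \<open>x\<close> near \<open>P\<close> keeps it incomparable with \<open>y\<close>; hence the annihilator
  of \<open>x\<close> is prime near \<open>P\<close>.\<close>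
lemma incomp_mult:
  assumes "incomp x y" "c \<in> carrier R" "\<not> nzero (c \<otimes> x)"
  shows "incomp (c \<otimes> x) y"
proof -
  have xy: "x \<in> carrier R" "y \<in> carrier R" using incomp_carrier assms(1) by auto
  have "\<not> ndvd (c \<otimes> x) y"
  proof
    assume "ndvd (c \<otimes> x) y"
    then obtain s r where s: "s \<in> S" "r \<in> carrier R" "s \<otimes> y = r \<otimes> (c \<otimes> x)" unfolding ndvd_def by blast
    have "ndvd x y" unfolding ndvd_def using s xy assms(2)
      by (intro bexI[of _ s] bexI[of _ "r \<otimes> c"]) (auto simp: m_assoc)
    thus False using assms(1) by (simp add: incomp_def)
  qed
  moreover have "\<not> ndvd y (c \<otimes> x)"
  proof
    assume "ndvd y (c \<otimes> x)"
    then obtain s r where s: "s \<in> S" "r \<in> carrier R" "s \<otimes> (c \<otimes> x) = r \<otimes> y" unfolding ndvd_def by blast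
    have "nzero ((s \<otimes> c) \<otimes> x)"
      by (rule incomp_eqD[OF assms(1) _ s(2)]) (use s xy assms(2) in \<open>auto simp: m_assoc\<close>)
    hence "nzero (c \<otimes> x)" using nzero_cancel[of "c \<otimes> x" s] s(1) xy assms(2) by (simp add: m_assoc)
    thus False using assms(3) by simp
  qed
  ultimately show ?thesis using xy assms(2) by (simp add: incomp_def)
qed

lemma incomp_ann_prime:
  assumes "incomp x y" "a \<in> carrier R" "c \<in> carrier R" "nzero (a \<otimes> c \<otimes> x)"
  shows "nzero (a \<otimes> x) \<or> nzero (c \<otimes> x)"
proof (rule disjCI)
  assume n: "\<not> nzero (c \<otimes> x)"
  have xy: "x \<in> carrier R" "y \<in> carrier R" using incomp_carrier assms(1) by auto
  have "incomp (c \<otimes> x) y" by (rule incomp_mult[OF assms(1,3) n])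
  moreover have "nzero (a \<otimes> (c \<otimes> x))" using assms xy by (simp add: m_assoc)
  ultimately have "nzero (a \<otimes> y)" using incomp_ann assms(2) by blast
  thus "nzero (a \<otimes> x)" by (rule incomp_ann[OF incomp_sym[OF assms(1)] assms(2)])
qed

end

subsection \<open>Primes with an incomparable pair\<close>

locale nonchain_at_prime = split_at_prime +
  fixes x\<^sub>0 y\<^sub>0
  assumes incomp0: "incomp x\<^sub>0 y\<^sub>0"
begin

text \<open>Near \<open>P\<close> this annihilator of \<open>x\<^sub>0\<close> is the nilradical: it is prime, and its square is zero.\<close>
definition N :: "'a set"
  where "N = {a \<in> carrier R. nzero (a \<otimes> x\<^sub>0)}"

lemma x0 [simp]: "x\<^sub>0 \<in> carrier R" and y0 [simp]: "y\<^sub>0 \<in> carrier R"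
  using incomp_carrier incomp0 by auto

lemma N_carrier: "a \<in> N \<Longrightarrow> a \<in> carrier R"
  by (simp add: N_def)

lemma N_y0: "a \<in> carrier R \<Longrightarrow> a \<in> N \<longleftrightarrow> nzero (a \<otimes> y\<^sub>0)"
  using incomp_ann[OF incomp0, of a] incomp_ann[OF incomp_sym[OF incomp0], of a] by (auto simp: N_def)

lemma N_prime: "a \<in> carrier R \<Longrightarrow> b \<in> carrier R \<Longrightarrow> a \<otimes> b \<in> N \<Longrightarrow> a \<in> N \<or> b \<in> N"
  using incomp_ann_prime[OF incomp0, of a b] by (auto simp: N_def)

lemma N_mult: "a \<in> carrier R \<Longrightarrow> b \<in> N \<Longrightarrow> a \<otimes> b \<in> N"
  using nzero_mult[of "b \<otimes> x\<^sub>0" a] by (auto simp: N_def m_assoc)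

lemma nzero_N: "a \<in> carrier R \<Longrightarrow> nzero a \<Longrightarrow> a \<in> N"
  using nzero_mult[of a x\<^sub>0] by (simp add: N_def m_comm)

lemma S_not_N: "s \<in> S \<Longrightarrow> s \<notin> N"
  using nzero_cancel[of x\<^sub>0 s] incomp_not_nzero[OF incomp0] by (auto simp: N_def)

lemma N_cancel_S: "s \<in> S \<Longrightarrow> a \<in> carrier R \<Longrightarrow> s \<otimes> a \<in> N \<Longrightarrow> a \<in> N"
  using N_prime[of s a] S_not_N by auto

text \<open>Incomparable elements are nilpotent, so the ring modulo \<open>N\<close> is a valuation domain near \<open>P\<close>.\<close>
lemma incomp_N: "incomp z w \<Longrightarrow> z \<in> N"
  using incomp_prod(2)[of z w] incomp_carrier(1)[of z w] nzero_N[of "z \<otimes> z"] N_prime[of z z] by auto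

text \<open>An element of \<open>N\<close> that is comparable with both \<open>x\<^sub>0\<close> and \<open>y\<^sub>0\<close> is zero near \<open>P\<close>: a common multiple
  is zero by the triviality of relations, and a common divisor cannot annihilate \<open>x\<^sub>0\<close>, as the two
  cofactors are again incomparable.\<close>
lemma N_cases:
  assumes z: "z \<in> N"
  shows "incomp x\<^sub>0 z \<or> incomp y\<^sub>0 z \<or> nzero z"
proof -
  have zc: "z \<in> carrier R" using z N_carrier by auto
  have common_multiple: "nzero z" if cm: "ndvd x\<^sub>0 z" "ndvd y\<^sub>0 z"
  proof -
    obtain s r s' r' where *: "s \<in> S" "r \<in> carrier R" "s \<otimes> z = r \<otimes> x\<^sub>0"
      "s' \<in> S" "r' \<in> carrier R" "s' \<otimes> z = r' \<otimes> y\<^sub>0"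
      using cm unfolding ndvd_def by blast
    have sc: "s \<in> carrier R" "s' \<in> carrier R" using * by auto
    have 1: "(s' \<otimes> r) \<otimes> x\<^sub>0 = (s' \<otimes> s) \<otimes> z" using *(2) *(3)[symmetric] sc zc by (simp add: m_assoc)
    have 2: "(s \<otimes> r') \<otimes> y\<^sub>0 = (s \<otimes> s') \<otimes> z" using *(5) *(6)[symmetric] sc zc by (simp add: m_assoc)
    have "nzero ((s' \<otimes> r) \<otimes> x\<^sub>0)"
      by (rule incomp_eqD[OF incomp0, of _ "s \<otimes> r'"]) (use 1 2 sc * in \<open>auto simp: m_comm\<close>)
    hence "nzero ((s' \<otimes> s) \<otimes> z)" unfolding 1 .
    thus ?thesis using nzero_cancel[of z "s' \<otimes> s"] zc *(1,4) by simp
  qed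
  have no_chain: False if d: "ndvd u z" "ndvd z v" and uv: "incomp u v" for u v
    using ndvd_trans[OF incomp_carrier(1)[OF uv] zc incomp_carrier(2)[OF uv] d] uv by (simp add: incomp_def)
  have no_common_divisor: False if cd: "ndvd z x\<^sub>0" "ndvd z y\<^sub>0"
  proof -
    obtain s x' s' y' where *: "s \<in> S" "x' \<in> carrier R" "s \<otimes> x\<^sub>0 = x' \<otimes> z"
      "s' \<in> S" "y' \<in> carrier R" "s' \<otimes> y\<^sub>0 = y' \<otimes> z"
      using cd unfolding ndvd_def by blast
    have sc: "s \<in> carrier R" "s' \<in> carrier R" using * by auto
    have "\<not> ndvd x' y'"
    proof
      assume "ndvd x' y'"
      then obtain t r where t: "t \<in> S" "r \<in> carrier R" "t \<otimes> y' = r \<otimes> x'" unfolding ndvd_def by blast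
      have "(t \<otimes> s') \<otimes> y\<^sub>0 = (t \<otimes> y') \<otimes> z" using t(1) sc * zc by (simp add: m_assoc)
      also have "\<dots> = r \<otimes> (s \<otimes> x\<^sub>0)" unfolding t(3) *(3) using t * zc by (simp add: m_assoc)
      finally have "(t \<otimes> s') \<otimes> y\<^sub>0 = (r \<otimes> s) \<otimes> x\<^sub>0" using t sc by (simp add: m_assoc)
      hence "ndvd x\<^sub>0 y\<^sub>0" unfolding ndvd_def using t * by (intro bexI[of _ "t \<otimes> s'"] bexI[of _ "r \<otimes> s"]) auto
      thus False using incomp0 by (simp add: incomp_def)
    qed
    moreover have "\<not> ndvd y' x'"
    proof
      assume "ndvd y' x'"
      then obtain t r where t: "t \<in> S" "r \<in> carrier R" "t \<otimes> x' = r \<otimes> y'" unfolding ndvd_def by blast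
      have "(t \<otimes> s) \<otimes> x\<^sub>0 = (t \<otimes> x') \<otimes> z" using t(1) sc * zc by (simp add: m_assoc)
      also have "\<dots> = r \<otimes> (s' \<otimes> y\<^sub>0)" unfolding t(3) *(6) using t * zc by (simp add: m_assoc)
      finally have "(t \<otimes> s) \<otimes> x\<^sub>0 = (r \<otimes> s') \<otimes> y\<^sub>0" using t sc by (simp add: m_assoc)
      hence "ndvd y\<^sub>0 x\<^sub>0" unfolding ndvd_def using t * by (intro bexI[of _ "t \<otimes> s"] bexI[of _ "r \<otimes> s'"]) auto
      thus False using incomp0 by (simp add: incomp_def)
    qed
    ultimately have i': "incomp x' y'" using * by (simp add: incomp_def)
    have "nzero (z \<otimes> x\<^sub>0)" using z by (simp add: N_def)
    hence "nzero (s \<otimes> (z \<otimes> x\<^sub>0))" by (rule nzero_mult[rotated 2]) (use zc sc in auto)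
    moreover have "s \<otimes> (z \<otimes> x\<^sub>0) = z \<otimes> (s \<otimes> x\<^sub>0)" using zc sc by (simp add: m_lcomm)
    ultimately have "nzero (z \<otimes> z \<otimes> x')" unfolding *(3) using zc * by (simp add: m_ac)
    hence "nzero (z \<otimes> x')" using incomp_ann_prime[OF i' zc zc] by blast
    hence "nzero (s \<otimes> x\<^sub>0)" unfolding *(3) using zc * by (simp add: m_comm)
    thus False using nzero_cancel[of x\<^sub>0 s] *(1) incomp_not_nzero[OF incomp0] by simp
  qed
  show ?thesis
    using common_multiple no_common_divisor no_chain[OF _ _ incomp0] no_chain[OF _ _ incomp_sym[OF incomp0]] zc
    unfolding incomp_def using x0 y0 by blast
qed

lemma N_square_zero:
  assumes z: "z \<in> N" and a: "a \<in> N"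
  shows "nzero (a \<otimes> z)"
  using N_cases[OF z]
proof (elim disjE)
  have ac: "a \<in> carrier R" using a N_carrier by auto
  show ?thesis if "incomp x\<^sub>0 z" using incomp_ann[OF that ac] a by (simp add: N_def)
  show ?thesis if "incomp y\<^sub>0 z" using incomp_ann[OF that ac] a N_y0[OF ac] by simp
  show ?thesis if "nzero z" using nzero_mult[OF N_carrier[OF z] ac that] .
qed

lemma not_N_cancel:
  assumes z: "z \<in> carrier R" "z \<notin> N" and a: "a \<in> carrier R" "nzero (z \<otimes> a)"
  shows "nzero a"
proof -
  have "z \<otimes> a \<in> N" using nzero_N z a by simp
  hence aN: "a \<in> N" using N_prime z a by blast
  show ?thesis
    using N_cases[OF aN]
  proof (elim disjE)
    show ?thesis if "incomp x\<^sub>0 a"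
      using incomp_ann[OF incomp_sym[OF that] z(1) a(2)] z by (simp add: N_def)
    show ?thesis if "incomp y\<^sub>0 a"
      using incomp_ann[OF incomp_sym[OF that] z(1) a(2)] z N_y0[OF z(1)] by simp
  qed
qed

text \<open>\<open>N\<close> is divisible as a module over the ring modulo \<open>N\<close>: incomparable elements lie in \<open>N\<close>, and a multiple of
  \<open>w\<close> cannot be outside \<open>N\<close>.\<close>
lemma not_N_ndvd_N:
  assumes z: "z \<in> carrier R" "z \<notin> N" and w: "w \<in> N"
  shows "ndvd z w"
proof -
  have wc: "w \<in> carrier R" using w N_carrier by auto
  have "\<not> ndvd w z"
  proof
    assume "ndvd w z"
    then obtain s r where s: "s \<in> S" "r \<in> carrier R" "s \<otimes> z = r \<otimes> w" unfolding ndvd_def by blast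
    have "s \<otimes> z \<in> N" unfolding s(3) by (rule N_mult[OF s(2) w])
    thus False using N_cancel_S[OF s(1) z(1)] z(2) by blast
  qed
  thus ?thesis using incomp_N[of z w] z wc by (auto simp: incomp_def)
qed

lemma not_N_comparable:
  "z \<in> carrier R \<Longrightarrow> z \<notin> N \<Longrightarrow> w \<in> carrier R \<Longrightarrow> ndvd z w \<or> ndvd w z"
  using incomp_N[of z w] by (auto simp: incomp_def)

lemma ex_pivot_not_N:
  assumes "finite B" "B \<subseteq> carrier R" "\<not> B \<subseteq> N"
  shows "\<exists>b\<in>B. b \<notin> N \<and> (\<forall>a\<in>B. ndvd b a)"
proof -
  have "\<exists>b\<in>B - N. \<forall>a\<in>B - N. ndvd b a"
    by (rule ex_ndvd_least) (use assms not_N_comparable in auto)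
  then obtain b where b: "b \<in> B" "b \<notin> N" "\<And>a. a \<in> B \<Longrightarrow> a \<notin> N \<Longrightarrow> ndvd b a" by blast
  have bc: "b \<in> carrier R" using b(1) assms(2) by blast
  have "ndvd b a" if "a \<in> B" for a
    using b(3)[OF that] not_N_ndvd_N[OF bc b(2)] by blast
  thus ?thesis using b(1,2) by blast
qed

lemma N_zero: "\<zero> \<in> N"
  using nzero_zero by (simp add: N_def)

text \<open>At the prime the annihilator of \<open>z\<close> vanishes. Being finitely generated, it vanishes near the prime.\<close>
lemma pres_ann_not_N:
  assumes z: "z \<in> carrier R" "z \<notin> N" and p: "pres 2 (ann z)"
  shows "pres k (ann z)"
proof -
  obtain J f where f: "cover J f (ann z)" using p unfolding numeral_2_eq_2 pres.simps by blast
  obtain s where J: "finite J" "lin (vecs J) f" "\<And>r. r \<in> vecs J \<Longrightarrow> f r \<in> ann z"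
    using coverD[OF f] by blast
  have "near (f ` vecs J) {vzero}"
  proof (rule near_image[OF J(1,2) submod_vzero])
    fix j assume "j \<in> J"
    hence v: "f (unit_vec j) \<in> vecs {0}" "f (unit_vec j) 0 \<otimes> z = \<zero>"
      using J(3)[OF unit_vec_vecs] by (simp_all add: ann_def)
    have vc: "f (unit_vec j) 0 \<in> carrier R" using v(1) by simp
    have "nzero (z \<otimes> f (unit_vec j) 0)" using v(2) z(1) vc nzero_zero by (simp add: m_comm)
    hence "nzero (f (unit_vec j) 0)" by (rule not_N_cancel[OF z vc])
    then obtain s where s: "s \<in> S" "s \<otimes> f (unit_vec j) 0 = \<zero>" by (auto simp: nzero_def)
    have "smul s (f (unit_vec j)) = vzero"
      by (rule vec1_eqI[of _ 0]) (use s v(1) in auto)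
    thus "\<exists>s\<in>S. smul s (f (unit_vec j)) \<in> {vzero}" using s(1) by blast
  qed
  hence "near (ann z) {vzero}"
    using near_trans[of "ann z" "f ` vecs J" "{vzero}"] f submod_ann[OF z(1)] by (auto simp: cover_def)
  moreover have "near {vzero} (ann z)"
    by (rule near_refl[OF submod_vzero]) (use submod_zero[OF submod_ann[OF z(1)]] in simp)
  ultimately show ?thesis
    using pres_near_eq[OF submod_ann[OF z(1)] submod_vzero] pres_vzero by blast
qed

subsection \<open>Families with entries in the nilradical\<close>

text \<open>Such families have coefficients modulo \<open>N\<close>, which is a valuation domain near \<open>P\<close>. So a relation with
  a coefficient outside \<open>N\<close> makes one member redundant, namely the one whose coefficient divides the
  others.\<close>
lemma ex_independent_mod_N:
  assumes C: "finite C" and I: "finite I" and x: "\<And>i. i \<in> I \<Longrightarrow> x i \<in> vecs C"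
  shows "\<exists>I'\<subseteq>I. (\<forall>i\<in>I. \<exists>s\<in>S. smul s (x i) \<in> lincomb I' x ` vecs I') \<and> (\<forall>r\<in>syz I' x. \<forall>i. r i \<in> N)"
  using I x
proof (induction "card I" arbitrary: I)
  case 0
  hence "I = {}" by simp
  moreover have "r i \<in> N" if "r \<in> syz {} x" for r i
    using that N_zero by (auto simp: syz_def ker_def vecs_empty)
  ultimately show ?case by auto
next
  case (Suc n)
  have xU: "x i \<in> vecs UNIV" if "i \<in> I" for i using Suc.prems(2)[OF that] by (rule vecs_UNIV)
  show ?case
  proof (cases "\<forall>r\<in>syz I x. \<forall>i. r i \<in> N")
    case True
    have "\<exists>s\<in>S. smul s (x i) \<in> lincomb I x ` vecs I" if "i \<in> I" for i
      using lincomb_generator[of I i x] Suc.prems(1) xU that smul_one[OF xU[OF that]]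
      by (intro bexI[OF _ one_S]) simp
    thus ?thesis using True by blast
  next
    case False
    then obtain r i where r: "r \<in> syz I x" "r i \<notin> N" by blast
    have rI: "r \<in> vecs I" "lincomb I x r = vzero" using r(1) by (auto simp: syz_def ker_def)
    have rc: "r j \<in> carrier R" for j using rI(1) by simp
    have "i \<in> I"
    proof (rule ccontr)
      assume "i \<notin> I"
      hence "r i = \<zero>" by (rule vecs_outside[OF rI(1)])
      thus False using r(2) N_zero by simp
    qed
    hence nN: "\<not> r ` I \<subseteq> N" using r(2) by blast
    obtain p where p: "p \<in> I" "r p \<notin> N" "\<And>j. j \<in> I \<Longrightarrow> ndvd (r p) (r j)"
    proof -
      have "finite (r ` I)" "r ` I \<subseteq> carrier R" using Suc.prems(1) rc by auto
      from ex_pivot_not_N[OF this nN] show ?thesis using that by blast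
    qed
    have "\<exists>s\<in>S. \<forall>j\<in>I. \<exists>a\<in>carrier R. s \<otimes> r j = a \<otimes> r p"
      by (rule common_multiple_denominator[OF Suc.prems(1) rc rc p(3)])
    then obtain s where s: "s \<in> S" and "\<forall>j\<in>I. \<exists>a. a \<in> carrier R \<and> s \<otimes> r j = a \<otimes> r p" by blast
    from bchoice[OF this(2)] obtain a where "\<forall>j\<in>I. a j \<in> carrier R \<and> s \<otimes> r j = a j \<otimes> r p" ..
    hence a: "a j \<in> carrier R" "s \<otimes> r j = a j \<otimes> r p" if "j \<in> I" for j using that by simp_all
    have sc: "s \<in> carrier R" using s by simp
    define c where "c = (\<lambda>j. if j = p then s else if j \<in> I then a j else \<zero>)"
    have cI: "c \<in> vecs I" unfolding vecs_def c_def using a(1) sc p(1) by auto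
    have cU: "c \<in> vecs UNIV" by (rule vecs_UNIV[OF cI])
    have cr: "r p \<otimes> c j = s \<otimes> r j" if "j \<in> I" for j
      using a(2)[OF that] a(1)[OF that] that sc rc by (auto simp: c_def m_comm)
    let ?w = "lincomb I x c"
    have lx: "lin (vecs UNIV) (lincomb I x)" by (rule lin_lincomb[OF Suc.prems(1) xU])
    have wC: "?w \<in> vecs C" by (rule lincomb_vecs[OF Suc.prems(1) Suc.prems(2) cU])
    have "smul (r p) ?w = lincomb I x (smul (r p) c)" using lin_smul[OF lx rc cU] by simp
    also have "\<dots> = lincomb I x (smul s r)"
      by (rule lincomb_cong) (use cr xU rc cU in auto)
    also have "\<dots> = smul s (lincomb I x r)" by (rule lin_smul[OF lx sc vecs_UNIV[OF rI(1)]])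
    also have "\<dots> = vzero" unfolding rI(2) using sc by simp
    finally have rw: "smul (r p) ?w = vzero" .
    have "nzero (?w d)" for d
    proof (rule not_N_cancel[OF rc p(2)])
      show "nzero (r p \<otimes> ?w d)" using fun_cong[OF rw, of d] nzero_zero by simp
      show "?w d \<in> carrier R" using wC by simp
    qed
    hence "\<exists>t\<in>S. \<forall>d\<in>C. t \<otimes> ?w d = \<zero>"
      using common_annihilator[OF C, of ?w] vecs_carrier[OF wC] by blast
    then obtain t where t: "t \<in> S" "\<And>d. d \<in> C \<Longrightarrow> t \<otimes> ?w d = \<zero>" by blast
    have tc: "t \<in> carrier R" using t by simp
    have tw: "smul t ?w = vzero"
    proof
      fix d
      show "smul t ?w d = vzero d"
        using t(2)[of d] vecs_outside[OF wC, of d] tc by (cases "d \<in> C") auto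
    qed
    let ?I = "I - {p}"
    have fI: "finite ?I" using Suc.prems(1) by simp
    have lx': "lin (vecs UNIV) (lincomb ?I x)" by (rule lin_lincomb[OF fI]) (use xU in auto)
    have split: "?w = vadd (smul s (x p)) (lincomb ?I x c)"
      using lincomb_remove[of I p x c] Suc.prems(1) p(1) xU cU by (simp add: c_def)
    have uU: "lincomb ?I x c \<in> vecs UNIV" by (rule lin_vecs[OF lx' cU])
    have e: "smul (t \<otimes> s) (x p) = smul (\<ominus> t) (lincomb ?I x c)"
    proof
      fix d
      have 1: "t \<otimes> (s \<otimes> x p d \<oplus> lincomb ?I x c d) = \<zero>"
        using fun_cong[OF tw, of d] unfolding split by simp
      have k: "x p d \<in> carrier R" "lincomb ?I x c d \<in> carrier R" using xU[OF p(1)] uU by simp_all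
      have "t \<otimes> s \<otimes> x p d = t \<otimes> (s \<otimes> x p d \<oplus> lincomb ?I x c d) \<oplus> \<ominus> t \<otimes> lincomb ?I x c d"
        using k sc tc by algebra
      thus "smul (t \<otimes> s) (x p) d = smul (\<ominus> t) (lincomb ?I x c) d" unfolding 1 using k tc by simp
    qed
    have nI: "n = card ?I" using Suc.hyps(2) p(1) Suc.prems(1) by simp
    obtain I' where I': "I' \<subseteq> ?I" "\<And>j. j \<in> ?I \<Longrightarrow> \<exists>s\<in>S. smul s (x j) \<in> lincomb I' x ` vecs I'"
      "\<forall>r\<in>syz I' x. \<forall>i. r i \<in> N"
      using Suc.hyps(1)[OF nI fI Suc.prems(2)] by blast
    have fI': "finite I'" using finite_subset[OF I'(1) fI] .
    have sI': "submod (lincomb I' x ` vecs I')"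
      by (rule submod_image[OF submod_vecs_set lin_lincomb_vecs[OF fI']]) (use xU I'(1) in auto)
    have lxI: "lin (vecs ?I) (lincomb ?I x)" by (rule lin_lincomb_vecs[OF fI]) (use xU in auto)
    have "near (lincomb ?I x ` vecs ?I) (lincomb I' x ` vecs I')"
    proof (rule near_image[OF fI lxI sI'])
      fix j assume j: "j \<in> ?I"
      have "lincomb ?I x (unit_vec j) = x j" using lincomb_unit_vec[of ?I j x] fI j xU by auto
      thus "\<exists>s\<in>S. smul s (lincomb ?I x (unit_vec j)) \<in> lincomb I' x ` vecs I'" using I'(2)[OF j] by simp
    qed
    then obtain q where q: "q \<in> S" "\<And>v. v \<in> lincomb ?I x ` vecs ?I \<Longrightarrow> smul q v \<in> lincomb I' x ` vecs I'"
      unfolding near_def by blast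
    define c' where "c' = (\<lambda>j. if j = p then \<zero> else c j)"
    have c'I: "c' \<in> vecs ?I" using cI unfolding vecs_def c'_def by auto
    have "lincomb ?I x c = lincomb ?I x c'"
      by (rule lincomb_cong) (use xU cU in \<open>auto simp: c'_def\<close>)
    hence "smul (t \<otimes> s) (x p) = lincomb ?I x (smul (\<ominus> t) c')"
      unfolding e using lin_smul[OF lxI _ c'I, of "\<ominus> t"] tc by simp
    moreover have "smul (\<ominus> t) c' \<in> vecs ?I" using c'I tc by simp
    ultimately have "smul (t \<otimes> s) (x p) \<in> lincomb ?I x ` vecs ?I" by blast
    hence "smul q (smul (t \<otimes> s) (x p)) \<in> lincomb I' x ` vecs I'" by (rule q(2))
    hence "smul (q \<otimes> (t \<otimes> s)) (x p) \<in> lincomb I' x ` vecs I'"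
      using q(1) tc sc xU[OF p(1)] by (simp add: smul_smul)
    hence "\<exists>s\<in>S. smul s (x p) \<in> lincomb I' x ` vecs I'"
      using q(1) t(1) s by (intro bexI[of _ "q \<otimes> (t \<otimes> s)"]) auto
    hence "\<forall>i\<in>I. \<exists>s\<in>S. smul s (x i) \<in> lincomb I' x ` vecs I'" using I'(2) by blast
    thus ?thesis using I'(1,3) by blast
  qed
qed

lemma smul_zero_unit_vec: "smul \<zero> (unit_vec i) = vzero"
  by (rule smul_zero(2)[of _ UNIV]) simp

text \<open>The ideal is given as a submodule of the first coordinate axis, so that \<open>pres\<close> applies to it directly;
  \<open>copies L I\<close> is the direct sum of copies of it indexed by \<open>I\<close>.\<close>
definition copies :: "(nat \<Rightarrow> 'a) set \<Rightarrow> nat set \<Rightarrow> (nat \<Rightarrow> 'a) set"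
  where "copies L I = {r \<in> vecs I. \<forall>i. smul (r i) (unit_vec 0) \<in> L}"

lemma submod_copies:
  assumes "submod L"
  shows "submod (copies L I)"
  unfolding submod_def
proof (intro conjI ballI)
  show "copies L I \<subseteq> vecs UNIV" using vecs_UNIV by (auto simp: copies_def)
  show "vzero \<in> copies L I" using submod_zero[OF assms] by (simp add: copies_def smul_zero_unit_vec)
next
  fix u v assume uv: "u \<in> copies L I" "v \<in> copies L I"
  have "smul (u i \<oplus> v i) (unit_vec 0) = vadd (smul (u i) (unit_vec 0)) (smul (v i) (unit_vec 0))" for i
    by (rule add_smul) (use uv in \<open>auto simp: copies_def\<close>)
  thus "vadd u v \<in> copies L I" using uv submod_vadd[OF assms] by (simp add: copies_def)
next
  fix a v assume av: "a \<in> carrier R" "v \<in> copies L I"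
  have "smul (a \<otimes> v i) (unit_vec 0) = smul a (smul (v i) (unit_vec 0))" for i
    by (rule smul_smul[symmetric]) (use av in \<open>auto simp: copies_def\<close>)
  thus "smul a v \<in> copies L I" using av submod_smul[OF assms] by (simp add: copies_def)
qed

lemma pres_copies_insert:
  assumes L: "submod L" "L \<subseteq> vecs {0}" and i: "i \<notin> I"
  shows "pres k (copies L (insert i I)) \<longleftrightarrow> pres k L \<and> pres k (copies L I)"
proof -
  let ?D = "direct_sum L (copies L I)"
  let ?h = "\<lambda>v. vadd (smul (\<one> \<otimes> evens v 0) (unit_vec i)) (odds v)"
  have sC: "submod (copies L I)" "submod (copies L (insert i I))" by (rule submod_copies[OF L(1)])+
  have sD: "submod ?D" by (rule submod_direct_sum[OF L(1) sC(1)])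
  have lh: "lin ?D ?h"
  proof (rule lin_add[OF _ lin_odds[OF sD]])
    show "lin ?D (\<lambda>v. smul (\<one> \<otimes> evens v 0) (unit_vec i))"
      by (rule lin_comp[OF lin_evens[OF sD] lin_coord[OF submod_vecs_set[of UNIV]]])
         (auto intro: evens_vecs submod_vecs[OF sD])
  qed
  have L0: "smul (u 0) (unit_vec 0) = u" if "u \<in> L" for u
    using vec1_eq[of u 0] that L(2) by auto
  have Dv: "evens v \<in> L" "odds v \<in> vecs I" "\<And>j. smul (odds v j) (unit_vec 0) \<in> L"
      "evens v \<in> vecs {0}" "odds v i = \<zero>" "evens v 0 \<in> carrier R"
    if "v \<in> ?D" for v
  proof -
    show 1: "evens v \<in> L" "odds v \<in> vecs I" "\<And>j. smul (odds v j) (unit_vec 0) \<in> L"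
      using that by (auto simp: direct_sum_iff copies_def)
    show 2: "evens v \<in> vecs {0}" using 1(1) L(2) by blast
    show "odds v i = \<zero>" by (rule vecs_outside[OF 1(2) i])
    show "evens v 0 \<in> carrier R" using 2 by simp
  qed
  have "near_iso ?D (copies L (insert i I)) ?h"
  proof (rule near_isoI[OF lh _ one_S _ one_S])
    fix v assume v: "v \<in> ?D"
    note d = Dv[OF v]
    have hi: "?h v j = (if j = i then evens v 0 else odds v j)" for j
      using d(2,5,6) by (simp add: unit_vec_apply)
    have "odds v \<in> vecs (insert i I)" using d(2) by (rule vecs_mono[rotated]) auto
    hence "?h v \<in> vecs (insert i I)" using d(6) by simp
    moreover have "smul (?h v j) (unit_vec 0) \<in> L" for j
      unfolding hi using d(1,3) L0[OF d(1)] by simp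
    ultimately show "?h v \<in> copies L (insert i I)" unfolding copies_def by blast
    assume h0: "?h v = vzero"
    have "evens v 0 = \<zero>" using hi[of i] h0 by simp
    hence "evens v = vzero" by (intro vec1_eqI[OF d(4)]) auto
    moreover have "odds v = vzero"
    proof
      fix j show "odds v j = vzero j" using hi[of j] h0 d(5) by (cases "j = i") auto
    qed
    ultimately have "join (evens v) (odds v) = vzero" unfolding join_eq_vzero by blast
    thus "smul \<one> v = vzero" by simp
  next
    fix w assume w: "w \<in> copies L (insert i I)"
    hence w': "w \<in> vecs (insert i I)" "\<And>j. smul (w j) (unit_vec 0) \<in> L" by (auto simp: copies_def)
    have wc: "w j \<in> carrier R" for j using w'(1) by simp
    define w0 where "w0 = (\<lambda>j. if j = i then \<zero> else w j)"
    have w0: "w0 \<in> vecs I" using w'(1) unfolding vecs_def w0_def by auto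
    have "smul (w0 j) (unit_vec 0) \<in> L" for j
      using w'(2)[of j] submod_zero[OF L(1)] smul_zero_unit_vec by (simp add: w0_def)
    hence v: "join (smul (w i) (unit_vec 0)) w0 \<in> ?D" using w'(2) w0 by (simp add: direct_sum_iff copies_def)
    have "smul \<one> w = ?h (join (smul (w i) (unit_vec 0)) w0)"
      unfolding evens_join odds_join
    proof
      fix j
      show "smul \<one> w j = vadd (smul (\<one> \<otimes> smul (w i) (unit_vec 0) 0) (unit_vec i)) w0 j"
        using wc by (simp add: unit_vec_apply w0_def)
    qed
    thus "\<exists>v\<in>?D. smul \<one> w = ?h v" using v by blast
  qed
  thus ?thesis using pres_near_iso[OF sD sC(2)] pres_direct_sum[OF L(1) sC(1)] by blast
qed

lemma pres_copies:
  assumes "submod L" "L \<subseteq> vecs {0}" "finite I" "pres k L"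
  shows "pres k (copies L I)"
  using assms(3)
proof (induction I)
  case empty
  have "copies L {} = {vzero}"
    using submod_zero[OF submod_copies[OF assms(1)], of "{}"] by (auto simp: copies_def vecs_empty)
  thus ?case using pres_vzero by simp
next
  case (insert i I)
  thus ?case using pres_copies_insert[OF assms(1,2)] assms(4) by blast
qed

lemma pres_copiesD:
  assumes "submod L" "L \<subseteq> vecs {0}" "i \<in> I" "pres k (copies L I)"
  shows "pres k L"
  using pres_copies_insert[OF assms(1,2), of i "I - {i}" k] assms(3,4) by (simp add: insert_absorb)

lemma near_image_copies:
  assumes "finite J" "lin (vecs J) f" "submod L" "finite I"
    and fI: "\<And>j. j \<in> J \<Longrightarrow> f (unit_vec j) \<in> vecs I"
    and fL: "\<And>j i. j \<in> J \<Longrightarrow> i \<in> I \<Longrightarrow> \<exists>s\<in>S. smul (s \<otimes> f (unit_vec j) i) (unit_vec 0) \<in> L"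
  shows "near (f ` vecs J) (copies L I)"
proof (rule near_image[OF assms(1,2) submod_copies[OF assms(3)]])
  fix j assume j: "j \<in> J"
  let ?v = "f (unit_vec j)"
  have vc: "?v i \<in> carrier R" for i using fI[OF j] by simp
  have "\<exists>s\<in>S. \<forall>i\<in>I. smul (s \<otimes> ?v i) (unit_vec 0) \<in> L"
  proof (rule common_denominator[OF assms(4) fL[OF j]])
    fix i s t assume st: "s \<in> S" "t \<in> S" and m: "smul (s \<otimes> ?v i) (unit_vec 0) \<in> L"
    have "smul (t \<otimes> s \<otimes> ?v i) (unit_vec 0) = smul t (smul (s \<otimes> ?v i) (unit_vec 0))"
      using st vc by (simp add: smul_smul m_assoc)
    thus "smul (t \<otimes> s \<otimes> ?v i) (unit_vec 0) \<in> L" using submod_smul[OF assms(3) _ m] st by simp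
  qed
  then obtain s where s: "s \<in> S" "\<And>i. i \<in> I \<Longrightarrow> smul (s \<otimes> ?v i) (unit_vec 0) \<in> L" by blast
  have "smul (smul s ?v i) (unit_vec 0) \<in> L" for i
  proof (cases "i \<in> I")
    case False
    hence "smul s ?v i = \<zero>" using vecs_outside[OF fI[OF j]] s(1) by simp
    thus ?thesis using submod_zero[OF assms(3)] smul_zero_unit_vec by simp
  qed (simp add: s(2))
  moreover have "smul s ?v \<in> vecs I" using fI[OF j] s(1) by simp
  ultimately show "\<exists>s\<in>S. smul s ?v \<in> copies L I" unfolding copies_def using s(1) by blast
qed

text \<open>The square of \<open>N\<close> is zero near \<open>P\<close>, and the finitely many products of a generator with an entry have a common
  denominator. So finitely many elements of \<open>N\<close> generate an ideal that annihilates the family.\<close>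
lemma near_copies_syz:
  assumes K: "finite K" "\<And>k. k \<in> K \<Longrightarrow> g k \<in> N"
    and I: "finite I" "finite C" "\<And>i. i \<in> I \<Longrightarrow> x i \<in> vecs C" "\<And>i c. i \<in> I \<Longrightarrow> x i c \<in> N"
  shows "near (copies (lincomb K (\<lambda>k. smul (g k) (unit_vec 0)) ` vecs K) I) (syz I x)"
proof -
  let ?X = "\<lambda>k. smul (g k) (unit_vec 0)" and ?L = "lincomb K (\<lambda>k. smul (g k) (unit_vec 0)) ` vecs K"
  have gc: "g k \<in> carrier R" if "k \<in> K" for k using K(2)[OF that] N_carrier by blast
  have xc: "x i c \<in> carrier R" if "i \<in> I" for i c using I(4)[OF that] N_carrier by blast
  have XU: "?X k \<in> vecs UNIV" if "k \<in> K" for k using gc[OF that] by simp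
  have "\<exists>s\<in>S. \<forall>p\<in>I \<times> C \<times> K. s \<otimes> (g (snd (snd p)) \<otimes> x (fst p) (fst (snd p))) = \<zero>"
  proof (rule common_annihilator)
    show "finite (I \<times> C \<times> K)" using I K by simp
    fix p assume "p \<in> I \<times> C \<times> K"
    hence p: "g (snd (snd p)) \<in> N" "x (fst p) (fst (snd p)) \<in> N" using K I by auto
    thus "nzero (g (snd (snd p)) \<otimes> x (fst p) (fst (snd p)))" by (intro N_square_zero)
    show "g (snd (snd p)) \<otimes> x (fst p) (fst (snd p)) \<in> carrier R" using p N_carrier by simp
  qed
  then obtain s where s: "s \<in> S" and s0: "\<And>i c k. i \<in> I \<Longrightarrow> c \<in> C \<Longrightarrow> k \<in> K \<Longrightarrow> s \<otimes> (g k \<otimes> x i c) = \<zero>"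
    by fastforce
  have sc: "s \<in> carrier R" using s by simp
  have kill: "s \<otimes> (v 0 \<otimes> x i c) = \<zero>" if i: "i \<in> I" and v: "v \<in> ?L" for i c v
  proof (cases "c \<in> C")
    case True
    let ?T = "{v \<in> vecs UNIV. s \<otimes> (v 0 \<otimes> x i c) = \<zero>}"
    have T: "submod ?T"
      unfolding submod_def
    proof (intro conjI ballI)
      fix u v assume u: "u \<in> ?T" and v: "v \<in> ?T"
      have "s \<otimes> (vadd u v 0 \<otimes> x i c) = s \<otimes> (u 0 \<otimes> x i c) \<oplus> s \<otimes> (v 0 \<otimes> x i c)"
        using u v sc xc[OF i] by (simp add: l_distr r_distr)
      thus "vadd u v \<in> ?T" using u v by simp
    next
      fix a v assume a: "a \<in> carrier R" and v: "v \<in> ?T"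
      have "s \<otimes> (smul a v 0 \<otimes> x i c) = a \<otimes> (s \<otimes> (v 0 \<otimes> x i c))"
        using a v sc xc[OF i] by (simp add: m_ac)
      thus "smul a v \<in> ?T" using a v by simp
    qed (use sc xc[OF i] in auto)
    have "?X k \<in> ?T" if "k \<in> K" for k
      using XU[OF that] s0[OF i True that] gc[OF that] by (simp add: unit_vec_apply)
    hence "v \<in> ?T" using v lincomb_mem[OF T K(1), of ?X] vecs_UNIV by auto
    thus ?thesis by simp
  next
    case False
    have "v 0 \<in> carrier R"
      using v lincomb_vecs[OF K(1), of ?X UNIV] XU vecs_UNIV by auto
    thus ?thesis using vecs_outside[OF I(3)[OF i] False] sc by simp
  qed
  have "smul s r \<in> syz I x" if r: "r \<in> copies ?L I" for r
  proof -
    have rI: "r \<in> vecs I" "\<And>i. smul (r i) (unit_vec 0) \<in> ?L" using r by (auto simp: copies_def)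
    have rc: "r i \<in> carrier R" for i using rI(1) by simp
    have "lincomb I x (smul s r) = vzero"
    proof
      fix c
      have "s \<otimes> r i \<otimes> x i c = \<zero>" if "i \<in> I" for i
        using kill[OF that rI(2)[of i], of c] rc[of i] xc[OF that] sc by (simp add: unit_vec_apply m_assoc)
      hence "lincomb I x (smul s r) c = (\<Oplus>i\<in>I. \<zero>)"
        unfolding lincomb_def by (intro finsum_cong') auto
      thus "lincomb I x (smul s r) c = vzero c" by simp
    qed
    thus ?thesis using rI(1) sc by (simp add: syz_def ker_def)
  qed
  thus ?thesis unfolding near_def using s by blast
qed

text \<open>Let the family be independent modulo \<open>N\<close>. As \<open>N\<close> squares to zero near \<open>P\<close>, its syzygies are the vectors
  with entries in \<open>N\<close>. If they are finitely generated, then so is \<open>N\<close>, and its own syzygies have the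
  same form, so that \<open>N\<close> has presentations of every length.\<close>
lemma pres_syz_entries_in_N:
  assumes C: "finite C" and I: "finite I" and x: "\<And>i. i \<in> I \<Longrightarrow> x i \<in> vecs C"
    and xN: "\<And>i c. i \<in> I \<Longrightarrow> x i c \<in> N" and p: "pres 2 (syz I x)"
  shows "pres 3 (syz I x)"
proof -
  obtain I' where I': "I' \<subseteq> I" "\<And>i. i \<in> I \<Longrightarrow> \<exists>s\<in>S. smul s (x i) \<in> lincomb I' x ` vecs I'"
    "\<And>r i. r \<in> syz I' x \<Longrightarrow> r i \<in> N"
    using ex_independent_mod_N[of C I x] C I x by blast
  have fI': "finite I'" using finite_subset[OF I'(1) I] .
  have xU: "x i \<in> vecs UNIV" if "i \<in> I" for i using vecs_UNIV[OF x[OF that]] .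
  have x': "x i \<in> vecs C" "x i \<in> vecs UNIV" if "i \<in> I'" for i
    using x[of i] xU[of i] I'(1) that by blast+
  let ?M = "syz I' x"
  have eqv: "pres k (syz I x) \<longleftrightarrow> pres k ?M" for k
  proof (rule pres_syz_span[OF I fI' xU x'(2) I'(2)])
    fix j assume j: "j \<in> I'"
    have "x j \<in> lincomb I x ` vecs I"
      using lincomb_generator[of I j x] I xU I'(1) j by blast
    thus "\<exists>s\<in>S. smul s (x j) \<in> lincomb I x ` vecs I"
      using smul_one[OF x'(2)[OF j]] by (intro bexI[OF _ one_S]) simp
  qed
  have sM: "submod ?M" by (rule submod_syz[OF fI' x'(2)])
  show ?thesis
  proof (cases "I' = {}")
    case True
    hence "?M = vecs {}" using syz_no_entries[of "{}" x] by simp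
    thus ?thesis using pres_vecs[of "{}" 3] unfolding eqv by simp
  next
    case False
    then obtain i1 where i1: "i1 \<in> I'" by blast
    have p2: "pres (Suc 1) ?M" using p unfolding eqv by (simp only: numeral_2_eq_2 One_nat_def)
    then obtain J f where f: "cover J f ?M" unfolding pres.simps by blast
    obtain s where J: "finite J" "lin (vecs J) f" "\<And>r. r \<in> vecs J \<Longrightarrow> f r \<in> ?M"
      using coverD[OF f] by blast
    have fv: "f (unit_vec j) \<in> vecs I'" "\<And>i. f (unit_vec j) i \<in> N" if "j \<in> J" for j
    proof -
      have m: "f (unit_vec j) \<in> ?M" by (rule J(3)[OF unit_vec_vecs[OF that]])
      show "f (unit_vec j) i \<in> N" for i by (rule I'(3)[OF m])
      show "f (unit_vec j) \<in> vecs I'" using m by (simp add: syz_def ker_def)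
    qed
    let ?G = "(\<lambda>(j, i). f (unit_vec j) i) ` (J \<times> I')"
    have "finite ?G" using J(1) fI' by simp
    from finite_imp_nat_seg_image_inj_on[OF this] obtain n and g :: "nat \<Rightarrow> 'a" where g: "?G = g ` {k. k < n}"
      by blast
    have gN: "g k \<in> N" if "k \<in> {k. k < n}" for k
    proof -
      have "g k \<in> ?G" unfolding g using that by blast
      then obtain j i where "j \<in> J" "g k = f (unit_vec j) i" by auto
      thus ?thesis using fv(2)[of j i] by simp
    qed
    have gc: "g k \<in> carrier R" if "k \<in> {k. k < n}" for k using N_carrier[OF gN[OF that]] .
    let ?X = "\<lambda>k. smul (g k) (unit_vec 0)"
    have X: "?X k \<in> vecs {0}" if "k \<in> {k. k < n}" for k using gc[OF that] by simp
    obtain K where K: "K \<subseteq> {k. k < n}" "\<And>k. k \<in> {k. k < n} \<Longrightarrow> \<exists>s\<in>S. smul s (?X k) \<in> lincomb K ?X ` vecs K"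
      "\<And>r i. r \<in> syz K ?X \<Longrightarrow> r i \<in> N"
    proof -
      have "finite {0::nat}" "finite {k. k < n}" by simp_all
      from ex_independent_mod_N[of "{0}" "{k. k < n}" ?X, OF this X] show ?thesis using that by blast
    qed
    have fK: "finite K" using finite_subset[OF K(1)] by simp
    have XK: "?X k \<in> vecs {0}" "?X k \<in> vecs UNIV" "g k \<in> N" "?X k c \<in> N" if "k \<in> K" for k c
    proof -
      have k: "k \<in> {k. k < n}" using that K(1) by blast
      show "?X k \<in> vecs {0}" by (rule X[OF k])
      thus "?X k \<in> vecs UNIV" by (rule vecs_UNIV)
      show "g k \<in> N" by (rule gN[OF k])
      show "?X k c \<in> N" using gN[OF k] gc[OF k] N_zero by (simp add: unit_vec_apply)
    qed
    let ?L = "lincomb K ?X ` vecs K"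
    have lX: "lin (vecs K) (lincomb K ?X)" by (rule lin_lincomb_vecs[OF fK XK(2)])
    have sL: "submod ?L" by (rule submod_image[OF submod_vecs_set lX])
    have L0: "?L \<subseteq> vecs {0}"
    proof
      fix v assume "v \<in> ?L"
      then obtain r where r: "r \<in> vecs K" "v = lincomb K ?X r" by blast
      show "v \<in> vecs {0}"
        unfolding r(2) by (rule lincomb_vecs[of K ?X "{0}" r, OF fK _ vecs_UNIV[OF r(1)]]) (rule XK(1))
    qed
    have cL: "cover K (lincomb K ?X) ?L"
      unfolding cover_def using fK lX near_refl[OF sL, of ?L] by blast
    have sC: "submod (copies ?L I)" for I by (rule submod_copies[OF sL])
    have "near (f ` vecs J) (copies ?L I')"
    proof (rule near_image_copies[OF J(1,2) sL fI' fv(1)])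
      fix j i assume ji: "j \<in> J" "i \<in> I'"
      hence "f (unit_vec j) i \<in> ?G" by (auto intro!: image_eqI[of _ _ "(j, i)"])
      then obtain k where k: "k \<in> {k. k < n}" "f (unit_vec j) i = g k" unfolding g by blast
      obtain s where s: "s \<in> S" "smul s (?X k) \<in> ?L" using K(2)[OF k(1)] by blast
      have "smul (s \<otimes> f (unit_vec j) i) (unit_vec 0) \<in> ?L"
        using s gc[OF k(1)] unfolding k(2) by (simp add: smul_smul)
      thus "\<exists>s\<in>S. smul (s \<otimes> f (unit_vec j) i) (unit_vec 0) \<in> ?L" using s(1) by blast
    qed
    hence n1: "near ?M (copies ?L I')"
      using near_trans[of ?M "f ` vecs J" "copies ?L I'"] f sM unfolding cover_def by simp
    have n2: "near (copies ?L I') ?M"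
    proof (rule near_copies_syz[of K g I' C x, OF fK _ fI' C])
      show "x i c \<in> N" if "i \<in> I'" for i c using xN[of i c] I'(1) that by blast
    qed (rule XK(3) x'(1); assumption)+
    have M: "pres k ?M \<longleftrightarrow> pres k (copies ?L I')" for k
      by (rule pres_near_eq[OF sM sC n1 n2])
    have L2: "pres (Suc 1) ?L" using pres_copiesD[OF sL L0 i1] p2 unfolding M by blast
    \<comment> \<open>So \<open>?L\<close> and \<open>N\<close> agree after localisation at \<open>P\<close>.\<close>
    have NL: "\<exists>s\<in>S. smul (s \<otimes> a) (unit_vec 0) \<in> ?L" if a: "a \<in> N" for a
    proof -
      have ac: "a \<in> carrier R" by (rule N_carrier[OF a])
      have "\<exists>s\<in>S. \<forall>c\<in>C. s \<otimes> (a \<otimes> x i1 c) = \<zero>"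
      proof (rule common_annihilator[OF C])
        show "nzero (a \<otimes> x i1 c)" for c
          by (rule N_square_zero[OF _ a]) (use xN I'(1) i1 in blast)
        show "a \<otimes> x i1 c \<in> carrier R" for c using ac vecs_carrier[OF x'(1)[OF i1], of c] by simp
      qed
      then obtain s where s: "s \<in> S" "\<And>c. c \<in> C \<Longrightarrow> s \<otimes> (a \<otimes> x i1 c) = \<zero>" by blast
      have sc: "s \<in> carrier R" using s by simp
      let ?v = "smul (s \<otimes> a) (unit_vec i1)"
      have vI: "?v \<in> vecs I'" using sc ac i1 by simp
      have "lincomb I' x ?v = smul (s \<otimes> a) (lincomb I' x (unit_vec i1))"
        by (rule lin_smul[OF lin_lincomb[OF fI' x'(2)]]) (use sc ac in auto)
      also have "lincomb I' x (unit_vec i1) = x i1" using lincomb_unit_vec[of I' i1 x] fI' i1 x'(2) by blast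
      also have "smul (s \<otimes> a) (x i1) = vzero"
      proof
        fix c
        show "smul (s \<otimes> a) (x i1) c = vzero c"
          using s(2)[of c] sc ac vecs_outside[OF x'(1)[OF i1], of c] vecs_carrier[OF x'(1)[OF i1], of c]
          by (cases "c \<in> C") (auto simp: m_assoc)
      qed
      finally have "?v \<in> ?M" using vI unfolding syz_def ker_def by blast
      then obtain t where t: "t \<in> S" "smul t ?v \<in> copies ?L I'" using n1 unfolding near_def by blast
      hence "smul (smul t ?v i1) (unit_vec 0) \<in> ?L" unfolding copies_def by blast
      moreover have "smul t ?v i1 = (t \<otimes> s) \<otimes> a" using t(1) sc ac by (simp add: unit_vec_apply m_assoc)
      ultimately show ?thesis using t(1) s(1) by (intro bexI[of _ "t \<otimes> s"]) auto
    qed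
    let ?K = "syz K ?X"
    have sK: "submod ?K" by (rule submod_syz[OF fK XK(2)])
    have L_Suc: "pres (Suc k) ?L \<longleftrightarrow> pres k ?K" for k
      using pres_Suc_cover[OF sL cL] unfolding syz_def .
    have "pres (Suc 0) ?K" using L2 unfolding L_Suc One_nat_def .
    then obtain J' f' where f': "cover J' f' ?K" unfolding pres.simps by blast
    obtain s' where J': "finite J'" "lin (vecs J') f'" "\<And>r. r \<in> vecs J' \<Longrightarrow> f' r \<in> ?K"
      using coverD[OF f'] by blast
    have "near (f' ` vecs J') (copies ?L K)"
    proof (rule near_image_copies[OF J'(1,2) sL fK])
      fix j assume j: "j \<in> J'"
      have m: "f' (unit_vec j) \<in> ?K" by (rule J'(3)[OF unit_vec_vecs[OF j]])
      thus "f' (unit_vec j) \<in> vecs K" by (simp add: syz_def ker_def)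
      show "\<exists>s\<in>S. smul (s \<otimes> f' (unit_vec j) i) (unit_vec 0) \<in> ?L" for i
        by (rule NL[OF K(3)[OF m]])
    qed
    hence k1: "near ?K (copies ?L K)"
      using near_trans[of ?K "f' ` vecs J'" "copies ?L K"] f' sK unfolding cover_def by simp
    have k2: "near (copies ?L K) ?K"
      by (rule near_copies_syz[of K g K "{0}" ?X, OF fK _ fK]) (rule XK finite.intros; assumption?)+
    have "pres k ?L \<Longrightarrow> pres (Suc k) ?L" for k
      unfolding L_Suc using pres_near_eq[OF sK sC k1 k2] pres_copies[OF sL L0 fK] by blast
    hence "pres (Suc (Suc 1)) ?L" using L2 by blast
    hence "pres (Suc (Suc 1)) ?M" unfolding M by (rule pres_copies[OF sL L0 fI'])
    thus ?thesis unfolding eqv by (simp only: numeral_3_eq_3 One_nat_def)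
  qed
qed

lemma pres_syz_nonchain:
  assumes C: "finite C" and I: "finite I" "\<And>i. i \<in> I \<Longrightarrow> x i \<in> vecs C" and p: "pres 2 (syz I x)"
  shows "pres 3 (syz I x)"
proof (rule pres_syz_by_pivots[OF C _ _ I p, where Z = "- N"])
  show "pres 3 (ann z)" if "z \<in> - N" "z \<in> carrier R" "pres 2 (ann z)" for z
    using pres_ann_not_N that by blast
next
  fix I :: "nat set" and x :: "nat \<Rightarrow> nat \<Rightarrow> 'a"
  assume I: "finite I" and x: "\<And>i. i \<in> I \<Longrightarrow> x i \<in> vecs C"
    and *: "\<And>i j. i \<in> I \<Longrightarrow> j \<in> C \<Longrightarrow> x i j \<in> - N \<Longrightarrow> \<exists>i'\<in>I. \<exists>c\<in>C. \<not> ndvd (x i j) (x i' c)"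
    and p: "pres 2 (syz I x)"
  let ?B = "(\<lambda>(i, j). x i j) ` (I \<times> C)"
  have B: "?B \<subseteq> carrier R"
  proof
    fix b assume "b \<in> ?B"
    then obtain i j where "i \<in> I" "b = x i j" by auto
    thus "b \<in> carrier R" using x[of i] by simp
  qed
  have "?B \<subseteq> N"
  proof (rule ccontr)
    assume "\<not> ?B \<subseteq> N"
    then obtain b where b: "b \<in> ?B" "b \<notin> N" "\<forall>a\<in>?B. ndvd b a"
      using ex_pivot_not_N[of ?B] I C B by blast
    then obtain i j where ij: "i \<in> I" "j \<in> C" "b = x i j" by auto
    then obtain i' c where "i' \<in> I" "c \<in> C" "\<not> ndvd b (x i' c)" using *[of i j] b(2) by blast
    moreover from this have "x i' c \<in> ?B" by (auto intro!: image_eqI[of _ _ "(i', c)"])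
    ultimately show False using b(3) by blast
  qed
  have "x i c \<in> N" if i: "i \<in> I" for i c
  proof (cases "c \<in> C")
    case True
    hence "x i c \<in> ?B" using i by (auto intro!: image_eqI[of _ _ "(i, c)"])
    thus ?thesis using \<open>?B \<subseteq> N\<close> by blast
  next
    case False
    thus ?thesis using vecs_outside[OF x[OF i]] N_zero by simp
  qed
  thus "pres 3 (syz I x)" using pres_syz_entries_in_N[of C I x] C I x p by blast
qed

end

text \<open>The third step comes for free in both cases: either all pairs are comparable near \<open>P\<close>, or there is an
  incomparable one.\<close>
lemma (in split_at_prime) pres_syz:
  assumes "finite C" "finite I" "\<And>i. i \<in> I \<Longrightarrow> x i \<in> vecs C" "pres 2 (syz I x)"
  shows "pres 3 (syz I x)"
proof (cases "\<exists>a b. incomp a b")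
  case True
  then obtain a b where "incomp a b" by blast
  then interpret nonchain_at_prime P R a b by unfold_locales
  show ?thesis by (rule pres_syz_nonchain[OF assms])
next
  case False
  hence "ndvd a b \<or> ndvd b a" if "a \<in> carrier R" "b \<in> carrier R" for a b
    using that unfolding incomp_def by blast
  thus ?thesis by (rule pres_syz_if_chain[OF _ assms])
qed

section \<open>Quotient modules\<close>

text \<open>The cosets serve as elements, and a coset is multiplied or added through chosen representatives.\<close>
lemma ex_quotient_module:
  fixes R :: "('a, 'r) ring_scheme" and M :: "('a, 'm) module"
  assumes "module R M" and K: "K \<subseteq> carrier M" "\<zero>\<^bsub>M\<^esub> \<in> K"
    "\<And>x y. x \<in> K \<Longrightarrow> y \<in> K \<Longrightarrow> x \<oplus>\<^bsub>M\<^esub> y \<in> K"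
    "\<And>a x. a \<in> carrier R \<Longrightarrow> x \<in> K \<Longrightarrow> a \<odot>\<^bsub>M\<^esub> x \<in> K"
  shows "\<exists>(Q :: ('a, 'm set) module) p. module R Q \<and> p \<in> mod_epi R M Q \<and> mod_ker M Q p = K"
proof -
  interpret module R M by fact
  have Kc: "k \<in> carrier M" if "k \<in> K" for k using that K(1) by blast
  have Kneg: "\<ominus>\<^bsub>M\<^esub> k \<in> K" if "k \<in> K" for k
  proof -
    have "(\<ominus>\<^bsub>R\<^esub> \<one>\<^bsub>R\<^esub>) \<odot>\<^bsub>M\<^esub> k \<in> K" by (rule K(4)[OF _ that]) simp
    thus ?thesis using smult_l_minus[of "\<one>\<^bsub>R\<^esub>" k] Kc[OF that] by simp
  qed
  define c where "c x = {x \<oplus>\<^bsub>M\<^esub> k |k. k \<in> K}" for x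
  have c_eq: "c x = c y \<longleftrightarrow> (\<exists>k\<in>K. y = x \<oplus>\<^bsub>M\<^esub> k)" if xy: "x \<in> carrier M" "y \<in> carrier M" for x y
  proof
    assume "c x = c y"
    moreover have "y \<in> c y" unfolding c_def using xy K(2) by (intro CollectI exI[of _ "\<zero>\<^bsub>M\<^esub>"]) auto
    ultimately show "\<exists>k\<in>K. y = x \<oplus>\<^bsub>M\<^esub> k" unfolding c_def by blast
  next
    assume "\<exists>k\<in>K. y = x \<oplus>\<^bsub>M\<^esub> k"
    then obtain k where k: "k \<in> K" "y = x \<oplus>\<^bsub>M\<^esub> k" by blast
    have "x \<oplus>\<^bsub>M\<^esub> l \<in> c y" if l: "l \<in> K" for l
      unfolding c_def k(2)
    proof (intro CollectI exI conjI)
      show "\<ominus>\<^bsub>M\<^esub> k \<oplus>\<^bsub>M\<^esub> l \<in> K" using K(3) Kneg k l by blast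
      show "x \<oplus>\<^bsub>M\<^esub> l = x \<oplus>\<^bsub>M\<^esub> k \<oplus>\<^bsub>M\<^esub> (\<ominus>\<^bsub>M\<^esub> k \<oplus>\<^bsub>M\<^esub> l)"
        using xy Kc[OF k(1)] Kc[OF l] by (simp add: M.a_assoc M.r_neg2)
    qed
    moreover have "y \<oplus>\<^bsub>M\<^esub> l \<in> c x" if l: "l \<in> K" for l
      unfolding c_def k(2)
    proof (intro CollectI exI conjI)
      show "k \<oplus>\<^bsub>M\<^esub> l \<in> K" using K(3) k l by blast
      show "x \<oplus>\<^bsub>M\<^esub> k \<oplus>\<^bsub>M\<^esub> l = x \<oplus>\<^bsub>M\<^esub> (k \<oplus>\<^bsub>M\<^esub> l)"
        using xy Kc[OF k(1)] Kc[OF l] by (simp add: M.a_assoc)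
    qed
    ultimately show "c x = c y" unfolding c_def[of x] c_def[of y] by (auto simp: c_def)
  qed
  have cK: "c (x \<oplus>\<^bsub>M\<^esub> k) = c x" if "x \<in> carrier M" "k \<in> K" for x k
  proof -
    have "\<exists>l\<in>K. x \<oplus>\<^bsub>M\<^esub> k = x \<oplus>\<^bsub>M\<^esub> l" using that(2) by blast
    thus ?thesis using c_eq[of x "x \<oplus>\<^bsub>M\<^esub> k"] that Kc by simp
  qed
  define h where "h = inv_into (carrier M) c"
  have h: "h (c x) \<in> carrier M" "c (h (c x)) = c x" if "x \<in> carrier M" for x
    unfolding h_def using inv_into_into[OF imageI[OF that]] f_inv_into_f[OF imageI[OF that]] .
  have hk: "\<exists>k\<in>K. h (c x) = x \<oplus>\<^bsub>M\<^esub> k" if "x \<in> carrier M" for x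
    using c_eq[OF that h(1)[OF that]] h(2)[OF that] by simp
  have add: "c (h (c x) \<oplus>\<^bsub>M\<^esub> h (c y)) = c (x \<oplus>\<^bsub>M\<^esub> y)" if xy: "x \<in> carrier M" "y \<in> carrier M" for x y
  proof -
    obtain k l where k: "k \<in> K" "h (c x) = x \<oplus>\<^bsub>M\<^esub> k" and l: "l \<in> K" "h (c y) = y \<oplus>\<^bsub>M\<^esub> l"
      using hk xy by blast
    have "h (c x) \<oplus>\<^bsub>M\<^esub> h (c y) = (x \<oplus>\<^bsub>M\<^esub> y) \<oplus>\<^bsub>M\<^esub> (k \<oplus>\<^bsub>M\<^esub> l)"
      unfolding k(2) l(2) using xy Kc[OF k(1)] Kc[OF l(1)] by (simp add: M.a_ac)
    thus ?thesis using cK[OF M.a_closed[OF xy] K(3)[OF k(1) l(1)]] by simp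
  qed
  have smul: "c (a \<odot>\<^bsub>M\<^esub> h (c x)) = c (a \<odot>\<^bsub>M\<^esub> x)" if ax: "a \<in> carrier R" "x \<in> carrier M" for a x
  proof -
    obtain k where k: "k \<in> K" "h (c x) = x \<oplus>\<^bsub>M\<^esub> k" using hk ax by blast
    have "a \<odot>\<^bsub>M\<^esub> h (c x) = a \<odot>\<^bsub>M\<^esub> x \<oplus>\<^bsub>M\<^esub> a \<odot>\<^bsub>M\<^esub> k"
      unfolding k(2) using ax Kc[OF k(1)] by (simp add: smult_r_distr)
    thus ?thesis using cK[OF smult_closed[OF ax] K(4)[OF ax(1) k(1)]] by simp
  qed
  define Q where "Q = \<lparr>carrier = c ` carrier M, monoid.mult = (\<lambda>X Y. X), one = c \<zero>\<^bsub>M\<^esub>, zero = c \<zero>\<^bsub>M\<^esub>,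
     add = (\<lambda>X Y. c (h X \<oplus>\<^bsub>M\<^esub> h Y)), smult = (\<lambda>a X. c (a \<odot>\<^bsub>M\<^esub> h X))\<rparr>"
  have Q: "carrier Q = c ` carrier M" "\<zero>\<^bsub>Q\<^esub> = c \<zero>\<^bsub>M\<^esub>"
    "\<And>x y. x \<in> carrier M \<Longrightarrow> y \<in> carrier M \<Longrightarrow> c x \<oplus>\<^bsub>Q\<^esub> c y = c (x \<oplus>\<^bsub>M\<^esub> y)"
    "\<And>a x. a \<in> carrier R \<Longrightarrow> x \<in> carrier M \<Longrightarrow> a \<odot>\<^bsub>Q\<^esub> c x = c (a \<odot>\<^bsub>M\<^esub> x)"
    using add smul by (simp_all add: Q_def)
  have "abelian_group Q"
  proof (rule abelian_groupI)
    show "\<exists>Y\<in>carrier Q. Y \<oplus>\<^bsub>Q\<^esub> X = \<zero>\<^bsub>Q\<^esub>" if X: "X \<in> carrier Q" for X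
    proof -
      obtain x where x: "x \<in> carrier M" "X = c x" using X unfolding Q(1) by blast
      thus ?thesis using Q(1,2) Q(3)[of "\<ominus>\<^bsub>M\<^esub> x" x] by (intro bexI[of _ "c (\<ominus>\<^bsub>M\<^esub> x)"]) (auto simp: M.l_neg)
    qed
  qed (auto simp: Q M.a_ac)
  hence "module R Q"
    by (intro moduleI R.is_cring) (auto simp: Q smult_l_distr smult_r_distr smult_assoc1)
  moreover have "c \<in> mod_epi R M Q" by (auto simp: mod_epi_def mod_hom_def Q)
  moreover have "mod_ker M Q c = K"
  proof -
    have "c x = c \<zero>\<^bsub>M\<^esub> \<longleftrightarrow> x \<in> K" if "x \<in> carrier M" for x
      using c_eq[of "\<zero>\<^bsub>M\<^esub>" x] that Kc by auto
    thus ?thesis using Kc by (auto simp: mod_ker_def Q)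
  qed
  ultimately show ?thesis by blast
qed

lemma mod_hom_factor:
  assumes "module R M" "module R Q" "module R W"
    and p: "p \<in> mod_epi R M Q" and f: "f \<in> mod_hom R M W" and ker: "mod_ker M Q p \<subseteq> mod_ker M W f"
  shows "\<exists>g\<in>mod_hom R Q W. \<forall>x\<in>carrier M. g (p x) = f x"
proof -
  interpret M: module R M by fact
  interpret Q: module R Q by fact
  interpret W: module R W by fact
  have ph: "\<And>x. x \<in> carrier M \<Longrightarrow> p x \<in> carrier Q" "p ` carrier M = carrier Q"
    "\<And>x y. x \<in> carrier M \<Longrightarrow> y \<in> carrier M \<Longrightarrow> p (x \<oplus>\<^bsub>M\<^esub> y) = p x \<oplus>\<^bsub>Q\<^esub> p y"
    "\<And>a x. a \<in> carrier R \<Longrightarrow> x \<in> carrier M \<Longrightarrow> p (a \<odot>\<^bsub>M\<^esub> x) = a \<odot>\<^bsub>Q\<^esub> p x"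
    using p by (auto simp: mod_epi_def mod_hom_def)
  have fh: "\<And>x. x \<in> carrier M \<Longrightarrow> f x \<in> carrier W"
    "\<And>x y. x \<in> carrier M \<Longrightarrow> y \<in> carrier M \<Longrightarrow> f (x \<oplus>\<^bsub>M\<^esub> y) = f x \<oplus>\<^bsub>W\<^esub> f y"
    "\<And>a x. a \<in> carrier R \<Longrightarrow> x \<in> carrier M \<Longrightarrow> f (a \<odot>\<^bsub>M\<^esub> x) = a \<odot>\<^bsub>W\<^esub> f x"
    using f by (auto simp: mod_hom_def)
  have m1: "\<ominus>\<^bsub>R\<^esub> \<one>\<^bsub>R\<^esub> \<in> carrier R" by simp
  have Qm: "(\<ominus>\<^bsub>R\<^esub> \<one>\<^bsub>R\<^esub>) \<odot>\<^bsub>Q\<^esub> y = \<ominus>\<^bsub>Q\<^esub> y" if "y \<in> carrier Q" for y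
    using Q.smult_l_minus[of "\<one>\<^bsub>R\<^esub>" y] that by simp
  have Wm: "(\<ominus>\<^bsub>R\<^esub> \<one>\<^bsub>R\<^esub>) \<odot>\<^bsub>W\<^esub> y = \<ominus>\<^bsub>W\<^esub> y" if "y \<in> carrier W" for y
    using W.smult_l_minus[of "\<one>\<^bsub>R\<^esub>" y] that by simp
  have f_eq: "f x = f y" if xy: "x \<in> carrier M" "y \<in> carrier M" "p x = p y" for x y
  proof -
    let ?d = "x \<oplus>\<^bsub>M\<^esub> (\<ominus>\<^bsub>R\<^esub> \<one>\<^bsub>R\<^esub>) \<odot>\<^bsub>M\<^esub> y"
    have my: "(\<ominus>\<^bsub>R\<^esub> \<one>\<^bsub>R\<^esub>) \<odot>\<^bsub>M\<^esub> y \<in> carrier M" using xy m1 by simp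
    have "p ?d = p y \<oplus>\<^bsub>Q\<^esub> (\<ominus>\<^bsub>Q\<^esub> p y)"
      using ph(3)[OF xy(1) my] ph(4)[OF m1 xy(2)] xy(3) Qm[OF ph(1)[OF xy(2)]] by simp
    hence "p ?d = \<zero>\<^bsub>Q\<^esub>" using ph(1)[OF xy(2)] by (simp add: Q.M.r_neg)
    hence "?d \<in> mod_ker M Q p" using xy(1) my by (simp add: mod_ker_def)
    hence "f ?d = \<zero>\<^bsub>W\<^esub>" using ker by (auto simp: mod_ker_def)
    hence "f x \<oplus>\<^bsub>W\<^esub> (\<ominus>\<^bsub>W\<^esub> f y) = \<zero>\<^bsub>W\<^esub>"
      using fh(2)[OF xy(1) my] fh(3)[OF m1 xy(2)] Wm[OF fh(1)[OF xy(2)]] by simp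
    thus "f x = f y"
      using fh(1)[OF xy(1)] fh(1)[OF xy(2)] W.M.minus_equality[of "f x" "\<ominus>\<^bsub>W\<^esub> f y"] by simp
  qed
  define h where "h = inv_into (carrier M) p"
  have h: "h y \<in> carrier M" "p (h y) = y" if "y \<in> carrier Q" for y
    unfolding h_def using that ph(2) by (auto intro: inv_into_into f_inv_into_f)
  define g where "g y = f (h y)" for y
  have gp: "g (p x) = f x" if "x \<in> carrier M" for x
    unfolding g_def by (rule f_eq) (use h ph(1) that in auto)
  have "g y \<oplus>\<^bsub>W\<^esub> g z = g (y \<oplus>\<^bsub>Q\<^esub> z)" if yz: "y \<in> carrier Q" "z \<in> carrier Q" for y z
    using gp[of "h y \<oplus>\<^bsub>M\<^esub> h z"] h[OF yz(1)] h[OF yz(2)] ph(3) fh(2) unfolding g_def by simp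
  moreover have "a \<odot>\<^bsub>W\<^esub> g y = g (a \<odot>\<^bsub>Q\<^esub> y)" if ay: "a \<in> carrier R" "y \<in> carrier Q" for a y
    using gp[of "a \<odot>\<^bsub>M\<^esub> h y"] h[OF ay(2)] ay(1) ph(4) fh(3) unfolding g_def by simp
  moreover have "g y \<in> carrier W" if "y \<in> carrier Q" for y
    unfolding g_def by (rule fh(1)[OF h(1)[OF that]])
  ultimately have "g \<in> mod_hom R Q W" by (auto simp: mod_hom_def)
  thus ?thesis using gp by blast
qed

section \<open>Free modules of vectors\<close>

definition vec_module :: "('a, 'r) ring_scheme \<Rightarrow> nat set \<Rightarrow> ('a, nat \<Rightarrow> 'a) module"
  where "vec_module R I = \<lparr>carrier = cring.vecs R I, monoid.mult = (\<lambda>u v. u), one = cring.vzero R,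
    zero = cring.vzero R, add = cring.vadd R, smult = cring.smul R\<rparr>"

context cring
begin

lemma vec_module_simps [simp]:
  "carrier (vec_module R I) = vecs I" "\<zero>\<^bsub>vec_module R I\<^esub> = vzero"
  "u \<oplus>\<^bsub>vec_module R I\<^esub> v = vadd u v" "a \<odot>\<^bsub>vec_module R I\<^esub> v = smul a v"
  by (simp_all add: vec_module_def)

lemma module_vec_module: "module R (vec_module R I)"
proof (rule moduleI[OF is_cring])
  show "abelian_group (vec_module R I)"
  proof (rule abelian_groupI)
    fix u v w assume uvw: "u \<in> carrier (vec_module R I)" "v \<in> carrier (vec_module R I)" "w \<in> carrier (vec_module R I)"
    show "u \<oplus>\<^bsub>vec_module R I\<^esub> v \<oplus>\<^bsub>vec_module R I\<^esub> w = u \<oplus>\<^bsub>vec_module R I\<^esub> (v \<oplus>\<^bsub>vec_module R I\<^esub> w)"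
      using uvw vecs_UNIV vadd_assoc by simp
  next
    fix u v assume uv: "u \<in> carrier (vec_module R I)" "v \<in> carrier (vec_module R I)"
    show "u \<oplus>\<^bsub>vec_module R I\<^esub> v \<in> carrier (vec_module R I)" using uv by simp
    show "u \<oplus>\<^bsub>vec_module R I\<^esub> v = v \<oplus>\<^bsub>vec_module R I\<^esub> u"
      using uv vecs_UNIV vadd_comm by simp
  next
    fix u assume u: "u \<in> carrier (vec_module R I)"
    show "\<zero>\<^bsub>vec_module R I\<^esub> \<oplus>\<^bsub>vec_module R I\<^esub> u = u" using u vadd_zero(2)[of u I] by simp
    show "\<exists>v\<in>carrier (vec_module R I). v \<oplus>\<^bsub>vec_module R I\<^esub> u = \<zero>\<^bsub>vec_module R I\<^esub>"
      using u vadd_minus(2)[of u I] by (intro bexI[of _ "smul (\<ominus> \<one>) u"]) simp_all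
  qed simp
next
  fix a b u assume "a \<in> carrier R" "b \<in> carrier R" "u \<in> carrier (vec_module R I)"
  thus "(a \<oplus> b) \<odot>\<^bsub>vec_module R I\<^esub> u = a \<odot>\<^bsub>vec_module R I\<^esub> u \<oplus>\<^bsub>vec_module R I\<^esub> b \<odot>\<^bsub>vec_module R I\<^esub> u"
    "(a \<otimes> b) \<odot>\<^bsub>vec_module R I\<^esub> u = a \<odot>\<^bsub>vec_module R I\<^esub> (b \<odot>\<^bsub>vec_module R I\<^esub> u)"
    using vecs_UNIV add_smul smul_smul by simp_all
next
  fix a u v assume "a \<in> carrier R" "u \<in> carrier (vec_module R I)" "v \<in> carrier (vec_module R I)"
  thus "a \<odot>\<^bsub>vec_module R I\<^esub> (u \<oplus>\<^bsub>vec_module R I\<^esub> v) = a \<odot>\<^bsub>vec_module R I\<^esub> u \<oplus>\<^bsub>vec_module R I\<^esub> a \<odot>\<^bsub>vec_module R I\<^esub> v"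
    using vecs_UNIV smul_vadd by simp
next
  fix u assume "u \<in> carrier (vec_module R I)"
  thus "\<one> \<odot>\<^bsub>vec_module R I\<^esub> u = u" using smul_one[of u I] by simp
qed simp

lemma mod_hom_vec_module_iff:
  "f \<in> mod_hom R (vec_module R I) (vec_module R J) \<longleftrightarrow> lin (vecs I) f \<and> f ` vecs I \<subseteq> vecs J"
  using vecs_UNIV by (auto simp: mod_hom_def lin_def Pi_iff image_subset_iff)

lemma vec_module_iso_power:
  assumes "finite I"
  shows "\<exists>f. f \<in> mod_iso R (mod_power (ideal_module R (carrier R)) (card I)) (vec_module R I)"
proof -
  obtain h where h: "bij_betw h I {..<card I}"
    using ex_bij_betw_finite_nat[OF assms] unfolding atLeast0LessThan by blast
  have hI: "h i < card I" if "i \<in> I" for i using bij_betwE[OF h] that by blast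
  have hinv: "inv_into I h (h i) = i" if "i \<in> I" for i
    by (rule inv_into_f_f[OF bij_betw_imp_inj_on[OF h] that])
  let ?P = "mod_power (ideal_module R (carrier R)) (card I)"
  let ?f = "\<lambda>v i. if i \<in> I then v (h i) else \<zero>"
  have P: "carrier ?P = {..<card I} \<rightarrow>\<^sub>E carrier R" by (simp add: mod_power_def ideal_module_def)
  have mem: "?f v \<in> vecs I" if "v \<in> carrier ?P" for v
  proof -
    have "v (h i) \<in> carrier R" if "i \<in> I" for i
      using PiE_mem[of v "{..<card I}" "\<lambda>_. carrier R" "h i"] \<open>v \<in> carrier ?P\<close> hI[OF that] unfolding P by simp
    thus ?thesis unfolding vecs_def by simp
  qed
  have "?f \<in> mod_hom R ?P (vec_module R I)"
    unfolding mod_hom_def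
  proof (intro CollectI conjI ballI)
    show "?f \<in> carrier ?P \<rightarrow> carrier (vec_module R I)" using mem by simp
    fix u v assume "u \<in> carrier ?P" "v \<in> carrier ?P"
    show "?f (u \<oplus>\<^bsub>?P\<^esub> v) = ?f u \<oplus>\<^bsub>vec_module R I\<^esub> ?f v"
    proof
      fix i show "?f (u \<oplus>\<^bsub>?P\<^esub> v) i = (?f u \<oplus>\<^bsub>vec_module R I\<^esub> ?f v) i"
        using hI by (cases "i \<in> I") (simp_all add: mod_power_def ideal_module_def)
    qed
  next
    fix a v assume a: "a \<in> carrier R" and "v \<in> carrier ?P"
    show "?f (a \<odot>\<^bsub>?P\<^esub> v) = a \<odot>\<^bsub>vec_module R I\<^esub> ?f v"
    proof
      fix i show "?f (a \<odot>\<^bsub>?P\<^esub> v) i = (a \<odot>\<^bsub>vec_module R I\<^esub> ?f v) i"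
        using hI a by (cases "i \<in> I") (simp_all add: mod_power_def ideal_module_def)
    qed
  qed
  moreover have "bij_betw ?f (carrier ?P) (vecs I)"
  proof (rule bij_betw_byWitness[where f' = "\<lambda>v. \<lambda>j\<in>{..<card I}. v (inv_into I h j)"])
    have inv: "inv_into I h j \<in> I" "h (inv_into I h j) = j" if "j < card I" for j
    proof -
      have "j \<in> h ` I" using bij_betw_imp_surj_on[OF h] that by simp
      thus "inv_into I h j \<in> I" "h (inv_into I h j) = j" by (rule inv_into_into, rule f_inv_into_f)
    qed
    show "\<forall>v\<in>carrier ?P. (\<lambda>j\<in>{..<card I}. ?f v (inv_into I h j)) = v"
    proof
      fix v assume v: "v \<in> carrier ?P"
      show "(\<lambda>j\<in>{..<card I}. ?f v (inv_into I h j)) = v"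
      proof
        fix j
        show "(\<lambda>j\<in>{..<card I}. ?f v (inv_into I h j)) j = v j"
        proof (cases "j < card I")
          case True
          thus ?thesis using inv[OF True] by simp
        next
          case False
          thus ?thesis using PiE_arb[of v "{..<card I}" "\<lambda>_. carrier R" j] v unfolding P by simp
        qed
      qed
    qed
    show "\<forall>v\<in>vecs I. ?f (\<lambda>j\<in>{..<card I}. v (inv_into I h j)) = v"
    proof
      fix v assume v: "v \<in> vecs I"
      show "?f (\<lambda>j\<in>{..<card I}. v (inv_into I h j)) = v"
      proof
        fix i
        show "?f (\<lambda>j\<in>{..<card I}. v (inv_into I h j)) i = v i"
          using hI[of i] hinv[of i] vecs_outside[OF v, of i] by (cases "i \<in> I") simp_all
      qed
    qed
    show "?f ` carrier ?P \<subseteq> vecs I" using mem by blast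
    show "(\<lambda>v. \<lambda>j\<in>{..<card I}. v (inv_into I h j)) ` vecs I \<subseteq> carrier ?P"
      unfolding P by (intro image_subsetI restrict_PiE_iff[THEN iffD2] ballI vecs_carrier)
  qed
  ultimately have "?f \<in> mod_iso R ?P (vec_module R I)" by (simp add: mod_iso_def)
  thus ?thesis by blast
qed

lemma free_vec_module: "finite I \<Longrightarrow> free_of_finite_rank R (vec_module R I)"
  unfolding free_of_finite_rank_def
  by (intro conjI module_vec_module exI[of _ "card I"] vec_module_iso_power)

lemma free_of_finite_rank_vec_module:
  assumes "free_of_finite_rank R F"
  shows "\<exists>k f. f \<in> mod_iso R (vec_module R {..<k}) F"
proof -
  let ?P = "\<lambda>k. mod_power (ideal_module R (carrier R)) k"
  obtain k f where f: "f \<in> mod_iso R (?P k) F" using assms unfolding free_of_finite_rank_def by blast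
  obtain g where g: "g \<in> mod_iso R (?P k) (vec_module R {..<k})"
    using vec_module_iso_power[of "{..<k}"] unfolding card_lessThan by blast
  have "module R (?P k)" by (intro module_mod_power module_ideal_module is_cring oneideal)
  hence "inv_into (carrier (?P k)) g \<in> mod_iso R (vec_module R {..<k}) (?P k)" by (rule mod_iso_inv[OF _ g])
  from mod_iso_comp[OF this f] show ?thesis by blast
qed

section \<open>Finite generation is local\<close>

text \<open>Zorn's lemma yields a maximal ideal.\<close>
lemma ex_primeideal:
  assumes "ideal J R" "\<one> \<notin> J"
  shows "\<exists>P. primeideal P R \<and> J \<subseteq> P"
proof -
  let ?A = "{I. ideal I R \<and> J \<subseteq> I \<and> \<one> \<notin> I}"
  have "\<exists>M\<in>?A. \<forall>X\<in>?A. M \<subseteq> X \<longrightarrow> X = M"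
  proof (rule subset_Zorn_nonempty)
    show "?A \<noteq> {}" using assms by blast
    fix C assume C: "C \<noteq> {}" "subset.chain ?A C"
    hence CA: "C \<subseteq> ?A" unfolding pred_on.chain_def by simp
    hence "C \<subseteq> {I. ideal I R}" by blast
    hence "subset.chain {I. ideal I R} C" using C(2) unfolding pred_on.chain_def by simp
    hence "ideal (\<Union> C) R" using chain_Union_is_ideal[of C] C(1) by simp
    moreover obtain X where "X \<in> C" using C(1) by blast
    hence "J \<subseteq> \<Union> C" using CA by blast
    moreover have "\<one> \<notin> \<Union> C" using CA by blast
    ultimately show "\<Union> C \<in> ?A" by simp
  qed
  then obtain M where "M \<in> ?A" and mx: "\<forall>X\<in>?A. M \<subseteq> X \<longrightarrow> X = M" by (rule bexE)
  hence M: "ideal M R" "J \<subseteq> M" "\<one> \<notin> M" by simp_all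
  have max: "X = M" if "ideal X R" "J \<subseteq> X" "\<one> \<notin> X" "M \<subseteq> X" for X
    using bspec[OF mx, of X] that by simp
  have "maximalideal M R"
  proof (rule maximalidealI[OF M(1)])
    show "carrier R \<noteq> M" using M(3) by auto
    fix X assume X: "ideal X R" "M \<subseteq> X" "X \<subseteq> carrier R"
    show "X = M \<or> X = carrier R"
    proof (cases "\<one> \<in> X")
      case True
      thus ?thesis using ideal.one_imp_carrier[OF X(1)] by blast
    next
      case False
      thus ?thesis using max[OF X(1) _ False X(2)] M(2) X(2) by blast
    qed
  qed
  hence "primeideal M R" by (rule maximalideal_prime)
  thus ?thesis using M(2) by blast
qed

text \<open>The elements that multiply \<open>K\<close> into a finitely generated submodule of \<open>K\<close> form an ideal, and by hypothesis no
  prime ideal contains it.\<close>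
lemma finitely_generated_if_locally:
  assumes K: "submod K"
    and loc: "\<And>P. primeideal P R \<Longrightarrow> \<exists>a\<in>carrier R - P. \<exists>I f. finite I \<and> lin (vecs I) f \<and> f ` vecs I \<subseteq> K \<and>
      (\<forall>v\<in>K. smul a v \<in> f ` vecs I)"
  shows "\<exists>I f. finite I \<and> lin (vecs I) f \<and> f ` vecs I = K"
proof -
  define G where "G a I f \<longleftrightarrow> finite I \<and> lin (vecs I) f \<and> f ` vecs I \<subseteq> K \<and> (\<forall>v\<in>K. smul a v \<in> f ` vecs I)" for a I f
  let ?J = "{a \<in> carrier R. \<exists>I f. G a I f}"
  have JI: "a \<in> ?J" if "a \<in> carrier R" "G a I f" for a I f
    using that by (intro CollectI conjI exI)
  have im: "submod (f ` vecs I)" if "G a I f" for a I f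
    using that submod_image[OF submod_vecs_set] unfolding G_def by blast
  have "ideal ?J R"
  proof (rule idealI[OF ring_axioms])
    show "subgroup ?J (add_monoid R)"
    proof (rule add.subgroupI)
      have "smul \<zero> v = vzero" if "v \<in> K" for v
        by (rule smul_zero(2)[OF submod_vecs[OF K that]])
      hence "G \<zero> {} (\<lambda>v. v)"
        using lin_id[OF submod_vecs_set[of "{}"]] submod_zero[OF K]
        unfolding G_def vecs_empty by simp
      hence "\<zero> \<in> ?J" by (rule JI[OF zero_closed])
      thus "?J \<noteq> {}" by (rule ex_in_conv[THEN iffD1, OF exI])
    next
      fix a assume "a \<in> ?J"
      then obtain I f where a: "a \<in> carrier R" and f: "G a I f" by blast
      have "smul (\<ominus> a) v \<in> f ` vecs I" if "v \<in> K" for v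
      proof -
        have "smul (\<ominus> \<one>) (smul a v) \<in> f ` vecs I"
          by (rule submod_smul[OF im[OF f]]) (use f that in \<open>auto simp: G_def\<close>)
        thus ?thesis using a submod_vecs[OF K that] by (simp add: smul_smul l_minus)
      qed
      hence "G (\<ominus> a) I f" using f by (simp add: G_def)
      moreover have "\<ominus> a \<in> carrier R" using a by simp
      ultimately show "\<ominus> a \<in> ?J" by (rule JI[rotated])
    next
      fix a b assume "a \<in> ?J" "b \<in> ?J"
      then obtain I f L g where a: "a \<in> carrier R" "b \<in> carrier R" and f: "G a I f" and g: "G b L g" by blast
      let ?h = "\<lambda>r. vadd (f (evens r)) (g (odds r))"
      have D: "submod (vecs (join_index I L))" by simp
      have eo: "evens r \<in> vecs I" "odds r \<in> vecs L" if "r \<in> vecs (join_index I L)" for r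
        using that by (simp_all add: vecs_join_index direct_sum_iff)
      have lf: "lin (vecs I) f" "lin (vecs L) g" and fK: "f ` vecs I \<subseteq> K" "g ` vecs L \<subseteq> K"
        using f g by (auto simp: G_def)
      have lh: "lin (vecs (join_index I L)) ?h"
        by (rule lin_add[OF lin_comp[OF lin_evens[OF D] lf(1)] lin_comp[OF lin_odds[OF D] lf(2)]])
           (use eo in auto)
      have "?h r \<in> K" if "r \<in> vecs (join_index I L)" for r
        by (rule submod_vadd[OF K]) (use fK eo[OF that] in auto)
      hence hK: "?h ` vecs (join_index I L) \<subseteq> K" by blast
      have "smul (a \<oplus> b) v \<in> ?h ` vecs (join_index I L)" if v: "v \<in> K" for v
      proof -
        obtain r q where r: "r \<in> vecs I" "smul a v = f r" and q: "q \<in> vecs L" "smul b v = g q"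
        proof -
          have "smul a v \<in> f ` vecs I" "smul b v \<in> g ` vecs L" using f g v by (simp_all add: G_def)
          thus ?thesis using that by blast
        qed
        have "smul (a \<oplus> b) v = ?h (join r q)"
          unfolding evens_join odds_join r(2)[symmetric] q(2)[symmetric]
          by (rule add_smul[OF a submod_vecs[OF K v]])
        moreover have "join r q \<in> vecs (join_index I L)" using r q by (simp add: vecs_join_index direct_sum_iff)
        ultimately show ?thesis by blast
      qed
      moreover have "finite (join_index I L)" using f g by (simp add: G_def finite_join_index)
      ultimately have "G (a \<oplus> b) (join_index I L) ?h"
        unfolding G_def using lh hK by (intro conjI ballI)
      moreover have "a \<oplus> b \<in> carrier R" using a by simp
      ultimately show "a \<oplus> b \<in> ?J" by (rule JI[rotated])
    qed (simp add: Collect_mono subset_iff)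
  next
    fix a x assume "a \<in> ?J" and x: "x \<in> carrier R"
    then obtain I f where a: "a \<in> carrier R" and f: "G a I f" by blast
    have "smul (x \<otimes> a) v \<in> f ` vecs I" if "v \<in> K" for v
    proof -
      have "smul x (smul a v) \<in> f ` vecs I"
        by (rule submod_smul[OF im[OF f] x]) (use f that in \<open>auto simp: G_def\<close>)
      thus ?thesis using a x submod_vecs[OF K that] by (simp add: smul_smul)
    qed
    hence "G (x \<otimes> a) I f" using f by (simp add: G_def)
    moreover have "x \<otimes> a \<in> carrier R" using a x by simp
    ultimately show "x \<otimes> a \<in> ?J" by (rule JI[rotated])
    thus "a \<otimes> x \<in> ?J" using a x by (simp only: m_comm)
  qed
  moreover have "\<not> ?J \<subseteq> P" if P: "primeideal P R" for P
  proof -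
    obtain a I f where a: "a \<in> carrier R - P" "G a I f" using loc[OF P] unfolding G_def by blast
    hence "a \<in> ?J" by (intro JI) simp_all
    thus ?thesis using a(1) by blast
  qed
  ultimately have "\<one> \<in> ?J" using ex_primeideal[of ?J] by blast
  then obtain I f where f: "G \<one> I f" by blast
  have "K \<subseteq> f ` vecs I"
  proof
    fix v assume v: "v \<in> K"
    hence "smul \<one> v \<in> f ` vecs I" using f by (simp add: G_def)
    thus "v \<in> f ` vecs I" using smul_one[OF submod_vecs[OF K v]] by simp
  qed
  thus ?thesis using f unfolding G_def by blast
qed

end

section \<open>Quasi-flat ideals with two generators\<close>

context cring
begin

lemma genideal_pair:
  assumes "x \<in> carrier R" "y \<in> carrier R" "z \<in> Idl {x, y}"
  shows "\<exists>c\<in>carrier R. \<exists>d\<in>carrier R. z = c \<otimes> x \<oplus> d \<otimes> y"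
proof -
  have "ideal (PIdl x <+> PIdl y) R"
    by (intro add_ideals cgenideal_ideal assms)
  moreover have "x \<in> PIdl x <+> PIdl y"
  proof -
    have "x \<in> PIdl x" "\<zero> \<in> PIdl y"
      using cgenideal_self[OF assms(1)] additive_subgroup.zero_closed[OF ideal.axioms(1)[OF cgenideal_ideal[OF assms(2)]]] .
    thus ?thesis unfolding set_add_def' using r_zero[OF assms(1)] by force
  qed
  moreover have "y \<in> PIdl x <+> PIdl y"
  proof -
    have "y \<in> PIdl y" "\<zero> \<in> PIdl x"
      using cgenideal_self[OF assms(2)] additive_subgroup.zero_closed[OF ideal.axioms(1)[OF cgenideal_ideal[OF assms(1)]]] .
    thus ?thesis unfolding set_add_def' using l_zero[OF assms(2)] by force
  qed
  ultimately have "Idl {x, y} \<subseteq> PIdl x <+> PIdl y" by (intro genideal_minimal) auto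
  thus ?thesis using assms(3) unfolding set_add_def' cgenideal_def by blast
qed

text \<open>Let \<open>V\<close> be the ideal generated by \<open>x\<close> and \<open>y\<close>, and \<open>A\<close> the set of all \<open>a\<close> with \<open>a y \<in> R x\<close>. The map
  \<open>V \<rightarrow> V / A w\<close> with \<open>x \<mapsto> 0\<close> and \<open>y \<mapsto> w\<close> is well defined. Flatness of \<open>V\<close> relative to itself lifts it
  along the relation \<open>(r, t)\<close>, that is, on the module with two generators and this single relation.\<close>
lemma quasi_flat_pair_relation:
  assumes qf: "quasi_flat R (ideal_module R (Idl {x, y}))"
    and c: "x \<in> carrier R" "y \<in> carrier R" "r \<in> carrier R" "t \<in> carrier R"
    and rel: "r \<otimes> x \<oplus> t \<otimes> y = \<zero>" and w: "w \<in> {x, y}"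
  shows "\<exists>a\<in>carrier R. \<exists>b\<in>carrier R. (\<exists>a'\<in>carrier R. a \<otimes> y = a' \<otimes> x) \<and> (\<exists>b'\<in>carrier R. b \<otimes> y = b' \<otimes> x) \<and>
    r \<otimes> (a \<otimes> w) \<oplus> t \<otimes> (w \<oplus> b \<otimes> w) = \<zero>"
proof -
  define V where "V = ideal_module R (Idl {x, y})"
  have idl: "ideal (Idl {x, y}) R" by (rule genideal_ideal) (use c in auto)
  interpret I: ideal "Idl {x, y}" R by (rule idl)
  have xy: "x \<in> Idl {x, y}" "y \<in> Idl {x, y}" using genideal_self[of "{x, y}"] c by auto
  have modV: "module R V" unfolding V_def by (rule module_ideal_module[OF is_cring idl])
  have V [simp]: "carrier V = Idl {x, y}" "\<zero>\<^bsub>V\<^esub> = \<zero>" "a \<oplus>\<^bsub>V\<^esub> b = a \<oplus> b" "a \<odot>\<^bsub>V\<^esub> b = a \<otimes> b" for a b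
    by (simp_all add: V_def ideal_module_def)
  have wI: "w \<in> Idl {x, y}" and wc: "w \<in> carrier R" using w xy c by auto
  let ?F = "vec_module R {0, 1}"
  note modF = module_vec_module[of "{0, 1}"]
  let ?e0 = "unit_vec 0" and ?e1 = "unit_vec 1"
  have e: "?e0 \<in> vecs {0, 1}" "?e1 \<in> vecs {0, 1}" by simp_all
  define \<pi> where "\<pi> v = v 0 \<otimes> x \<oplus> v 1 \<otimes> y" for v :: "nat \<Rightarrow> 'a"
  have \<pi>I: "\<pi> v \<in> Idl {x, y}" if "v \<in> vecs {0, 1}" for v
    unfolding \<pi>_def using that xy by (intro I.a_closed I.I_l_closed) simp_all
  have \<pi>h: "\<pi> \<in> mod_hom R ?F V"
    unfolding mod_hom_def
  proof (intro CollectI conjI ballI)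
    show "\<pi> \<in> carrier ?F \<rightarrow> carrier V" using \<pi>I by simp
    fix u v assume uv: "u \<in> carrier ?F" "v \<in> carrier ?F"
    have k: "u 0 \<in> carrier R" "u 1 \<in> carrier R" "v 0 \<in> carrier R" "v 1 \<in> carrier R" using uv by simp_all
    have "(u 0 \<oplus> v 0) \<otimes> x \<oplus> (u 1 \<oplus> v 1) \<otimes> y = (u 0 \<otimes> x \<oplus> u 1 \<otimes> y) \<oplus> (v 0 \<otimes> x \<oplus> v 1 \<otimes> y)"
      using k c by algebra
    thus "\<pi> (u \<oplus>\<^bsub>?F\<^esub> v) = \<pi> u \<oplus>\<^bsub>V\<^esub> \<pi> v" by (simp add: \<pi>_def)
  next
    fix a v assume a: "a \<in> carrier R" and v: "v \<in> carrier ?F"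
    have k: "v 0 \<in> carrier R" "v 1 \<in> carrier R" using v by simp_all
    have "(a \<otimes> v 0) \<otimes> x \<oplus> (a \<otimes> v 1) \<otimes> y = a \<otimes> (v 0 \<otimes> x \<oplus> v 1 \<otimes> y)"
      using k c a by algebra
    thus "\<pi> (a \<odot>\<^bsub>?F\<^esub> v) = a \<odot>\<^bsub>V\<^esub> \<pi> v" by (simp add: \<pi>_def)
  qed
  have "z \<in> \<pi> ` carrier ?F" if z: "z \<in> Idl {x, y}" for z
  proof -
    obtain c' d where d: "c' \<in> carrier R" "d \<in> carrier R" "z = c' \<otimes> x \<oplus> d \<otimes> y"
      using genideal_pair[OF c(1,2) z] by blast
    let ?v = "vadd (smul c' ?e0) (smul d ?e1)"
    have "\<pi> ?v = z" unfolding \<pi>_def d(3) using d by (simp add: unit_vec_apply)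
    moreover have "?v \<in> carrier ?F" using d by simp
    ultimately show ?thesis by blast
  qed
  hence \<pi>: "\<pi> \<in> mod_epi R ?F V" unfolding mod_epi_def using \<pi>h \<pi>I by auto
  \<comment> \<open>\<open>G\<close> is the module on two generators with the single relation \<open>(r, t)\<close>.\<close>
  define \<rho> where "\<rho> = vadd (smul r ?e0) (smul t ?e1)"
  have \<rho>: "\<rho> \<in> vecs {0, 1}" "\<rho> 0 = r" "\<rho> 1 = t" using c by (simp_all add: \<rho>_def unit_vec_apply)
  have \<rho>U: "\<rho> \<in> vecs UNIV" by (rule vecs_UNIV[OF \<rho>(1)])
  define K where "K = {smul a \<rho> |a. a \<in> carrier R}"
  have KI: "smul a \<rho> \<in> K" if "a \<in> carrier R" for a
    unfolding K_def using that by auto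
  have KE: "\<exists>a\<in>carrier R. u = smul a \<rho>" if "u \<in> K" for u
    using that unfolding K_def by blast
  have "\<exists>(G :: ('a, (nat \<Rightarrow> 'a) set) module) e. module R G \<and> e \<in> mod_epi R ?F G \<and> mod_ker ?F G e = K"
  proof (rule ex_quotient_module[OF modF])
    show "K \<subseteq> carrier ?F"
    proof
      fix u assume "u \<in> K"
      then obtain a where "a \<in> carrier R" "u = smul a \<rho>" using KE by blast
      thus "u \<in> carrier ?F" using \<rho>(1) by simp
    qed
    show "\<zero>\<^bsub>?F\<^esub> \<in> K" using KI[OF zero_closed] smul_zero(2)[OF \<rho>U] by simp
    show "u \<oplus>\<^bsub>?F\<^esub> v \<in> K" if uv: "u \<in> K" "v \<in> K" for u v
    proof -
      obtain a b where "a \<in> carrier R" "b \<in> carrier R" "u = smul a \<rho>" "v = smul b \<rho>"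
        using KE[OF uv(1)] KE[OF uv(2)] by blast
      hence "u \<oplus>\<^bsub>?F\<^esub> v = smul (a \<oplus> b) \<rho>" "a \<oplus> b \<in> carrier R"
        using add_smul[OF _ _ \<rho>U, of a b] by simp_all
      thus ?thesis using KI by metis
    qed
    show "a \<odot>\<^bsub>?F\<^esub> u \<in> K" if a: "a \<in> carrier R" and u: "u \<in> K" for a u
    proof -
      obtain b where "b \<in> carrier R" "u = smul b \<rho>" using KE[OF u] by blast
      hence "a \<odot>\<^bsub>?F\<^esub> u = smul (a \<otimes> b) \<rho>" "a \<otimes> b \<in> carrier R"
        using smul_smul[OF a _ \<rho>U, of b] a by simp_all
      thus ?thesis using KI by metis
    qed
  qed
  then obtain G :: "('a, (nat \<Rightarrow> 'a) set) module" and \<epsilon>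
    where G: "module R G" and \<epsilon>: "\<epsilon> \<in> mod_epi R ?F G" and ker_\<epsilon>: "mod_ker ?F G \<epsilon> = K" by (elim exE conjE)
  have \<epsilon>h: "\<epsilon> \<in> mod_hom R ?F G" using \<epsilon> by (simp add: mod_epi_def)
  define Fs where "Fs i = (if i = (0::nat) then ?F else vec_module R {0})" for i
  have Fs: "Fs 0 = ?F" "Fs 1 = vec_module R {0}" by (simp_all add: Fs_def)
  have "finite_n_presentation R 1 Fs (\<lambda>_ v. smul (v 0) \<rho>) \<epsilon> G"
    unfolding finite_n_presentation_def
  proof (intro conjI allI impI)
    show "free_of_finite_rank R (Fs i)" for i unfolding Fs_def by (simp add: free_vec_module)
    show "\<epsilon> \<in> mod_epi R (Fs 0) G" using \<epsilon> by (simp add: Fs_def)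
    fix i :: nat assume "i < 1"
    hence i: "i = 0" by simp
    have "(\<lambda>v. smul (v 0) \<rho>) \<in> mod_hom R (vec_module R {0}) ?F"
      unfolding mod_hom_def
    proof (intro CollectI conjI ballI)
      show "(\<lambda>v. smul (v 0) \<rho>) \<in> carrier (vec_module R {0}) \<rightarrow> carrier ?F" using \<rho>(1) by simp
      show "smul ((v \<oplus>\<^bsub>vec_module R {0}\<^esub> v') 0) \<rho> = smul (v 0) \<rho> \<oplus>\<^bsub>?F\<^esub> smul (v' 0) \<rho>"
        if "v \<in> carrier (vec_module R {0})" "v' \<in> carrier (vec_module R {0})" for v v'
        using add_smul[OF _ _ \<rho>U, of "v 0" "v' 0"] that by simp
      show "smul ((a \<odot>\<^bsub>vec_module R {0}\<^esub> v) 0) \<rho> = a \<odot>\<^bsub>?F\<^esub> smul (v 0) \<rho>"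
        if "a \<in> carrier R" "v \<in> carrier (vec_module R {0})" for a v
        using smul_smul[OF that(1) _ \<rho>U, of "v 0"] that by simp
    qed
    thus "(\<lambda>v. smul (v 0) \<rho>) \<in> mod_hom R (Fs (Suc i)) (Fs i)" unfolding i Fs_def by simp
  next
    have "(\<lambda>v. smul (v 0) \<rho>) ` vecs {0} = K"
    proof (intro equalityI subsetI)
      fix u assume "u \<in> K"
      then obtain a where a: "a \<in> carrier R" "u = smul a \<rho>" unfolding K_def by blast
      show "u \<in> (\<lambda>v. smul (v 0) \<rho>) ` vecs {0}"
        unfolding a(2) using a(1) by (intro image_eqI[of _ _ "smul a ?e0"]) (simp_all add: unit_vec_apply)
    next
      fix u assume "u \<in> (\<lambda>v. smul (v 0) \<rho>) ` vecs {0}"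
      then obtain v where v: "v \<in> vecs {0}" "u = smul (v 0) \<rho>" by blast
      have "v 0 \<in> carrier R" using v(1) by simp
      thus "u \<in> K" unfolding K_def v(2) by blast
    qed
    thus "(\<lambda>v. smul (v 0) \<rho>) ` carrier (Fs 1) = mod_ker (Fs 0) G \<epsilon>"
      unfolding Fs ker_\<epsilon> vec_module_simps .
  qed simp
  hence fpG: "finitely_presented R G" by (rule finite_n_presentation_imp_finitely_n_presented[OF G])
  have "mod_ker ?F G \<epsilon> \<subseteq> mod_ker ?F V \<pi>"
    unfolding ker_\<epsilon>
  proof
    fix u assume "u \<in> K"
    then obtain a where a: "a \<in> carrier R" "u = smul a \<rho>" unfolding K_def by blast
    have "(a \<otimes> r) \<otimes> x \<oplus> (a \<otimes> t) \<otimes> y = a \<otimes> (r \<otimes> x \<oplus> t \<otimes> y)" using a(1) c by algebra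
    hence "\<pi> u = \<zero>" unfolding rel \<pi>_def a(2) using a(1) \<rho>(2,3) by simp
    moreover have "u \<in> vecs {0, 1}" unfolding a(2) using a(1) \<rho>(1) by simp
    ultimately show "u \<in> mod_ker ?F V \<pi>" by (simp add: mod_ker_def)
  qed
  from mod_hom_factor[OF modF G modV \<epsilon> \<pi>h this]
  obtain v where v1: "v \<in> mod_hom R G V" "\<forall>u\<in>carrier ?F. v (\<epsilon> u) = \<pi> u" by (rule bexE)
  have v: "v \<in> mod_hom R G V" "\<And>u. u \<in> vecs {0, 1} \<Longrightarrow> v (\<epsilon> u) = \<pi> u"
    using v1 by simp_all
  \<comment> \<open>In \<open>V / A w\<close> the class of \<open>w\<close> is killed by every coefficient of \<open>y\<close> in a relation of \<open>x\<close> and \<open>y\<close>.\<close>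
  define A where "A = {a \<in> carrier R. \<exists>a'\<in>carrier R. a \<otimes> y = a' \<otimes> x}"
  define W where "W = {a \<otimes> w |a. a \<in> A}"
  have Ac: "a \<in> carrier R" if "a \<in> A" for a using that by (simp add: A_def)
  have A0: "\<zero> \<in> A" unfolding A_def using c by (auto intro!: bexI[of _ \<zero>])
  have Aadd: "a \<oplus> b \<in> A" if ab: "a \<in> A" "b \<in> A" for a b
  proof -
    obtain a' b' where k: "a' \<in> carrier R" "a \<otimes> y = a' \<otimes> x" "b' \<in> carrier R" "b \<otimes> y = b' \<otimes> x"
      using ab by (auto simp: A_def)
    have "(a \<oplus> b) \<otimes> y = (a' \<oplus> b') \<otimes> x" using k Ac ab c by (simp add: l_distr)
    thus ?thesis unfolding A_def using Ac[OF ab(1)] Ac[OF ab(2)] k(1,3)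
      by (intro CollectI conjI bexI[of _ "a' \<oplus> b'"]) auto
  qed
  have Amul: "s \<otimes> a \<in> A" if s: "s \<in> carrier R" and a: "a \<in> A" for s a
  proof -
    obtain a' where k: "a' \<in> carrier R" "a \<otimes> y = a' \<otimes> x" using a by (auto simp: A_def)
    have "(s \<otimes> a) \<otimes> y = (s \<otimes> a') \<otimes> x" using k Ac[OF a] s c by (simp add: m_assoc)
    thus ?thesis unfolding A_def using Ac[OF a] s k(1) by (intro CollectI conjI bexI[of _ "s \<otimes> a'"]) auto
  qed
  have "\<exists>(Q :: ('a, 'a set) module) p. module R Q \<and> p \<in> mod_epi R V Q \<and> mod_ker V Q p = W"
  proof (rule ex_quotient_module[OF modV])
    show "W \<subseteq> carrier V" using Ac wI I.I_l_closed by (auto simp: W_def)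
    have "\<zero> = \<zero> \<otimes> w" using wc by simp
    thus "\<zero>\<^bsub>V\<^esub> \<in> W" unfolding W_def using A0 by auto
    show "u \<oplus>\<^bsub>V\<^esub> u' \<in> W" if uu: "u \<in> W" "u' \<in> W" for u u'
    proof -
      obtain a b where ab: "a \<in> A" "b \<in> A" "u = a \<otimes> w" "u' = b \<otimes> w" using uu unfolding W_def by blast
      have "u \<oplus> u' = (a \<oplus> b) \<otimes> w" unfolding ab(3,4) using Ac ab(1,2) wc by (simp add: l_distr)
      thus ?thesis unfolding W_def using Aadd[OF ab(1,2)] by auto
    qed
    show "s \<odot>\<^bsub>V\<^esub> u \<in> W" if s: "s \<in> carrier R" and u: "u \<in> W" for s u
    proof -
      obtain a where a: "a \<in> A" "u = a \<otimes> w" using u unfolding W_def by blast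
      have "s \<otimes> u = (s \<otimes> a) \<otimes> w" unfolding a(2) using Ac[OF a(1)] s wc by (simp add: m_assoc)
      thus ?thesis unfolding W_def using Amul[OF s a(1)] by auto
    qed
  qed
  then obtain Q :: "('a, 'a set) module" and p
    where Q: "module R Q" and p: "p \<in> mod_epi R V Q" and ker_p: "mod_ker V Q p = W" by (elim exE conjE)
  interpret Q: module R Q by (rule Q)
  have ph: "\<And>z. z \<in> Idl {x, y} \<Longrightarrow> p z \<in> carrier Q"
    "\<And>z z'. z \<in> Idl {x, y} \<Longrightarrow> z' \<in> Idl {x, y} \<Longrightarrow> p (z \<oplus> z') = p z \<oplus>\<^bsub>Q\<^esub> p z'"
    "\<And>a z. a \<in> carrier R \<Longrightarrow> z \<in> Idl {x, y} \<Longrightarrow> p (a \<otimes> z) = a \<odot>\<^bsub>Q\<^esub> p z"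
    "p ` (Idl {x, y}) = carrier Q"
    using p by (auto simp: mod_epi_def mod_hom_def)
  have p0: "p z = \<zero>\<^bsub>Q\<^esub> \<longleftrightarrow> z \<in> W" if "z \<in> Idl {x, y}" for z
    using that unfolding ker_p[symmetric] by (simp add: mod_ker_def)
  let ?u0 = "\<lambda>z :: nat \<Rightarrow> 'a. z 1 \<odot>\<^bsub>Q\<^esub> p w"
  have u0: "?u0 \<in> mod_hom R ?F Q"
    unfolding mod_hom_def using ph(1)[OF wI] by (auto simp: Q.smult_l_distr Q.smult_assoc1)
  have "mod_ker ?F V \<pi> \<subseteq> mod_ker ?F Q ?u0"
  proof
    fix z assume "z \<in> mod_ker ?F V \<pi>"
    hence z: "z \<in> vecs {0, 1}" "z 0 \<otimes> x \<oplus> z 1 \<otimes> y = \<zero>" by (auto simp: mod_ker_def \<pi>_def)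
    have zc: "z 0 \<in> carrier R" "z 1 \<in> carrier R" using z(1) by simp_all
    have "z 1 \<otimes> y = (z 0 \<otimes> x \<oplus> z 1 \<otimes> y) \<oplus> \<ominus> z 0 \<otimes> x" using zc c by algebra
    also have "\<dots> = \<ominus> z 0 \<otimes> x" unfolding z(2) using zc c by simp
    finally have "z 1 \<in> A" unfolding A_def using zc by (intro CollectI conjI bexI[of _ "\<ominus> z 0"]) auto
    hence "z 1 \<otimes> w \<in> W" unfolding W_def by blast
    hence "p (z 1 \<otimes> w) = \<zero>\<^bsub>Q\<^esub>" using p0[OF I.I_l_closed[OF wI zc(2)]] by simp
    thus "z \<in> mod_ker ?F Q ?u0" using ph(3)[OF zc(2) wI] z(1) by (simp add: mod_ker_def)
  qed
  from mod_hom_factor[OF modF modV Q \<pi> u0 this]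
  obtain u where u1: "u \<in> mod_hom R V Q" "\<forall>z\<in>carrier ?F. u (\<pi> z) = ?u0 z" by (rule bexE)
  have u: "u \<in> mod_hom R V Q" "\<And>z. z \<in> vecs {0, 1} \<Longrightarrow> u (\<pi> z) = z 1 \<odot>\<^bsub>Q\<^esub> p w"
    using u1 by simp_all
  \<comment> \<open>Flatness of \<open>V\<close> relative to its first power gives the lift \<open>q\<close>; \<open>k\<close> is \<open>q\<close> on the two generators.\<close>
  have P1: "carrier (mod_power V 1) = {..<1} \<rightarrow>\<^sub>E Idl {x, y}" by (simp add: mod_power_def)
  have ev: "(\<lambda>f. f 0) \<in> mod_epi R (mod_power V 1) V"
  proof -
    have "z \<in> (\<lambda>f. f 0) ` carrier (mod_power V 1)" if "z \<in> Idl {x, y}" for z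
      using that unfolding P1 by (intro image_eqI[of _ _ "\<lambda>i\<in>{..<1::nat}. z"]) auto
    moreover have "f 0 \<in> Idl {x, y}" if "f \<in> carrier (mod_power V 1)" for f
      using that PiE_mem[of f "{..<1}" "\<lambda>_. Idl {x, y}" 0] unfolding P1 by simp
    ultimately show ?thesis unfolding mod_epi_def mod_hom_def by (auto simp: mod_power_def)
  qed
  have flat: "rel_flat R (mod_power V 1) V" using qf unfolding quasi_flat_def V_def by simp
  obtain q where q: "q \<in> mod_hom R G (mod_power V 1)"
    "\<And>z. z \<in> carrier G \<Longrightarrow> (p \<circ> (\<lambda>f. f 0)) (q z) = u (v z)"
    using rel_flatD[OF flat Q mod_epi_comp[OF ev p] u(1) fpG v(1)] by blast
  define k where "k = (\<lambda>f. f 0) \<circ> q \<circ> \<epsilon>"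
  have k: "k \<in> mod_hom R ?F V"
    unfolding k_def comp_assoc using ev by (intro mod_hom_comp[OF mod_hom_comp[OF \<epsilon>h q(1)]]) (simp add: mod_epi_def)
  have kI: "k z \<in> Idl {x, y}" if "z \<in> vecs {0, 1}" for z using k that by (auto simp: mod_hom_def)
  have pk: "p (k z) = z 1 \<odot>\<^bsub>Q\<^esub> p w" if z: "z \<in> vecs {0, 1}" for z
  proof -
    have "\<epsilon> z \<in> carrier G" using \<epsilon>h z by (auto simp: mod_hom_def)
    from q(2)[OF this] show ?thesis unfolding k_def v(2)[OF z] u(2)[OF z] by simp
  qed
  have "p (k ?e0) = \<zero>\<^bsub>Q\<^esub>" using pk[OF e(1)] ph(1)[OF wI] by (simp add: unit_vec_apply)
  hence "k ?e0 \<in> W" using p0[OF kI[OF e(1)]] by simp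
  then obtain a where a: "a \<in> A" "k ?e0 = a \<otimes> w" unfolding W_def by blast
  have mw: "\<ominus> \<one> \<otimes> w \<in> Idl {x, y}" by (rule I.I_l_closed[OF wI]) simp
  have "p (k ?e1 \<oplus> \<ominus> \<one> \<otimes> w) = p w \<oplus>\<^bsub>Q\<^esub> (\<ominus> \<one>) \<odot>\<^bsub>Q\<^esub> p w"
    using ph(2)[OF kI[OF e(2)] mw] ph(3)[OF _ wI, of "\<ominus> \<one>"] pk[OF e(2)] ph(1)[OF wI] by (simp add: unit_vec_apply)
  also have "\<dots> = \<zero>\<^bsub>Q\<^esub>"
    using ph(1)[OF wI] Q.smult_l_minus[of \<one> "p w"] by (simp add: Q.M.r_neg)
  finally have "k ?e1 \<oplus> \<ominus> \<one> \<otimes> w \<in> W" using p0[OF I.a_closed[OF kI[OF e(2)] mw]] by simp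
  then obtain b where b: "b \<in> A" "k ?e1 \<oplus> \<ominus> \<one> \<otimes> w = b \<otimes> w" unfolding W_def by blast
  have kc: "k ?e1 \<in> carrier R" using I.Icarr[OF kI[OF e(2)]] .
  have "k ?e1 = w \<oplus> (k ?e1 \<oplus> \<ominus> \<one> \<otimes> w)" using kc wc by algebra
  hence k1: "k ?e1 = w \<oplus> b \<otimes> w" unfolding b(2) .
  have "\<epsilon> \<rho> = \<zero>\<^bsub>G\<^esub>"
  proof -
    have "\<rho> = smul \<one> \<rho>" using \<rho>U by simp
    hence "\<rho> \<in> mod_ker ?F G \<epsilon>" unfolding ker_\<epsilon> K_def by blast
    thus ?thesis by (simp add: mod_ker_def)
  qed
  moreover have "q \<zero>\<^bsub>G\<^esub> = \<zero>\<^bsub>mod_power V 1\<^esub>" by (rule mod_hom_zero[OF G module_mod_power[OF modV] q(1)])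
  ultimately have "k \<rho> = \<zero>" unfolding k_def by (simp add: mod_power_def)
  moreover have "k \<rho> = r \<otimes> k ?e0 \<oplus> t \<otimes> k ?e1"
  proof -
    have add: "k (vadd u v) = k u \<oplus> k v" if "u \<in> vecs {0, 1}" "v \<in> vecs {0, 1}" for u v
      using k that by (auto simp: mod_hom_def)
    have sm: "k (smul s u) = s \<otimes> k u" if "u \<in> vecs {0, 1}" "s \<in> carrier R" for u s
      using k that by (auto simp: mod_hom_def)
    show ?thesis
      unfolding \<rho>_def add[OF smul_vecs[OF c(3) e(1)] smul_vecs[OF c(4) e(2)]] sm[OF e(1) c(3)] sm[OF e(2) c(4)] ..
  qed
  ultimately have "r \<otimes> (a \<otimes> w) \<oplus> t \<otimes> (w \<oplus> b \<otimes> w) = \<zero>" unfolding a(2) k1 by simp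
  thus ?thesis using a(1) b(1) unfolding A_def by blast
qed

end

text \<open>Write \<open>x\<close>, \<open>y\<close> for two elements that are incomparable near \<open>P\<close> and \<open>r x + t y = 0\<close>. The multipliers that move
  one of \<open>x\<close>, \<open>y\<close> into the ideal generated by the other then lie in \<open>P\<close>. The preceding lemma for \<open>w = x\<close> gives
  \<open>(1 + b - a') t x = 0\<close> with \<open>b\<close> and \<open>a'\<close> in \<open>P\<close>, hence \<open>t x\<close> is zero near \<open>P\<close>; by symmetry so is \<open>r y\<close>. For
  \<open>w = y\<close> the first summand now disappears, which leaves \<open>(1 + b) t y = 0\<close>.\<close>
lemma fqf_split_at_prime:
  fixes R :: "('a, 'r) ring_scheme" (structure)
  assumes fqf: "fqf_ring R" and P: "primeideal P R"
  shows "split_at_prime P R"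
proof -
  interpret at_prime P R unfolding at_prime_def by (rule P)
  have qf: "quasi_flat R (ideal_module R (Idl {x, y}))" if "x \<in> carrier R" "y \<in> carrier R" for x y
    using fqf that by (simp add: fqf_ring_def)
  have A: "a \<in> P" if "\<not> ndvd x y" "a \<in> carrier R" "a' \<in> carrier R" "a \<otimes> y = a' \<otimes> x" for a a' x y
  proof (rule ccontr)
    assume "a \<notin> P"
    hence "a \<in> S" using that(2) by (simp add: S_def)
    thus False using that unfolding ndvd_def by blast
  qed
  have near_tx: "nzero (t \<otimes> x)"
    if c: "x \<in> carrier R" "y \<in> carrier R" "r \<in> carrier R" "t \<in> carrier R"
      and n: "\<not> ndvd x y" "\<not> ndvd y x" and rel: "r \<otimes> x \<oplus> t \<otimes> y = \<zero>" for x y r t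
  proof -
    obtain a b a' b' where ab: "a \<in> carrier R" "b \<in> carrier R" "a' \<in> carrier R" "a \<otimes> y = a' \<otimes> x"
      "b' \<in> carrier R" "b \<otimes> y = b' \<otimes> x" and eq: "r \<otimes> (a \<otimes> x) \<oplus> t \<otimes> (x \<oplus> b \<otimes> x) = \<zero>"
      using quasi_flat_pair_relation[OF qf[OF c(1,2)] c rel, of x] by blast
    have bP: "b \<in> P" by (rule A[OF n(1) ab(2,5,6)])
    have a'P: "a' \<in> P" by (rule A[OF n(2) ab(3,1) ab(4)[symmetric]])
    have "(\<one> \<oplus> b \<ominus> a') \<otimes> (t \<otimes> x) = (r \<otimes> (a \<otimes> x) \<oplus> t \<otimes> (x \<oplus> b \<otimes> x)) \<ominus> a \<otimes> (r \<otimes> x \<oplus> t \<otimes> y) \<oplus> t \<otimes> (a \<otimes> y \<ominus> a' \<otimes> x)"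
      using c ab(1,2,3) by algebra
    also have "\<dots> = \<zero>" unfolding eq rel ab(4) using c ab by (simp add: minus_eq r_neg)
    finally show ?thesis unfolding nzero_def using S_minus_P[OF S_plus_P[OF one_S bP] a'P] by blast
  qed
  show ?thesis
  proof (unfold_locales, intro conjI)
    fix x y r t
    assume c: "x \<in> carrier R" "y \<in> carrier R" and n: "\<not> ndvd x y" "\<not> ndvd y x"
      and rt: "r \<in> carrier R" "t \<in> carrier R" and rel: "r \<otimes> x \<oplus> t \<otimes> y = \<zero>"
    show tx: "nzero (t \<otimes> x)" by (rule near_tx[OF c rt n rel])
    have rel': "t \<otimes> y \<oplus> r \<otimes> x = \<zero>" using rel c rt by (simp add: a_comm)
    show ry: "nzero (r \<otimes> y)" by (rule near_tx[OF c(2,1) rt(2,1) n(2,1) rel'])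
    obtain a b b' where ab: "a \<in> carrier R" "b \<in> carrier R" "b' \<in> carrier R" "b \<otimes> y = b' \<otimes> x"
      and eq: "r \<otimes> (a \<otimes> y) \<oplus> t \<otimes> (y \<oplus> b \<otimes> y) = \<zero>"
      using quasi_flat_pair_relation[OF qf[OF c(1,2)] c rt rel, of y] by blast
    have bP: "b \<in> P" by (rule A[OF n(1) ab(2,3,4)])
    obtain f where f: "f \<in> S" "f \<otimes> (r \<otimes> y) = \<zero>" using ry by (auto simp: nzero_def)
    have fc: "f \<in> carrier R" using f by simp
    have "(f \<otimes> (\<one> \<oplus> b)) \<otimes> (t \<otimes> y) = f \<otimes> (r \<otimes> (a \<otimes> y) \<oplus> t \<otimes> (y \<oplus> b \<otimes> y)) \<ominus> a \<otimes> (f \<otimes> (r \<otimes> y))"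
      using c rt ab(1,2) fc by algebra
    also have "\<dots> = \<zero>" unfolding eq f(2) using fc ab by (simp add: minus_eq)
    finally show ty: "nzero (t \<otimes> y)"
      unfolding nzero_def using mult_S[OF f(1) S_plus_P[OF one_S bP]] by blast
    have "r \<otimes> x = (r \<otimes> x \<oplus> t \<otimes> y) \<oplus> \<ominus> \<one> \<otimes> (t \<otimes> y)" using c rt by algebra
    hence "r \<otimes> x = \<ominus> \<one> \<otimes> (t \<otimes> y)" unfolding rel using c rt by simp
    thus "nzero (r \<otimes> x)" using nzero_mult[OF _ _ ty, of "\<ominus> \<one>"] c rt by simp
  qed
qed

section \<open>Extending presentations\<close>

text \<open>The kernel of \<open>f\<close> is the syzygy module of the columns of \<open>f\<close>, and the given maps show \<open>pres 2\<close> for it. Near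
  each prime it satisfies \<open>pres 3\<close>, so that the last kernel is finitely generated there.\<close>
lemma (in cring) fqf_kernel_finitely_generated:
  assumes fqf: "fqf_ring R" and C: "finite C"
    and f: "finite I" "lin (vecs I) f" "f ` vecs I \<subseteq> vecs C"
    and g: "finite J" "lin (vecs J) g" "g ` vecs J = ker I f"
    and h: "finite L" "lin (vecs L) h" "h ` vecs L = ker J g"
  shows "\<exists>M m. finite M \<and> lin (vecs M) m \<and> m ` vecs M = ker L h"
proof (rule finitely_generated_if_locally[OF submod_ker[OF h(2)]])
  fix P assume P: "primeideal P R"
  interpret split_at_prime P R by (rule fqf_split_at_prime[OF fqf P])
  let ?x = "\<lambda>i. f (unit_vec i)"
  have kf: "ker I f = syz I ?x"
    unfolding syz_def ker_def using lin_eq_lincomb[OF f(1,2)] by (intro Collect_cong conj_cong HOL.refl) simp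
  have x: "?x i \<in> vecs C" if "i \<in> I" for i using f(3) unit_vec_vecs[OF that] by blast
  have s: "submod (ker I f)" "submod (ker J g)" by (rule submod_ker[OF f(2)], rule submod_ker[OF g(2)])
  have cg: "cover J g (ker I f)" unfolding cover_def using g near_refl[OF s(1)] by simp
  have ch: "cover L h (ker J g)" unfolding cover_def using h near_refl[OF s(2)] by simp
  have "pres (Suc (Suc 0)) (ker I f)"
    unfolding pres_Suc_cover[OF s(1) cg] pres_Suc_cover[OF s(2) ch] by simp
  hence "pres 2 (syz I ?x)" unfolding kf by (simp only: numeral_2_eq_2)
  hence "pres 3 (syz I ?x)" using pres_syz[of C I ?x] C f(1) x by blast
  hence "pres (Suc (Suc (Suc 0))) (ker I f)" unfolding kf by (simp only: numeral_3_eq_3)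
  hence "pres (Suc 0) (ker L h)" unfolding pres_Suc_cover[OF s(1) cg] pres_Suc_cover[OF s(2) ch] .
  then obtain M m where "cover M m (ker L h)" unfolding pres.simps by blast
  thus "\<exists>a\<in>carrier R - P. \<exists>I f. finite I \<and> lin (vecs I) f \<and> f ` vecs I \<subseteq> ker L h \<and>
      (\<forall>v\<in>ker L h. smul a v \<in> f ` vecs I)"
    unfolding cover_def near_def S_def by blast
qed

text \<open>The same for arbitrary free modules of finite rank, by passing to matrices.\<close>
lemma fqf_kernel_free:
  fixes R :: "('a, 'r) ring_scheme" and F0 F1 F2 F3 :: "('a, nat \<Rightarrow> 'a) module"
  assumes fqf: "fqf_ring R"
    and F: "free_of_finite_rank R F0" "free_of_finite_rank R F1" "free_of_finite_rank R F2" "free_of_finite_rank R F3"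
    and d: "d0 \<in> mod_hom R F1 F0" "d1 \<in> mod_hom R F2 F1" "d2 \<in> mod_hom R F3 F2"
    and ex: "d1 ` carrier F2 = mod_ker F1 F0 d0" "d2 ` carrier F3 = mod_ker F2 F1 d1"
  shows "\<exists>(F4 :: ('a, nat \<Rightarrow> 'a) module) d3. free_of_finite_rank R F4 \<and> d3 \<in> mod_hom R F4 F3 \<and>
    d3 ` carrier F4 = mod_ker F3 F2 d2"
proof -
  interpret cring R using fqf by (simp add: fqf_ring_def)
  obtain k0 p0 where p0: "p0 \<in> mod_iso R (vec_module R {..<k0}) F0" using free_of_finite_rank_vec_module[OF F(1)] by blast
  obtain k1 p1 where p1: "p1 \<in> mod_iso R (vec_module R {..<k1}) F1" using free_of_finite_rank_vec_module[OF F(2)] by blast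
  obtain k2 p2 where p2: "p2 \<in> mod_iso R (vec_module R {..<k2}) F2" using free_of_finite_rank_vec_module[OF F(3)] by blast
  obtain k3 p3 where p3: "p3 \<in> mod_iso R (vec_module R {..<k3}) F3" using free_of_finite_rank_vec_module[OF F(4)] by blast
  \<comment> \<open>A map between free modules and its matrix have corresponding kernels and images.\<close>
  define mat where "mat p k d q = inv_into (vecs {..<k}) p \<circ> d \<circ> q" 
    for p :: "(nat \<Rightarrow> 'a) \<Rightarrow> nat \<Rightarrow> 'a" and k :: nat and d q :: "(nat \<Rightarrow> 'a) \<Rightarrow> nat \<Rightarrow> 'a"
  have mat: "lin (vecs {..<l}) (mat p k d q) \<and> mat p k d q ` vecs {..<l} \<subseteq> vecs {..<k}"
      and mat_eq: "\<And>v. v \<in> vecs {..<l} \<Longrightarrow> p (mat p k d q v) = d (q v)"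
      and ker_mat: "q ` ker {..<l} (mat p k d q) = mod_ker F' F d"
    if p: "p \<in> mod_iso R (vec_module R {..<k}) F" and q: "q \<in> mod_iso R (vec_module R {..<l}) F'"
      and d: "d \<in> mod_hom R F' F" and mF: "module R F" for p k q l d and F F' :: "('a, nat \<Rightarrow> 'a) module"
  proof -
    have i: "inv_into (vecs {..<k}) p \<in> mod_iso R F (vec_module R {..<k})"
      using mod_iso_inv[OF module_vec_module p] by simp
    have "mat p k d q \<in> mod_hom R (vec_module R {..<l}) (vec_module R {..<k})"
      unfolding mat_def comp_assoc using i q d
      by (intro mod_hom_comp[OF mod_hom_comp]) (auto simp: mod_iso_def)
    thus lm: "lin (vecs {..<l}) (mat p k d q) \<and> mat p k d q ` vecs {..<l} \<subseteq> vecs {..<k}"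
      unfolding mod_hom_vec_module_iff .
    have pim: "p ` vecs {..<k} = carrier F" "inj_on p (vecs {..<k})" "p \<in> mod_hom R (vec_module R {..<k}) F"
      using p by (auto simp: mod_iso_def bij_betw_def)
    have qim: "q ` vecs {..<l} = carrier F'" using q by (auto simp: mod_iso_def bij_betw_def)
    have dF: "d z \<in> carrier F" if "z \<in> carrier F'" for z using d that by (auto simp: mod_hom_def)
    show eq: "p (mat p k d q v) = d (q v)" if "v \<in> vecs {..<l}" for v
    proof -
      have "q v \<in> carrier F'" using qim that by blast
      hence "d (q v) \<in> p ` vecs {..<k}" using dF pim(1) by simp
      thus ?thesis unfolding mat_def comp_def by (rule f_inv_into_f)
    qed
    have pz: "p vzero = \<zero>\<^bsub>F\<^esub>" using mod_hom_zero[OF module_vec_module mF pim(3)] by simp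
    have "mat p k d q v = vzero \<longleftrightarrow> d (q v) = \<zero>\<^bsub>F\<^esub>" if v: "v \<in> vecs {..<l}" for v
    proof -
      have "mat p k d q v \<in> vecs {..<k}" using lm v by blast
      hence "p (mat p k d q v) = p vzero \<longleftrightarrow> mat p k d q v = vzero"
        using inj_on_eq_iff[OF pim(2), of "mat p k d q v" vzero] by simp
      thus ?thesis unfolding eq[OF v] pz by blast
    qed
    thus "q ` ker {..<l} (mat p k d q) = mod_ker F' F d"
      unfolding ker_def mod_ker_def qim[symmetric] by blast
  qed
  have m: "module R F0" "module R F1" "module R F2" "module R F3"
    using F by (auto simp: free_of_finite_rank_def)
  let ?f = "mat p0 k0 d0 p1" and ?g = "mat p1 k1 d1 p2" and ?h = "mat p2 k2 d2 p3"
  have exact: "mat p k d q ` vecs {..<l} = ker {..<k} (mat p' k' d' p)"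
    if p: "p \<in> mod_iso R (vec_module R {..<k}) F" and q: "q \<in> mod_iso R (vec_module R {..<l}) F'"
      and p': "p' \<in> mod_iso R (vec_module R {..<k'}) F''"
      and d: "d \<in> mod_hom R F' F" and d': "d' \<in> mod_hom R F F''" and mod: "module R F" "module R F''"
      and e: "d ` carrier F' = mod_ker F F'' d'"
    for p k q l d p' k' d' and F F' F'' :: "('a, nat \<Rightarrow> 'a) module"
  proof -
    have inj: "inj_on p (vecs {..<k})" using p by (auto simp: mod_iso_def bij_betw_def)
    have qim: "q ` vecs {..<l} = carrier F'" using q by (auto simp: mod_iso_def bij_betw_def)
    have "p ` mat p k d q ` vecs {..<l} = d ` q ` vecs {..<l}"
      unfolding image_image using mat_eq[OF p q d mod(1)] by (intro image_cong HOL.refl)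
    also have "\<dots> = p ` ker {..<k} (mat p' k' d' p)" unfolding qim e ker_mat[OF p' p d' mod(2)] ..
    finally show ?thesis
      using inj_on_image_eq_iff[OF inj, of "mat p k d q ` vecs {..<l}" "ker {..<k} (mat p' k' d' p)"]
        mat[OF p q d mod(1)] by (simp add: ker_def)
  qed
  have "\<exists>M m. finite M \<and> lin (vecs M) m \<and> m ` vecs M = ker {..<k3} ?h"
  proof (rule fqf_kernel_finitely_generated[OF fqf, of "{..<k0}" "{..<k1}" ?f "{..<k2}" ?g])
    show "?g ` vecs {..<k2} = ker {..<k1} ?f" by (rule exact[OF p1 p2 p0 d(2,1) m(2,1) ex(1)])
    show "?h ` vecs {..<k3} = ker {..<k2} ?g" by (rule exact[OF p2 p3 p1 d(3,2) m(3,2) ex(2)])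
  qed (use mat[OF p0 p1 d(1) m(1)] mat[OF p1 p2 d(2) m(2)] mat[OF p2 p3 d(3) m(3)] in auto)
  then obtain M t where t: "finite M" "lin (vecs M) t" "t ` vecs M = ker {..<k3} ?h" by blast
  have "t \<in> mod_hom R (vec_module R M) (vec_module R {..<k3})"
    unfolding mod_hom_vec_module_iff using t by (auto simp: ker_def)
  hence "p3 \<circ> t \<in> mod_hom R (vec_module R M) F3"
    using p3 by (intro mod_hom_comp) (auto simp: mod_iso_def)
  moreover have "(p3 \<circ> t) ` carrier (vec_module R M) = mod_ker F3 F2 d2"
    unfolding image_comp[symmetric] vec_module_simps t(3) by (rule ker_mat[OF p2 p3 d(3) m(3)])
  ultimately show ?thesis using free_vec_module[OF t(1)] by blast
qed

lemma fqf_finitely_n_presented_Suc: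
  assumes fqf: "fqf_ring R" and n: "3 \<le> n" and E: "finitely_n_presented R n E"
  shows "finitely_n_presented R (Suc n) E"
proof -
  obtain F :: "nat \<Rightarrow> ('a, nat \<Rightarrow> 'a) module" and d e where mE: "module R E" and P: "finite_n_presentation R n F d e E"
    using E by (auto simp: finitely_n_presented_def)
  obtain j where "n = 3 + j" using n le_Suc_ex by blast
  hence j: "n = Suc (Suc (Suc j))" by simp
  have F: "\<And>i. i \<le> n \<Longrightarrow> free_of_finite_rank R (F i)" and d: "\<And>i. i < n \<Longrightarrow> d i \<in> mod_hom R (F (Suc i)) (F i)"
    and ex: "\<And>i. Suc i < n \<Longrightarrow> d (Suc i) ` carrier (F (Suc (Suc i))) = mod_ker (F (Suc i)) (F i) (d i)"
    using P unfolding finite_n_presentation_def by blast+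
  have F': "free_of_finite_rank R (F j)" "free_of_finite_rank R (F (Suc j))"
    "free_of_finite_rank R (F (Suc (Suc j)))" "free_of_finite_rank R (F n)"
    by (rule F, simp add: j)+
  have d': "d j \<in> mod_hom R (F (Suc j)) (F j)" "d (Suc j) \<in> mod_hom R (F (Suc (Suc j))) (F (Suc j))"
    "d (Suc (Suc j)) \<in> mod_hom R (F n) (F (Suc (Suc j)))"
    using d[of j] d[of "Suc j"] d[of "Suc (Suc j)"] by (simp_all add: j)
  have ex': "d (Suc j) ` carrier (F (Suc (Suc j))) = mod_ker (F (Suc j)) (F j) (d j)"
    "d (Suc (Suc j)) ` carrier (F n) = mod_ker (F (Suc (Suc j))) (F (Suc j)) (d (Suc j))"
    using ex[of j] ex[of "Suc j"] by (simp_all add: j)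
  obtain F4 :: "('a, nat \<Rightarrow> 'a) module" and d3 where F4: "free_of_finite_rank R F4" "d3 \<in> mod_hom R F4 (F n)"
    "d3 ` carrier F4 = mod_ker (F n) (F (Suc (Suc j))) (d (Suc (Suc j)))"
    using fqf_kernel_free[OF fqf F' d' ex'] by blast
  let ?F = "F(Suc n := F4)" and ?d = "d(n := d3)"
  have "finite_n_presentation R (Suc n) ?F ?d e E"
    unfolding finite_n_presentation_def
  proof (intro conjI allI impI)
    show "free_of_finite_rank R (?F i)" if "i \<le> Suc n" for i using F[of i] F4(1) that by auto
    show "e \<in> mod_epi R (?F 0) E" using P by (simp add: finite_n_presentation_def)
    show "?d i \<in> mod_hom R (?F (Suc i)) (?F i)" if "i < Suc n" for i
      using d[of i] F4(2) that by (cases "i = n") auto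
    show "?d 0 ` carrier (?F 1) = mod_ker (?F 0) E e" using P j by (simp add: finite_n_presentation_def)
    show "?d (Suc i) ` carrier (?F (Suc (Suc i))) = mod_ker (?F (Suc i)) (?F i) (?d i)" if "Suc i < Suc n" for i
      using ex[of i] F4(3) that j by (cases "Suc i = n") auto
  qed
  thus ?thesis using mE unfolding finitely_n_presented_def by blast
qed

theorem theorem4p7:
  fixes R :: "('a, 'r) ring_scheme"
  assumes "fqf_ring R"
  shows "lambda_dim TYPE('e) R \<le> 3"
proof -
  have "module_lambda R E = \<infinity>" if E: "ereal (real 3) \<le> module_lambda R E" for E :: "('a, 'e) module"
  proof -
    have fg: "finitely_generated_module R E"
    proof (rule ccontr)
      assume "\<not> ?thesis"
      hence "module_lambda R E = -1" by (simp add: module_lambda_def)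
      hence "ereal (real 3) \<le> ereal (-1)" using E by (metis one_ereal_def uminus_ereal.simps(1))
      thus False by simp
    qed
    hence l: "module_lambda R E = Sup {ereal (real n) |n. finitely_n_presented R n E}"
      by (simp add: module_lambda_def)
    have "\<exists>n\<ge>3. finitely_n_presented R n E"
    proof (rule ccontr)
      assume no: "\<not> ?thesis"
      have "Sup {ereal (real n) |n. finitely_n_presented R n E} \<le> ereal (real 2)"
      proof (rule Sup_least)
        fix z assume "z \<in> {ereal (real n) |n. finitely_n_presented R n E}"
        then obtain n where n: "z = ereal (real n)" "finitely_n_presented R n E" by blast
        have "\<not> 3 \<le> n" using no n(2) by blast
        hence "n \<le> 2" by simp
        thus "z \<le> ereal (real 2)" unfolding n(1) by simp
      qed
      hence "ereal (real 3) \<le> ereal (real 2)" using E unfolding l by (rule order_trans[rotated])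
      thus False by simp
    qed
    then obtain n where n: "3 \<le> n" "finitely_n_presented R n E" by blast
    have all: "finitely_n_presented R (n + k) E" for k
    proof (induction k)
      case (Suc k)
      thus ?case using fqf_finitely_n_presented_Suc[OF assms, of "n + k" E] n(1) by simp
    qed (use n in simp)
    show ?thesis
      unfolding l
    proof (rule ereal_top)
      fix B :: real
      obtain k where "B \<le> real k" using real_arch_simple by blast
      hence "ereal B \<le> ereal (real (n + k))" by simp
      also have "\<dots> \<le> Sup {ereal (real n) |n. finitely_n_presented R n E}"
        using all[of k] by (intro Sup_upper) blast
      finally show "ereal B \<le> Sup {ereal (real n) |n. finitely_n_presented R n E}" .
    qed
  qed
  hence "lambda_dim TYPE('e) R \<le> enat 3"
    unfolding lambda_dim_def by (intro Inf_lower) blast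
  thus ?thesis by (simp add: numeral_eq_enat)
qed

end
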